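(* Let $U$ be a consistent c.e. theory and $\mathcal X$ a set of sentences, and suppose $U$ is effectively ef-essentially $\mathcal X$-incomplete w.r.t. $N$ and $\xi$. Then $U$ is effectively essentially $\mathcal X$-incomplete via a witnessing partial computable function $\Phi$ such that each value $\Phi(i)$ is of the form $\xi(\ulcorner\sigma\urcorner)$ for some sentence $\sigma$.
   Context: $\mathsf{R}$ is the Tarski–Mostowski–Robinson theory of weak arithmetic. $\mathsf W_0,\mathsf W_1,\dots$ is a standard enumeration of c.e. sets; sentences are identified with Gödel numbers. Given an interpretation $N$ of $\mathsf R$ in $U$ (treated as one-dimensional for notational simplicity) and a $U$-formula $\xi(x)$, $\xi(\ulcorner\phi\urcorner)$ denotes $\xi$ applied to the $N$-translation of the numeral of the Gödel number of $\phi$. $U$ is effectively ef-essentially $\mathcal X$-incomplete w.r.t. $N$ and $\xi$ iff $N$ is an interpretation of $\mathsf R$ in $U$ and for every sentence $\phi$ with $U\cup\{\phi\}$ consistent, $\xi(\ulcorner\phi\urcorner)$ is independent of $U\cup\{\phi\}$ and belongs to $\mathcal X$. $U$ is effectively essentially $\mathcal X$-incomplete via $\Phi$ iff $\Phi$ is partial computable and for every $i$ such that $\mathsf W_i$ is a consistent extension of $U$ (a set of sentences of the language of $U$ proving all axioms of $U$), $\Phi(i)$ converges, $\Phi(i)\in\mathcal X$, and $\Phi(i)$ is independent of $\mathsf W_i$. *)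

theory Defs
  imports Main "HOL-Library.Nat_Bijection"
begin

section \<open>First-order logic with equality\<close>

text \<open>Formulas use de Bruijn indices. A symbol is a pair of a number and an arity; the arity of an
  occurrence is the length of its argument list.\<close>

datatype tm = Var nat | Fun nat "tm list"

datatype fm = Bot | Eq tm tm | Rel nat "tm list" | Imp fm fm | All fm

definition Neg :: "fm \<Rightarrow> fm" where "Neg p = Imp p Bot"
definition Or :: "fm \<Rightarrow> fm \<Rightarrow> fm" where "Or p q = Imp (Neg p) q"
definition And :: "fm \<Rightarrow> fm \<Rightarrow> fm" where "And p q = Neg (Imp p (Neg q))"
definition Ex :: "fm \<Rightarrow> fm" where "Ex p = Neg (All (Neg p))"
definition Conj :: "fm list \<Rightarrow> fm" where "Conj ps = foldr And ps (Neg Bot)"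
definition Disj :: "fm list \<Rightarrow> fm" where "Disj ps = foldr Or ps Bot"
definition Exs :: "nat \<Rightarrow> fm \<Rightarrow> fm" where "Exs n p = (Ex ^^ n) p"

record sig =
  funs :: "(nat \<times> nat) set"
  rels :: "(nat \<times> nat) set"

text \<open>\<open>wft L k t\<close> and \<open>wff L k p\<close>: only symbols of \<open>L\<close> occur, and all free variables are
  below \<open>k\<close>.\<close>

fun wft :: "sig \<Rightarrow> nat \<Rightarrow> tm \<Rightarrow> bool" where
  "wft L k (Var i) = (i < k)"
| "wft L k (Fun f ts) = ((f, length ts) \<in> funs L \<and> (\<forall>t\<in>set ts. wft L k t))"

primrec wff :: "sig \<Rightarrow> nat \<Rightarrow> fm \<Rightarrow> bool" where
  "wff L k Bot = True"
| "wff L k (Eq s t) = (wft L k s \<and> wft L k t)"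
| "wff L k (Rel r ts) = ((r, length ts) \<in> rels L \<and> (\<forall>t\<in>set ts. wft L k t))"
| "wff L k (Imp p q) = (wff L k p \<and> wff L k q)"
| "wff L k (All p) = wff L (Suc k) p"

definition Sent :: "sig \<Rightarrow> fm set" where
  "Sent L = {p. wff L 0 p}"

primrec tsubst :: "(nat \<Rightarrow> tm) \<Rightarrow> tm \<Rightarrow> tm" where
  "tsubst s (Var i) = s i"
| "tsubst s (Fun f ts) = Fun f (map (tsubst s) ts)"

primrec fsubst :: "(nat \<Rightarrow> tm) \<Rightarrow> fm \<Rightarrow> fm" where
  "fsubst s Bot = Bot"
| "fsubst s (Eq t u) = Eq (tsubst s t) (tsubst s u)"
| "fsubst s (Rel r ts) = Rel r (map (tsubst s) ts)"
| "fsubst s (Imp p q) = Imp (fsubst s p) (fsubst s q)"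
| "fsubst s (All p) =
     All (fsubst (case_nat (Var 0) (\<lambda>i. tsubst (\<lambda>j. Var (Suc j)) (s i))) p)"

definition lift :: "fm \<Rightarrow> fm" where
  "lift p = fsubst (\<lambda>i. Var (Suc i)) p"

definition inst :: "fm \<Rightarrow> tm \<Rightarrow> fm" where
  "inst p t = fsubst (case_nat t Var) p"

text \<open>Classical natural deduction. Derivations may use symbols outside the language of the theory;
  this is conservative, so no language parameter is needed.\<close>

inductive proves :: "fm set \<Rightarrow> fm \<Rightarrow> bool" (infix \<open>\<turnstile>\<close> 50) where
  assm: "p \<in> \<Gamma> \<Longrightarrow> \<Gamma> \<turnstile> p"
| impI: "insert p \<Gamma> \<turnstile> q \<Longrightarrow> \<Gamma> \<turnstile> Imp p q"
| impE: "\<Gamma> \<turnstile> Imp p q \<Longrightarrow> \<Gamma> \<turnstile> p \<Longrightarrow> \<Gamma> \<turnstile> q"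
| raa: "insert (Neg p) \<Gamma> \<turnstile> Bot \<Longrightarrow> \<Gamma> \<turnstile> p"
| allI: "lift ` \<Gamma> \<turnstile> p \<Longrightarrow> \<Gamma> \<turnstile> All p"
| allE: "\<Gamma> \<turnstile> All p \<Longrightarrow> \<Gamma> \<turnstile> inst p t"
| refl: "\<Gamma> \<turnstile> Eq t t"
| leibniz: "\<Gamma> \<turnstile> Eq s t \<Longrightarrow> \<Gamma> \<turnstile> inst p s \<Longrightarrow> \<Gamma> \<turnstile> inst p t"

definition consistent :: "fm set \<Rightarrow> bool" where
  "consistent T \<longleftrightarrow> \<not> T \<turnstile> Bot"

definition independent :: "fm set \<Rightarrow> fm \<Rightarrow> bool" where
  "independent T p \<longleftrightarrow> \<not> T \<turnstile> p \<and> \<not> T \<turnstile> Neg p"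

section \<open>Goedel numbers\<close>

primrec gnt :: "tm \<Rightarrow> nat" where
  "gnt (Var i) = prod_encode (0, i)"
| "gnt (Fun f ts) = prod_encode (Suc f, list_encode (map gnt ts))"

primrec gn :: "fm \<Rightarrow> nat" where
  "gn Bot = prod_encode (0, 0)"
| "gn (Eq s t) = prod_encode (1, prod_encode (gnt s, gnt t))"
| "gn (Rel r ts) = prod_encode (2, prod_encode (r, list_encode (map gnt ts)))"
| "gn (Imp p q) = prod_encode (3, prod_encode (gn p, gn q))"
| "gn (All p) = prod_encode (4, gn p)"

lemma gnt_inj: "gnt s = gnt t \<Longrightarrow> s = t"
proof (induction s arbitrary: t)
  case (Var i)
  then show ?case by (cases t) auto
next
  case (Fun f ts)
  then obtain us where t: "t = Fun f us" and e: "map gnt ts = map gnt us"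
    by (cases t) (auto dest: injD[OF inj_list_encode])
  have "ts = us"
    using e Fun.IH by (simp add: list_eq_iff_nth_eq)
  then show ?case using t by simp
qed

lemma gn_inj: "gn p = gn q \<Longrightarrow> p = q"
proof (induction p arbitrary: q)
  case (Rel r ts)
  have "inj gnt" by (auto intro: injI gnt_inj)
  with Rel show ?case by (cases q) (auto dest!: injD[OF inj_list_encode] simp: inj_map_eq_map)
qed (case_tac q, auto dest: gnt_inj)+

section \<open>Partial recursive functions and c.e. sets\<close>

datatype recf = Zero | Succ | Proj nat | Comp recf "recf list" | Prec recf recf | Mu recf

text \<open>\<open>ev f xs y\<close>: the function defined by \<open>f\<close> converges on the arguments \<open>xs\<close> with value \<open>y\<close>.
  Codes carry no arity; an application that makes no sense diverges.\<close>

inductive ev :: "recf \<Rightarrow> nat list \<Rightarrow> nat \<Rightarrow> bool" where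
  "ev Zero xs 0"
| "ev Succ [x] (Suc x)"
| "i < length xs \<Longrightarrow> ev (Proj i) xs (xs ! i)"
| "list_all2 (\<lambda>g y. ev g xs y) gs ys \<Longrightarrow> ev f ys z \<Longrightarrow> ev (Comp f gs) xs z"
| "ev f xs y \<Longrightarrow> ev (Prec f g) (0 # xs) y"
| "ev (Prec f g) (n # xs) r \<Longrightarrow> ev g (n # r # xs) y \<Longrightarrow> ev (Prec f g) (Suc n # xs) y"
| "ev f (n # xs) 0 \<Longrightarrow> (\<forall>m<n. \<exists>r. ev f (m # xs) (Suc r)) \<Longrightarrow> ev (Mu f) xs n"

primrec code :: "recf \<Rightarrow> nat" where
  "code Zero = prod_encode (0, 0)"
| "code Succ = prod_encode (1, 0)"
| "code (Proj i) = prod_encode (2, i)"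
| "code (Comp f gs) = prod_encode (3, prod_encode (code f, list_encode (map code gs)))"
| "code (Prec f g) = prod_encode (4, prod_encode (code f, code g))"
| "code (Mu f) = prod_encode (5, code f)"

definition partial_computable :: "(nat \<Rightarrow> nat option) \<Rightarrow> bool" where
  "partial_computable \<Phi> \<longleftrightarrow> (\<exists>f. \<forall>x y. \<Phi> x = Some y \<longleftrightarrow> ev f [x] y)"

text \<open>The domain of the \<open>i\<close>-th unary partial recursive function, which is empty if \<open>i\<close> is not a
  code.\<close>

definition W :: "nat \<Rightarrow> nat set" where
  "W i = {x. \<exists>f y. code f = i \<and> ev f [x] y}"

definition ce_theory :: "sig \<Rightarrow> fm set \<Rightarrow> bool" where
  "ce_theory L U \<longleftrightarrow> U \<subseteq> Sent L \<and> (\<exists>i. W i = gn ` U)"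

section \<open>The theory R\<close>

text \<open>The order is a primitive symbol with only the two usual axiom schemes, so that an
  interpretation of the variant of R in which the order is defined from addition also yields one
  of this R, with the same numerals.\<close>

definition sigA :: sig where
  "sigA = \<lparr>funs = {(0, 0), (1, 1), (2, 2), (3, 2)}, rels = {(0, 2)}\<rparr>"

definition zero_tm :: tm where "zero_tm = Fun 0 []"
definition suc_tm :: "tm \<Rightarrow> tm" where "suc_tm t = Fun 1 [t]"
definition plus_tm :: "tm \<Rightarrow> tm \<Rightarrow> tm" where "plus_tm s t = Fun 2 [s, t]"
definition times_tm :: "tm \<Rightarrow> tm \<Rightarrow> tm" where "times_tm s t = Fun 3 [s, t]"
definition le_fm :: "tm \<Rightarrow> tm \<Rightarrow> fm" where "le_fm s t = Rel 0 [s, t]"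

definition num_tm :: "nat \<Rightarrow> tm" where
  "num_tm n = (suc_tm ^^ n) zero_tm"

definition R :: "fm set" where
  "R = {Eq (plus_tm (num_tm m) (num_tm n)) (num_tm (m + n)) | m n. True}
     \<union> {Eq (times_tm (num_tm m) (num_tm n)) (num_tm (m * n)) | m n. True}
     \<union> {Neg (Eq (num_tm m) (num_tm n)) | m n. m \<noteq> n}
     \<union> {All (Imp (le_fm (Var 0) (num_tm n))
               (Disj (map (\<lambda>k. Eq (Var 0) (num_tm k)) [0..<Suc n]))) | n. True}
     \<union> {All (Or (le_fm (Var 0) (num_tm n)) (le_fm (num_tm n) (Var 0))) | n. True}"

section \<open>Interpretations\<close>

text \<open>One-dimensional, parameter-free, relativized, with equality not necessarily absolute. An
  \<open>n\<close>-ary function symbol is interpreted by its graph: variables \<open>0,\<dots>,n-1\<close> are the arguments,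
  variable \<open>n\<close> is the value.\<close>

record interp =
  dom :: fm
  eqf :: fm
  funf :: "nat \<Rightarrow> nat \<Rightarrow> fm"
  relf :: "nat \<Rightarrow> nat \<Rightarrow> fm"

definition wf_interp :: "sig \<Rightarrow> sig \<Rightarrow> interp \<Rightarrow> bool" where
  "wf_interp LV LU N \<longleftrightarrow> wff LU 1 (dom N) \<and> wff LU 2 (eqf N)
     \<and> (\<forall>(f, n) \<in> funs LV. wff LU (Suc n) (funf N f n))
     \<and> (\<forall>(r, n) \<in> rels LV. wff LU n (relf N r n))"

text \<open>Nested terms are unravelled. If \<open>vs\<close> lists, for each of \<open>n\<close> argument terms, the formula
  "the term has value \<open>y\<close>" as a function of an offset for the variables of the term and of \<open>y\<close>,
  then \<open>unravel N d vs p\<close> says that the arguments have values \<open>0,\<dots>,n-1\<close> in the domain for which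
  \<open>p\<close> holds.\<close>

definition unravel :: "interp \<Rightarrow> nat \<Rightarrow> (nat \<Rightarrow> nat \<Rightarrow> fm) list \<Rightarrow> fm \<Rightarrow> fm" where
  "unravel N d vs p = (let n = length vs in
     Exs n (And (Conj (map2 (\<lambda>i v. And (fsubst (\<lambda>_. Var i) (dom N)) (v (d + n) i)) [0..<n] vs)) p))"

primrec val :: "interp \<Rightarrow> tm \<Rightarrow> nat \<Rightarrow> nat \<Rightarrow> fm" where
  "val N (Var i) = (\<lambda>d y. fsubst (case_nat (Var (i + d)) (\<lambda>_. Var y)) (eqf N))"
| "val N (Fun f ts) = (\<lambda>d y. unravel N d (map (val N) ts)
     (fsubst (\<lambda>j. if j < length ts then Var j else Var (y + length ts)) (funf N f (length ts))))"

primrec transl :: "interp \<Rightarrow> fm \<Rightarrow> fm" where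
  "transl N Bot = Bot"
| "transl N (Eq s t) = unravel N 0 [val N s, val N t] (eqf N)"
| "transl N (Rel r ts) = unravel N 0 (map (val N) ts) (relf N r (length ts))"
| "transl N (Imp p q) = Imp (transl N p) (transl N q)"
| "transl N (All p) = All (Imp (dom N) (transl N p))"

definition interpretation_of :: "sig \<Rightarrow> fm set \<Rightarrow> sig \<Rightarrow> fm set \<Rightarrow> interp \<Rightarrow> bool" where
  "interpretation_of LV V LU U N \<longleftrightarrow>
     wf_interp LV LU N \<and> (\<forall>p \<in> Sent LV. V \<turnstile> p \<longrightarrow> U \<turnstile> transl N p)"

text \<open>\<open>at_gn N \<xi> p\<close> is \<open>\<xi>\<close> applied to the numeral, in the sense of \<open>N\<close>, of the Goedel number of
  \<open>p\<close>. As this numeral need not be a term of the interpreting theory, it is eliminated in favour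
  of a quantifier over the domain.\<close>

definition at_gn :: "interp \<Rightarrow> fm \<Rightarrow> fm \<Rightarrow> fm" where
  "at_gn N \<xi> p = Ex (And (dom N) (And (transl N (Eq (Var 0) (num_tm (gn p)))) \<xi>))"

section \<open>Effective essential incompleteness\<close>

definition eff_ef_ess_incomplete :: "sig \<Rightarrow> fm set \<Rightarrow> fm set \<Rightarrow> interp \<Rightarrow> fm \<Rightarrow> bool" where
  "eff_ef_ess_incomplete L U X N \<xi> \<longleftrightarrow>
     interpretation_of sigA R L U N \<and> wff L 1 \<xi> \<and>
     (\<forall>p \<in> Sent L. consistent (insert p U) \<longrightarrow>
        independent (insert p U) (at_gn N \<xi> p) \<and> at_gn N \<xi> p \<in> X)"

definition extends :: "sig \<Rightarrow> fm set \<Rightarrow> fm set \<Rightarrow> bool" where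
  "extends L T U \<longleftrightarrow> T \<subseteq> Sent L \<and> (\<forall>p \<in> U. T \<turnstile> p)"

definition eff_ess_incomplete_via ::
  "sig \<Rightarrow> fm set \<Rightarrow> fm set \<Rightarrow> (nat \<Rightarrow> nat option) \<Rightarrow> bool" where
  "eff_ess_incomplete_via L U X \<Phi> \<longleftrightarrow> partial_computable \<Phi> \<and>
     (\<forall>i T. W i = gn ` T \<and> consistent T \<and> extends L T U \<longrightarrow>
        (\<exists>p \<in> X. \<Phi> i = Some (gn p) \<and> independent T p))"

end

theory Submission
  imports Defs
begin

text \<open>Fix an index \<open>i\<close> of a consistent extension \<open>T\<close> of \<open>U\<close>. By the diagonal lemma there is a sentence
  \<open>\<sigma>\<close> saying: if a proof of \<open>\<xi>(\<sigma>)\<close> from \<open>T\<close> is found before any refutation of \<open>\<sigma>\<close>, then \<open>\<xi>(\<sigma>)\<close>; if a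
  refutation of \<open>\<xi>(\<sigma>)\<close> is found before any refutation of \<open>\<sigma>\<close>, then \<open>\<not> \<xi>(\<sigma>)\<close>. If \<open>T\<close> refuted \<open>\<sigma>\<close>, both
  Rosser comparisons would be decided in \<open>R\<close>, and in each case \<open>T\<close> would prove \<open>\<sigma>\<close>. So \<open>\<sigma>\<close> is
  consistent with \<open>U\<close>, hence \<open>\<xi>(\<sigma>)\<close> lies in \<open>X\<close> and is independent of \<open>U + \<sigma>\<close>. But if \<open>T\<close> decided
  \<open>\<xi>(\<sigma>)\<close>, then \<open>U + \<sigma>\<close> would decide it in the same way. The map \<open>\<Phi>\<close> sends \<open>i\<close> to \<open>\<xi>(\<sigma>)\<close>.

  Provability in \<open>R\<close> and in \<open>U\<close> is obtained from the completeness theorem. Provability from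
  \<open>W i\<close> is made \<open>\<Sigma>\<^sub>1\<close> through a logic program over Goedel numbers, whose derivations are coded
  by divisibility.\<close>

section \<open>Completeness\<close>

text \<open>One computable map has to serve all indices, although each \<open>W i\<close> calls for
  its own diagonal sentence. Hence a single formula \<open>\<beta>\<close> is applied to the numbers
  \<open>prod_encode (gn \<beta>, i)\<close>: the index is a parameter of the fixed point, and
  \<open>\<Phi>\<close> only has to insert numerals. The comparison with refutations of
  \<open>\<sigma>\<close> is there because the hypothesis speaks only of sentences consistent with
  \<open>U\<close>, and this consistency has to be secured before anything about
  \<open>\<xi>(\<sigma>)\<close> is known. R has no induction and says almost nothing about
  nonstandard elements, so every formula must be arranged such that nonstandard witnesses do no
  harm. Completeness turns this into reasoning about the standard initial segment of a model, where
  bounded formulas are absolute. One fixed logic program treats evaluation of recursive functions,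
  syntax and provability uniformly: its soundness is an invariant, its completeness an induction,
  and boundedness has to be checked only once, for codes of derivations. Divisibility is used for
  these codes because it is bounded-definable from multiplication alone, without
  exponentiation.\<close>

definition up :: "(nat \<Rightarrow> tm) \<Rightarrow> nat \<Rightarrow> tm" where
  "up s = case_nat (Var 0) (\<lambda>i. tsubst (\<lambda>j. Var (Suc j)) (s i))"

lemma up_simps [simp]: "up s 0 = Var 0" "up s (Suc i) = tsubst (\<lambda>j. Var (Suc j)) (s i)"
  by (auto simp: up_def)

text \<open>Replaces the defining equation for \<open>All\<close> in the simpset, so that the
  substitution beneath a binder stays folded as \<open>up s\<close>.\<close>

lemma fsubst_All [simp]: "fsubst s (All p) = All (fsubst (up s) p)"
  by (simp add: up_def)

declare fsubst.simps(5) [simp del]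

lemma fsubst_Neg [simp]: "fsubst s (Neg p) = Neg (fsubst s p)"
  by (simp add: Neg_def)

lemma tsubst_tsubst [simp]: "tsubst s (tsubst r t) = tsubst (\<lambda>i. tsubst s (r i)) t"
  by (induction t) auto

lemma tsubst_up: "(\<lambda>i. tsubst (up s) (up r i)) = up (\<lambda>i. tsubst s (r i))"
  by (rule ext, case_tac i) auto

lemma fsubst_fsubst [simp]: "fsubst s (fsubst r p) = fsubst (\<lambda>i. tsubst s (r i)) p"
  by (induction p arbitrary: s r) (auto simp: tsubst_up)

lemma tsubst_Var [simp]: "tsubst Var t = t"
  by (induction t) (auto simp: map_idI)

lemma up_Var [simp]: "up Var = Var"
  by (rule ext, case_tac x) auto

lemma fsubst_Var [simp]: "fsubst Var p = p"
  by (induction p) (auto simp: map_idI)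

lemma fsubst_inst: "fsubst s (inst p t) = inst (fsubst (up s) p) (tsubst s t)"
  unfolding inst_def fsubst_fsubst
  by (rule arg_cong[where f = "\<lambda>r. fsubst r p"]) (auto split: nat.split)

lemma fsubst_lift: "fsubst (up s) (lift p) = lift (fsubst s p)"
  by (simp add: lift_def)

text \<open>Instantiating a quantifier amounts to extending the substitution by a term; the
  quantifier case of the truth lemma rests on this.\<close>

lemma inst_fsubst_up: "inst (fsubst (up s) p) t = fsubst (case_nat t s) p"
  unfolding inst_def fsubst_fsubst
  by (rule arg_cong[where f = "\<lambda>r. fsubst r p"]) (auto split: nat.split)

lemma wft_mono: "wft L k t \<Longrightarrow> k \<le> m \<Longrightarrow> wft L m t"
  by (induction t) auto

lemma wff_mono: "wff L k p \<Longrightarrow> k \<le> m \<Longrightarrow> wff L m p"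
proof (induction p arbitrary: k m)
  case (All p)
  then show ?case using All.IH[of "Suc k" "Suc m"] by simp
qed (auto intro: wft_mono)

lemma tsubst_cong: "wft L k t \<Longrightarrow> (\<And>i. i < k \<Longrightarrow> s i = r i) \<Longrightarrow> tsubst s t = tsubst r t"
  by (induction t) auto

lemma fsubst_cong: "wff L k p \<Longrightarrow> (\<And>i. i < k \<Longrightarrow> s i = r i) \<Longrightarrow> fsubst s p = fsubst r p"
proof (induction p arbitrary: k s r)
  case (All p)
  have "fsubst (up s) p = fsubst (up r) p"
    using All.prems by (intro All.IH[of "Suc k"]) (auto simp: less_Suc_eq_0_disj)
  then show ?case by simp
next
  case (Imp p q)
  have "fsubst s p = fsubst r p" "fsubst s q = fsubst r q"
    using Imp.prems by (intro Imp.IH[of k]; simp)+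
  then show ?case by simp
qed (auto intro: tsubst_cong)

lemma wft_tsubst: "wft L k t \<Longrightarrow> (\<And>i. i < k \<Longrightarrow> wft L m (s i)) \<Longrightarrow> wft L m (tsubst s t)"
  by (induction t) auto

lemma wff_fsubst: "wff L k p \<Longrightarrow> (\<And>i. i < k \<Longrightarrow> wft L m (s i)) \<Longrightarrow> wff L m (fsubst s p)"
proof (induction p arbitrary: k m s)
  case (All p)
  have "wff L (Suc m) (fsubst (up s) p)"
    using All.prems
    by (intro All.IH[of "Suc k"]) (auto simp: less_Suc_eq_0_disj intro!: wft_tsubst)
  then show ?case by simp
qed (auto intro: wft_tsubst)

text \<open>Derivations may use any symbols, so over this signature \<open>wff full k\<close> is
  purely a bound on the free variables. It provides the fresh variables of the Henkin
  construction.\<close>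

definition full :: sig where "full = \<lparr>funs = UNIV, rels = UNIV\<rparr>"

lemma full_simps [simp]: "x \<in> funs full" "x \<in> rels full"
  by (auto simp: full_def)

lemma wft_full: "wft L k t \<Longrightarrow> wft full k t"
  by (induction t) auto

lemma wff_full: "wff L k p \<Longrightarrow> wff full k p"
  by (induction p arbitrary: k) (auto intro: wft_full)

lemma ex_bound_list:
  assumes "\<And>x. x \<in> set xs \<Longrightarrow> \<exists>k::nat. P k x" and "\<And>k m x. P k x \<Longrightarrow> k \<le> m \<Longrightarrow> P m x"
  shows "\<exists>k. \<forall>x \<in> set xs. P k x"
  using assms(1)
proof (induction xs)
  case (Cons a xs)
  have "\<exists>k. P k a" "\<exists>m. \<forall>x \<in> set xs. P m x"
    using Cons by (simp_all add: Cons.IH)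
  then obtain k m where "P k a" "\<forall>x \<in> set xs. P m x" by blast
  then have "\<forall>x \<in> set (a # xs). P (max k m) x"
    by (auto intro: assms(2)[OF _ max.cobounded1] assms(2)[OF _ max.cobounded2])
  then show ?case ..
qed simp

lemma ex_wft_full: "\<exists>k. wft full k t"
proof (induction t)
  case (Var i)
  show ?case by (auto intro: exI[of _ "Suc i"])
next
  case (Fun f ts)
  then have "\<exists>k. \<forall>t \<in> set ts. wft full k t"
    by (rule ex_bound_list[OF _ wft_mono])
  then show ?case by simp
qed

lemma ex_wff_full: "\<exists>k. wff full k p"
proof (induction p)
  case (Eq s t)
  have "\<exists>k. \<forall>u \<in> set [s, t]. wft full k u"
    by (rule ex_bound_list[OF ex_wft_full wft_mono])
  then show ?case by simp
next
  case (Rel r ts)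
  have "\<exists>k. \<forall>u \<in> set ts. wft full k u"
    by (rule ex_bound_list[OF ex_wft_full wft_mono])
  then show ?case by simp
next
  case (Imp p q)
  then have "\<exists>k. \<forall>u \<in> set [p, q]. wff full k u"
    by (intro ex_bound_list) (auto elim: wff_mono)
  then show ?case by simp
next
  case (All p)
  then obtain k where "wff full k p" ..
  then have "wff full k (All p)" by (simp add: wff_mono)
  then show ?case ..
qed simp

section \<open>Structural properties of derivability\<close>

lemma proves_weaken: "\<Gamma> \<turnstile> p \<Longrightarrow> \<Gamma> \<subseteq> \<Delta> \<Longrightarrow> \<Delta> \<turnstile> p"
proof (induction arbitrary: \<Delta> rule: proves.induct)
  case (assm p \<Gamma>)
  then show ?case by (blast intro: proves.assm)
next
  case (impI p \<Gamma> q)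
  show ?case by (rule proves.impI, rule impI.IH) (use impI.prems in blast)
next
  case (impE \<Gamma> p q)
  show ?case by (rule proves.impE[OF impE.IH]) (rule impE.prems)+
next
  case (raa p \<Gamma>)
  show ?case by (rule proves.raa, rule raa.IH) (use raa.prems in blast)
next
  case (allI \<Gamma> p)
  show ?case by (rule proves.allI, rule allI.IH) (use allI.prems in blast)
next
  case (allE \<Gamma> p t)
  show ?case by (rule proves.allE, rule allE.IH) (rule allE.prems)
next
  case (refl \<Gamma> t)
  show ?case by (rule proves.refl)
next
  case (leibniz \<Gamma> s t p)
  show ?case by (rule proves.leibniz[OF leibniz.IH]) (rule leibniz.prems)+
qed

text \<open>Substitution commutes with \<open>lift\<close> and \<open>inst\<close>, hence can be
  pushed through every rule. The rule for \<open>All\<close> uses the hypothesis for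
  \<open>up s\<close>, so \<open>s\<close> must be arbitrary.\<close>

lemma proves_fsubst: "\<Gamma> \<turnstile> p \<Longrightarrow> fsubst s ` \<Gamma> \<turnstile> fsubst s p"
proof (induction arbitrary: s rule: proves.induct)
  case (impI p \<Gamma> q)
  then show ?case by (auto intro: proves.impI)
next
  case (raa p \<Gamma>)
  show ?case by (rule proves.raa) (use raa.IH[of s] in simp)
next
  case (allI \<Gamma> p)
  have "lift ` fsubst s ` \<Gamma> = fsubst (up s) ` lift ` \<Gamma>"
    by (simp add: image_image fsubst_lift)
  then show ?case using allI.IH[of "up s"] by (auto intro: proves.allI)
next
  case (allE \<Gamma> p t)
  from proves.allE[of "fsubst s ` \<Gamma>" "fsubst (up s) p"] allE.IH[of s] show ?case
    by (simp add: fsubst_inst)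
next
  case (leibniz \<Gamma> t u p)
  from proves.leibniz[of "fsubst s ` \<Gamma>" "tsubst s t" "tsubst s u" "fsubst (up s) p"] leibniz.IH[of s]
  show ?case by (simp add: fsubst_inst)
next
  case (impE \<Gamma> p q)
  then show ?case by (auto intro: proves.impE)
qed (auto intro: proves.assm proves.refl)

text \<open>The context may be infinite, so the proof is an induction on the derivation and not a
  repeated discharge. Under a quantifier the derivations of the hypotheses are lifted by
  \<open>proves_fsubst\<close>.\<close>

lemma proves_cut: "\<Gamma> \<turnstile> q \<Longrightarrow> (\<And>p. p \<in> \<Gamma> \<Longrightarrow> \<Delta> \<turnstile> p) \<Longrightarrow> \<Delta> \<turnstile> q"
proof (induction arbitrary: \<Delta> rule: proves.induct)
  case (impI p \<Gamma> q)
  show ?case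
    by (rule proves.impI, rule impI.IH) (auto intro: proves.assm proves_weaken[OF impI.prems])
next
  case (raa p \<Gamma>)
  show ?case
    by (rule proves.raa, rule raa.IH) (auto intro: proves.assm proves_weaken[OF raa.prems])
next
  case (allI \<Gamma> p)
  show ?case
  proof (rule proves.allI, rule allI.IH)
    fix q assume "q \<in> lift ` \<Gamma>"
    then show "lift ` \<Delta> \<turnstile> q"
      using allI.prems proves_fsubst by (auto simp: lift_def[abs_def])
  qed
next
  case (assm p \<Gamma>)
  then show ?case by blast
next
  case (impE \<Gamma> p q)
  show ?case by (rule proves.impE[OF impE.IH]) (erule impE.prems)+
next
  case (allE \<Gamma> p t)
  show ?case by (rule proves.allE, rule allE.IH) (erule allE.prems)
next
  case (refl \<Gamma> t)
  show ?case by (rule proves.refl)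
next
  case (leibniz \<Gamma> s t p)
  show ?case by (rule proves.leibniz[OF leibniz.IH]) (erule leibniz.prems)+
qed

lemma proves_finite: "\<Gamma> \<turnstile> p \<Longrightarrow> \<exists>F. finite F \<and> F \<subseteq> \<Gamma> \<and> F \<turnstile> p"
proof (induction rule: proves.induct)
  case (assm p \<Gamma>)
  then show ?case by (intro exI[of _ "{p}"]) (auto intro: proves.assm)
next
  case (impI p \<Gamma> q)
  then obtain F where F: "finite F" "F \<subseteq> insert p \<Gamma>" "F \<turnstile> q" by blast
  then have "F - {p} \<turnstile> Imp p q"
    by (auto intro!: proves.impI elim: proves_weaken)
  then show ?case using F by (intro exI[of _ "F - {p}"]) auto
next
  case (impE \<Gamma> p q)
  then obtain F G where FG: "finite F" "F \<subseteq> \<Gamma>" "F \<turnstile> Imp p q" "finite G" "G \<subseteq> \<Gamma>" "G \<turnstile> p"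
    by blast
  then have "F \<union> G \<turnstile> q"
    by (blast intro: proves.impE proves_weaken)
  then show ?case using FG by (intro exI[of _ "F \<union> G"]) auto
next
  case (raa p \<Gamma>)
  then obtain F where F: "finite F" "F \<subseteq> insert (Neg p) \<Gamma>" "F \<turnstile> Bot" by blast
  have "F - {Neg p} \<turnstile> p"
    by (rule proves.raa) (use F in \<open>auto elim: proves_weaken\<close>)
  then show ?case using F by (intro exI[of _ "F - {Neg p}"]) auto
next
  case (allI \<Gamma> p)
  then obtain F where "finite F" "F \<subseteq> lift ` \<Gamma>" "F \<turnstile> p" by blast
  then show ?case by (metis finite_subset_image proves.allI)
next
  case (leibniz \<Gamma> s t p)
  then obtain F G where FG: "finite F" "F \<subseteq> \<Gamma>" "F \<turnstile> Eq s t" "finite G" "G \<subseteq> \<Gamma>" "G \<turnstile> inst p s"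
    by blast
  then have "F \<union> G \<turnstile> inst p t"
    by (blast intro: proves.leibniz proves_weaken)
  then show ?case using FG by (intro exI[of _ "F \<union> G"]) auto
next
  case (allE \<Gamma> p t)
  then show ?case by (metis proves.allE)
next
  case (refl \<Gamma> t)
  show ?case by (intro exI[of _ "{}"]) (simp add: proves.refl)
qed

text \<open>Generalization over a variable beyond all free variables of the context, the
  named-variable form of the de Bruijn rule \<open>allI\<close>.\<close>

lemma proves_gen:
  assumes "\<And>q. q \<in> \<Gamma> \<Longrightarrow> wff L k q" "wff L (Suc k) p" "\<Gamma> \<turnstile> inst p (Var k)"
  shows "\<Gamma> \<turnstile> All p"
proof (rule proves.allI)
  \<comment> \<open>This renaming makes \<open>Var k\<close> the variable bound by
    \<open>All\<close> and shifts all others, so on the context it acts as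
    \<open>lift\<close>.\<close>
  define s where "s i = (if i = k then Var 0 else Var (Suc i))" for i
  have "fsubst s (inst p (Var k)) = fsubst Var p"
    unfolding inst_def fsubst_fsubst
    by (rule fsubst_cong[OF assms(2)]) (auto simp: s_def less_Suc_eq_0_disj)
  moreover have "fsubst s ` \<Gamma> = lift ` \<Gamma>"
    unfolding lift_def by (intro image_cong refl fsubst_cong[OF assms(1)]) (auto simp: s_def)
  ultimately show "lift ` \<Gamma> \<turnstile> p"
    using proves_fsubst[OF assms(3), of s] by simp
qed

lemma proves_Bot: "\<Gamma> \<turnstile> Bot \<Longrightarrow> \<Gamma> \<turnstile> p"
  by (rule proves.raa) (auto elim: proves_weaken)

lemma proves_Neg_E: "\<Gamma> \<turnstile> Neg p \<Longrightarrow> \<Gamma> \<turnstile> p \<Longrightarrow> \<Gamma> \<turnstile> Bot"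
  unfolding Neg_def by (rule proves.impE)

section \<open>Structures and satisfaction\<close>

text \<open>The universe is a set, not the whole type, because the term model consists only of the
  equivalence classes within \<open>tm set\<close>. Closure under functions is assumed where it is
  used.\<close>

record 'a str =
  dm :: "'a set"
  fi :: "nat \<Rightarrow> 'a list \<Rightarrow> 'a"
  ri :: "nat \<Rightarrow> 'a list \<Rightarrow> bool"

primrec tval :: "'a str \<Rightarrow> (nat \<Rightarrow> 'a) \<Rightarrow> tm \<Rightarrow> 'a" where
  "tval M e (Var i) = e i"
| "tval M e (Fun f ts) = fi M f (map (tval M e) ts)"

primrec sat :: "'a str \<Rightarrow> (nat \<Rightarrow> 'a) \<Rightarrow> fm \<Rightarrow> bool" where
  "sat M e Bot = False"
| "sat M e (Eq s t) = (tval M e s = tval M e t)"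
| "sat M e (Rel r ts) = ri M r (map (tval M e) ts)"
| "sat M e (Imp p q) = (sat M e p \<longrightarrow> sat M e q)"
| "sat M e (All p) = (\<forall>x \<in> dm M. sat M (case_nat x e) p)"

lemma sat_simps [simp]:
  "sat M e (Neg p) = (\<not> sat M e p)"
  "sat M e (And p q) = (sat M e p \<and> sat M e q)"
  "sat M e (Or p q) = (sat M e p \<or> sat M e q)"
  "sat M e (Ex p) = (\<exists>x \<in> dm M. sat M (case_nat x e) p)"
  by (auto simp: Neg_def And_def Or_def Ex_def)

lemma sat_Disj [simp]: "sat M e (Disj ps) = (\<exists>p \<in> set ps. sat M e p)"
  by (induction ps) (auto simp: Disj_def)

lemma tval_cong: "wft L k t \<Longrightarrow> (\<And>i. i < k \<Longrightarrow> d i = e i) \<Longrightarrow> tval M d t = tval M e t"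
  by (induction t) (auto intro!: arg_cong[where f = "fi M _"])

lemma sat_cong: "wff L k p \<Longrightarrow> (\<And>i. i < k \<Longrightarrow> d i = e i) \<Longrightarrow> sat M d p = sat M e p"
proof (induction p arbitrary: k d e)
  case (Eq s t)
  then show ?case using tval_cong[of L k _ d e M] by auto
next
  case (Rel r ts)
  then have "map (tval M d) ts = map (tval M e) ts"
    by (auto intro: tval_cong)
  then show ?case by (simp only: sat.simps)
next
  case (Imp p q)
  have "sat M d p = sat M e p" "sat M d q = sat M e q"
    using Imp.prems by (intro Imp.IH[of k]; simp)+
  then show ?case by simp
next
  case (All p)
  have "sat M (case_nat x d) p = sat M (case_nat x e) p" for x
    using All.prems by (intro All.IH[of "Suc k"]) (auto simp: less_Suc_eq_0_disj)
  then show ?case by simp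
qed simp

section \<open>The Henkin construction\<close>

text \<open>Stage \<open>n\<close> treats the formula numbered \<open>n\<close>. Variables serve as
  Henkin constants: \<open>\<Gamma>\<close> will consist of sentences and is kept out of the stages,
  so each stage is a finite set and leaves some variable \<open>k\<close> fresh for a counterexample
  to \<open>All q\<close>.\<close>

primrec henkin :: "fm set \<Rightarrow> nat \<Rightarrow> fm set" where
  "henkin \<Gamma> 0 = {}"
| "henkin \<Gamma> (Suc n) = (let p = inv gn n; S = insert p (henkin \<Gamma> n) in
     if consistent (\<Gamma> \<union> S)
     then S \<union> {Neg (inst q (Var k)) | q k. p = Neg (All q) \<and> k = (SOME k. \<forall>r \<in> S. wff full k r)}
     else henkin \<Gamma> n)"

lemma inv_gn [simp]: "inv gn (gn p) = p"
  by (rule inv_f_f) (auto intro: injI gn_inj)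

lemma finite_henkin: "finite (henkin \<Gamma> n)"
proof (induction n)
  case (Suc n)
  have "{Neg (inst q (Var k)) | q k. p = Neg (All q) \<and> k = k'}
      \<subseteq> (case p of Imp (All q) _ \<Rightarrow> {Neg (inst q (Var k'))} | _ \<Rightarrow> {})" for p k'
    by (auto simp: Neg_def)
  then have "finite {Neg (inst q (Var k)) | q k. p = Neg (All q) \<and> k = k'}" for p k'
    by (rule finite_subset) (auto split: fm.split)
  then show ?case using Suc by (simp add: Let_def)
qed simp

lemma finite_ex_wff_full: "finite S \<Longrightarrow> \<exists>k. \<forall>r \<in> S. wff full k r"
proof -
  assume "finite S"
  then obtain ps where S: "set ps = S" using finite_list by blast
  show ?thesis
    unfolding S[symmetric] by (rule ex_bound_list) (auto intro: ex_wff_full wff_mono)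
qed

text \<open>If adding the counterexample were inconsistent, \<open>inst q (Var k)\<close> would be
  derivable without it; as \<open>k\<close> is fresh, so would be \<open>All q\<close>, against the
  negation just added.\<close>

lemma consistent_henkin:
  assumes "consistent \<Gamma>" "\<And>q. q \<in> \<Gamma> \<Longrightarrow> wff full 0 q"
  shows "consistent (\<Gamma> \<union> henkin \<Gamma> n)"
proof (induction n)
  case 0
  then show ?case using assms by simp
next
  case (Suc n)
  define p where "p = inv gn n"
  define S where "S = insert p (henkin \<Gamma> n)"
  define k where "k = (SOME k. \<forall>r \<in> S. wff full k r)"
  have k: "\<forall>r \<in> S. wff full k r"
    unfolding k_def by (rule someI_ex, rule finite_ex_wff_full) (simp add: S_def finite_henkin)
  have eq: "henkin \<Gamma> (Suc n) =
      (if consistent (\<Gamma> \<union> S) then S \<union> {Neg (inst q (Var k)) | q. p = Neg (All q)} else henkin \<Gamma> n)"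
    by (simp add: Let_def S_def p_def k_def)
  show ?case
  proof (cases "consistent (\<Gamma> \<union> S)")
    case False
    then show ?thesis using eq Suc by simp
  next
    case c: True
    show ?thesis
    proof (cases "\<exists>q. p = Neg (All q)")
      case False
      then show ?thesis using c eq by simp
    next
      case True
      then obtain q where q: "p = Neg (All q)" by blast
      then have eq': "\<Gamma> \<union> henkin \<Gamma> (Suc n) = insert (Neg (inst q (Var k))) (\<Gamma> \<union> S)"
        using eq c by (auto simp: Neg_def)
      show ?thesis
        unfolding consistent_def eq'
      proof
        assume "insert (Neg (inst q (Var k))) (\<Gamma> \<union> S) \<turnstile> Bot"
        then have "\<Gamma> \<union> S \<turnstile> inst q (Var k)" by (rule proves.raa)
        moreover have "wff full k p" using k by (simp add: S_def)
        ultimately have "\<Gamma> \<union> S \<turnstile> All q"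
          using k assms(2) wff_mono[of full 0 _ k] q
          by (intro proves_gen[of _ full k]) (auto simp: Neg_def)
        moreover have "\<Gamma> \<union> S \<turnstile> Neg (All q)"
          by (rule proves.assm) (simp add: S_def q)
        ultimately show False using c proves_Neg_E consistent_def by blast
      qed
    qed
  qed
qed

lemma henkin_Suc_subset: "henkin \<Gamma> n \<subseteq> henkin \<Gamma> (Suc n)"
  by (auto simp: Let_def)

lemma henkin_mono: "m \<le> n \<Longrightarrow> henkin \<Gamma> m \<subseteq> henkin \<Gamma> n"
  by (rule lift_Suc_mono_le[of "henkin \<Gamma>"]) (rule henkin_Suc_subset)

lemma ex_complete_henkin_extension:
  assumes "consistent \<Gamma>" "\<And>q. q \<in> \<Gamma> \<Longrightarrow> wff full 0 q"
  obtains \<Delta> where "\<Gamma> \<subseteq> \<Delta>" "consistent \<Delta>" "\<And>p. \<Delta> \<turnstile> p \<or> \<Delta> \<turnstile> Neg p"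
    "\<And>q. \<forall>t. \<Delta> \<turnstile> inst q t \<Longrightarrow> \<Delta> \<turnstile> All q"
proof -
  define \<Delta> where "\<Delta> = \<Gamma> \<union> (\<Union>n. henkin \<Gamma> n)"
  have sub: "\<Gamma> \<union> henkin \<Gamma> n \<subseteq> \<Delta>" for n by (auto simp: \<Delta>_def)
  have fin: "\<exists>n. F \<subseteq> \<Gamma> \<union> henkin \<Gamma> n" if "finite F" "F \<subseteq> \<Delta>" for F
    using that
  proof (induction F rule: finite_induct)
    case (insert x F)
    then obtain n m where "F \<subseteq> \<Gamma> \<union> henkin \<Gamma> n" "x \<in> \<Gamma> \<union> henkin \<Gamma> m"
      by (auto simp: \<Delta>_def)
    then have "insert x F \<subseteq> \<Gamma> \<union> henkin \<Gamma> (max n m)"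
      using henkin_mono[of n "max n m" \<Gamma>] henkin_mono[of m "max n m" \<Gamma>] by auto
    then show ?case ..
  qed simp
  have con: "consistent \<Delta>"
    unfolding consistent_def
  proof
    assume "\<Delta> \<turnstile> Bot"
    then obtain n where "\<Gamma> \<union> henkin \<Gamma> n \<turnstile> Bot"
      using proves_finite fin proves_weaken by metis
    then show False using consistent_henkin[OF assms] by (auto simp: consistent_def)
  qed
  \<comment> \<open>Each formula is settled at the stage given by its own Goedel number: it is added
    with its counterexample, or its negation is already derivable.\<close>
  have stage: "\<Delta> \<turnstile> p \<and> (\<forall>q. p = Neg (All q) \<longrightarrow> (\<exists>k. \<Delta> \<turnstile> Neg (inst q (Var k)))) \<or> \<Delta> \<turnstile> Neg p" for p
  proof (cases "consistent (\<Gamma> \<union> insert p (henkin \<Gamma> (gn p)))")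
    case True
    then have "insert p {Neg (inst q (Var k)) | q k. p = Neg (All q) \<and>
        k = (SOME k. \<forall>r \<in> insert p (henkin \<Gamma> (gn p)). wff full k r)} \<subseteq> henkin \<Gamma> (Suc (gn p))"
      by (auto simp: Let_def)
    then have "insert p {Neg (inst q (Var k)) | q k. p = Neg (All q) \<and>
        k = (SOME k. \<forall>r \<in> insert p (henkin \<Gamma> (gn p)). wff full k r)} \<subseteq> \<Delta>"
      using sub by blast
    then show ?thesis by (blast intro: proves.assm)
  next
    case False
    then have "insert p (\<Gamma> \<union> henkin \<Gamma> (gn p)) \<turnstile> Bot" by (simp add: consistent_def)
    then have "\<Gamma> \<union> henkin \<Gamma> (gn p) \<turnstile> Neg p"
      unfolding Neg_def by (rule proves.impI)
    then show ?thesis using proves_weaken sub by blast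
  qed
  show thesis
  proof (rule that)
    show "\<Gamma> \<subseteq> \<Delta>" by (auto simp: \<Delta>_def)
    show "consistent \<Delta>" by (rule con)
    show c: "\<Delta> \<turnstile> p \<or> \<Delta> \<turnstile> Neg p" for p using stage by blast
    show "\<Delta> \<turnstile> All q" if "\<forall>t. \<Delta> \<turnstile> inst q t" for q
    proof (rule ccontr)
      assume "\<not> \<Delta> \<turnstile> All q"
      then have "\<not> \<Delta> \<turnstile> Neg (Neg (All q))"
        using c[of "All q"] con proves_Neg_E unfolding consistent_def by blast
      then obtain k where "\<Delta> \<turnstile> Neg (inst q (Var k))" using stage by blast
      then show False using that con proves_Neg_E unfolding consistent_def by blast
    qed
  qed
qed

section \<open>Equality and the term model\<close>

lemma inst_Eq [simp]: "inst (Eq t u) v = Eq (tsubst (case_nat v Var) t) (tsubst (case_nat v Var) u)"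
  by (simp add: inst_def)

lemma inst_Rel [simp]: "inst (Rel r ts) v = Rel r (map (tsubst (case_nat v Var)) ts)"
  by (simp add: inst_def)

abbreviation shift :: "tm \<Rightarrow> tm" where
  "shift \<equiv> tsubst (\<lambda>i. Var (Suc i))"

lemma map_tsubst_shift [simp]: "map (tsubst (case_nat v Var) \<circ> shift) ts = ts"
  by (rule map_idI) simp

lemma proves_sym: "\<Gamma> \<turnstile> Eq s t \<Longrightarrow> \<Gamma> \<turnstile> Eq t s"
  using proves.leibniz[of \<Gamma> s t "Eq (Var 0) (shift s)"] by (simp add: proves.refl)

lemma proves_trans: "\<Gamma> \<turnstile> Eq s t \<Longrightarrow> \<Gamma> \<turnstile> Eq t u \<Longrightarrow> \<Gamma> \<turnstile> Eq s u"
  using proves.leibniz[of \<Gamma> t u "Eq (shift s) (Var 0)"] by simp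

text \<open>Leibniz's rule replaces one argument at a time; \<open>ps\<close> collects the arguments
  already replaced.\<close>

lemma proves_Fun_cong:
  "list_all2 (\<lambda>t u. \<Gamma> \<turnstile> Eq t u) ts us \<Longrightarrow> \<Gamma> \<turnstile> Eq (Fun f (ps @ ts)) (Fun f (ps @ us))"
proof (induction arbitrary: ps rule: list_all2_induct)
  case Nil
  then show ?case by (simp add: proves.refl)
next
  case (Cons t ts u us)
  have "\<Gamma> \<turnstile> Eq (Fun f (ps @ t # ts)) (Fun f (ps @ u # ts))"
    using proves.leibniz[OF Cons.hyps(1), of "Eq (Fun f (map shift ps @ shift t # map shift ts))
      (Fun f (map shift ps @ Var 0 # map shift ts))"]
    by (simp add: proves.refl)
  moreover have "\<Gamma> \<turnstile> Eq (Fun f (ps @ u # ts)) (Fun f (ps @ u # us))"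
    using Cons.IH[of "ps @ [u]"] by simp
  ultimately show ?case by (rule proves_trans)
qed

lemma proves_Rel_cong:
  "list_all2 (\<lambda>t u. \<Gamma> \<turnstile> Eq t u) ts us \<Longrightarrow> \<Gamma> \<turnstile> Rel r (ps @ ts) \<Longrightarrow> \<Gamma> \<turnstile> Rel r (ps @ us)"
proof (induction arbitrary: ps rule: list_all2_induct)
  case (Cons t ts u us)
  have "\<Gamma> \<turnstile> Rel r (ps @ u # ts)"
    using proves.leibniz[OF Cons.hyps(1), of "Rel r (map shift ps @ Var 0 # map shift ts)"] Cons.prems
    by simp
  then show ?case using Cons.IH[of "ps @ [u]"] by simp
qed simp

text \<open>Terms modulo derivable equality in a complete Henkin extension. Variables are terms too,
  so the assignment sends \<open>i\<close> to the class of \<open>Var i\<close>.\<close>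

lemma model_existence:
  assumes "\<And>q. q \<in> \<Gamma> \<Longrightarrow> wff full 0 q" "consistent \<Gamma>"
  obtains M :: "tm set str" and e where "\<And>i. e i \<in> dm M" "\<And>q. \<Gamma> \<turnstile> q \<Longrightarrow> sat M e q"
    "\<And>f xs. set xs \<subseteq> dm M \<Longrightarrow> fi M f xs \<in> dm M"
proof -
  obtain \<Delta> where sub: "\<Gamma> \<subseteq> \<Delta>" and con: "consistent \<Delta>"
    and complete: "\<And>p. \<Delta> \<turnstile> p \<or> \<Delta> \<turnstile> Neg p"
    and henkin: "\<And>q. \<forall>t. \<Delta> \<turnstile> inst q t \<Longrightarrow> \<Delta> \<turnstile> All q"
    using ex_complete_henkin_extension[OF assms(2,1)] by blast
  define cls where "cls t = {u. \<Delta> \<turnstile> Eq t u}" for t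
  define rep where "rep c = (SOME t. c = cls t)" for c
  define M :: "tm set str" where "M = \<lparr>dm = range cls, fi = \<lambda>f xs. cls (Fun f (map rep xs)),
    ri = \<lambda>r xs. \<Delta> \<turnstile> Rel r (map rep xs)\<rparr>"
  have cls_eq: "cls t = cls u \<longleftrightarrow> \<Delta> \<turnstile> Eq t u" for t u
    unfolding cls_def using proves.refl proves_sym proves_trans by blast
  have rep: "\<Delta> \<turnstile> Eq t (rep (cls t))" for t
    unfolding rep_def cls_eq[symmetric] by (rule someI) simp
  have reps: "list_all2 (\<lambda>t u. \<Delta> \<turnstile> Eq t u) ts (map (rep \<circ> cls) ts)" for ts
    by (simp add: list_all2_conv_all_nth rep)
  have reps': "list_all2 (\<lambda>t u. \<Delta> \<turnstile> Eq t u) (map (rep \<circ> cls) ts) ts" for ts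
    by (simp add: list_all2_conv_all_nth rep proves_sym)
  have tval: "tval M (\<lambda>i. cls (s i)) t = cls (tsubst s t)" for s t
  proof (induction t)
    case (Fun f ts)
    then have args: "map rep (map (tval M (\<lambda>i. cls (s i))) ts) = map (rep \<circ> cls) (map (tsubst s) ts)"
      by simp
    have fi: "fi M f xs = cls (Fun f (map rep xs))" for xs
      by (simp add: M_def)
    have "tval M (\<lambda>i. cls (s i)) (Fun f ts) = cls (Fun f (map (rep \<circ> cls) (map (tsubst s) ts)))"
      by (simp only: tval.simps fi args)
    also have "\<dots> = cls (Fun f (map (tsubst s) ts))"
      unfolding cls_eq using proves_Fun_cong[OF reps', of f "[]" "map (tsubst s) ts"] by simp
    finally show ?case by simp
  qed simp
  \<comment> \<open>All substitutions are needed at once, since a quantifier extends the assignment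
    by the class of an arbitrary term.\<close>
  have truth: "sat M (\<lambda>i. cls (s i)) p \<longleftrightarrow> \<Delta> \<turnstile> fsubst s p" for s p
  proof (induction p arbitrary: s)
    case Bot
    then show ?case using con by (simp add: consistent_def)
  next
    case (Eq t u)
    then show ?case by (simp add: tval cls_eq)
  next
    case (Rel r ts)
    have "map rep (map (tval M (\<lambda>i. cls (s i))) ts) = map (rep \<circ> cls) (map (tsubst s) ts)"
      by (simp add: tval)
    moreover have "ri M r xs \<longleftrightarrow> \<Delta> \<turnstile> Rel r (map rep xs)" for xs
      by (simp add: M_def)
    ultimately have "sat M (\<lambda>i. cls (s i)) (Rel r ts) \<longleftrightarrow> \<Delta> \<turnstile> Rel r (map (rep \<circ> cls) (map (tsubst s) ts))"
      by (simp only: sat.simps)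
    then show ?case
      using proves_Rel_cong[OF reps, of r "[]" "map (tsubst s) ts"]
        proves_Rel_cong[OF reps', of r "[]" "map (tsubst s) ts"] by auto
  next
    case (Imp p q)
    have "\<Delta> \<turnstile> Imp a b" if "\<Delta> \<turnstile> a \<longrightarrow> \<Delta> \<turnstile> b" for a b
    proof (cases "\<Delta> \<turnstile> a")
      case True
      then have "\<Delta> \<turnstile> b" using that by blast
      then show ?thesis by (intro proves.impI) (erule proves_weaken, blast)
    next
      case False
      then have "\<Delta> \<turnstile> Neg a" using complete by blast
      then have "insert a \<Delta> \<turnstile> Neg a" by (rule proves_weaken) blast
      then have "insert a \<Delta> \<turnstile> Bot" by (rule proves_Neg_E) (simp add: proves.assm)
      then show ?thesis by (rule proves.impI[OF proves_Bot])
    qed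
    then show ?case using Imp proves.impE[of \<Delta> "fsubst s p" "fsubst s q"] by auto
  next
    case (All p)
    have env: "case_nat (cls t) (\<lambda>i. cls (s i)) = (\<lambda>i. cls (case_nat t s i))" for t
      by (rule ext) (simp split: nat.split)
    have "dm M = range cls" by (simp add: M_def)
    then have "sat M (\<lambda>i. cls (s i)) (All p) \<longleftrightarrow> (\<forall>t. \<Delta> \<turnstile> inst (fsubst (up s) p) t)"
      by (simp add: env inst_fsubst_up All)
    then show ?case using henkin proves.allE by auto
  qed
  show thesis
  proof (rule that[of "\<lambda>i. cls (Var i)" M])
    show "sat M (\<lambda>i. cls (Var i)) q" if "\<Gamma> \<turnstile> q" for q
      using that sub proves_weaken truth[of Var q] by auto
  qed (auto simp: M_def)
qed

text \<open>A type cannot be quantified over, so the models range over the one type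
  \<open>tm set\<close> in which the term model lives. The closure property is passed on because it
  puts the numerals into the domain.\<close>

lemma completeness:
  assumes "\<And>q. q \<in> \<Gamma> \<Longrightarrow> wff L 0 q" "wff L 0 p"
    and "\<And>(M :: tm set str) e. \<lbrakk>\<And>i. e i \<in> dm M; \<And>q. \<Gamma> \<turnstile> q \<Longrightarrow> sat M e q;
      \<And>f xs. set xs \<subseteq> dm M \<Longrightarrow> fi M f xs \<in> dm M\<rbrakk> \<Longrightarrow> sat M e p"
  shows "\<Gamma> \<turnstile> p"
proof (rule ccontr)
  assume "\<not> \<Gamma> \<turnstile> p"
  then have con: "consistent (insert (Neg p) \<Gamma>)"
    using proves.raa by (auto simp: consistent_def)
  have "wff full 0 q" if "q \<in> insert (Neg p) \<Gamma>" for q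
    using that assms(1,2) wff_full by (auto simp: Neg_def)
  then obtain M :: "tm set str" and e where M: "\<And>i. e i \<in> dm M"
    "\<And>q. insert (Neg p) \<Gamma> \<turnstile> q \<Longrightarrow> sat M e q"
    "\<And>f xs. set xs \<subseteq> dm M \<Longrightarrow> fi M f xs \<in> dm M"
    using model_existence[OF _ con] by metis
  have "sat M e p"
  proof (rule assms(3)[OF M(1) _ M(3)])
    show "sat M e q" if "\<Gamma> \<turnstile> q" for q
      using that by (intro M(2)) (auto elim: proves_weaken)
  qed
  moreover have "sat M e (Neg p)"
    using M(2) proves.assm by blast
  ultimately show False by simp
qed

section \<open>Representability in R\<close>

definition NN :: "nat str" where
  "NN = \<lparr>dm = UNIV, fi = \<lambda>f xs. if f = 0 then 0 else if f = 1 then Suc (xs ! 0)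
     else if f = 2 then xs ! 0 + xs ! 1 else xs ! 0 * xs ! 1, ri = \<lambda>r xs. xs ! 0 \<le> xs ! 1\<rparr>"

lemma NN_simps [simp]: "dm NN = UNIV" "fi NN 0 xs = 0" "fi NN (Suc 0) [a] = Suc a"
  "fi NN 2 [a, b] = a + b" "fi NN 3 [a, b] = a * b" "ri NN r [a, b] \<longleftrightarrow> a \<le> b"
  by (auto simp: NN_def)

lemma wft_num_tm [simp]: "wft sigA k (num_tm n)"
  by (induction n) (auto simp: num_tm_def suc_tm_def zero_tm_def sigA_def)

lemma wff_Disj: "wff L k (Disj ps) \<longleftrightarrow> (\<forall>p \<in> set ps. wff L k p)"
  by (induction ps) (auto simp: Disj_def Or_def Neg_def)

lemma wff_simps [simp]:
  "wff L k (Neg p) = wff L k p"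
  "wff L k (And p q) = (wff L k p \<and> wff L k q)"
  "wff L k (Or p q) = (wff L k p \<and> wff L k q)"
  "wff L k (Ex p) = wff L (Suc k) p"
  by (auto simp: Neg_def And_def Or_def Ex_def)

lemma wff_le_fm [simp]: "wff sigA k (le_fm s t) \<longleftrightarrow> wft sigA k s \<and> wft sigA k t"
  by (auto simp: le_fm_def sigA_def)

lemma wft_arith [simp]:
  "wft sigA k (plus_tm s t) \<longleftrightarrow> wft sigA k s \<and> wft sigA k t"
  "wft sigA k (times_tm s t) \<longleftrightarrow> wft sigA k s \<and> wft sigA k t"
  "wft sigA k (suc_tm t) \<longleftrightarrow> wft sigA k t"
  by (auto simp: plus_tm_def times_tm_def suc_tm_def sigA_def)

lemma wff_R: "q \<in> R \<Longrightarrow> wff sigA 0 q"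
  by (auto simp: R_def wff_Disj)

section \<open>Models of R and their standard part\<close>

definition std :: "'a str \<Rightarrow> nat \<Rightarrow> 'a" where
  "std M n = tval M (\<lambda>_. undefined) (num_tm n)"

lemma tval_num_tm [simp]: "tval M e (num_tm n) = std M n"
  unfolding std_def by (rule tval_cong[of sigA 0]) auto

text \<open>The semantic content of R: the numerals form a copy of the natural numbers and an
  initial segment of the order. Of a nonstandard element only its comparability with each numeral is
  known.\<close>

definition rmodel :: "'a str \<Rightarrow> bool" where
  "rmodel M \<longleftrightarrow> range (std M) \<subseteq> dm M \<and> inj (std M) \<and>
     (\<forall>m n. fi M 2 [std M m, std M n] = std M (m + n)) \<and>
     (\<forall>m n. fi M 3 [std M m, std M n] = std M (m * n)) \<and>
     (\<forall>x \<in> dm M. \<forall>n. ri M 0 [x, std M n] \<longleftrightarrow> (\<exists>k \<le> n. x = std M k)) \<and>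
     (\<forall>x \<in> dm M. \<forall>n. ri M 0 [x, std M n] \<or> ri M 0 [std M n, x])"

lemma std_Suc: "fi M (Suc 0) [std M n] = std M (Suc n)"
  by (simp add: std_def num_tm_def suc_tm_def)

lemma std_0: "fi M 0 [] = std M 0"
  by (simp add: std_def num_tm_def zero_tm_def)

lemma rmodel_R:
  assumes sat: "\<And>q. q \<in> R \<Longrightarrow> sat M e q"
    and closed: "\<And>f xs. set xs \<subseteq> dm M \<Longrightarrow> fi M f xs \<in> dm M"
  shows "rmodel M"
proof -
  have dm: "std M n \<in> dm M" for n
    by (induction n) (auto simp: std_Suc[symmetric] std_0[symmetric] intro!: closed)
  have neq: "std M m \<noteq> std M n" if "m \<noteq> n" for m n
  proof -
    have "Neg (Eq (num_tm m) (num_tm n)) \<in> R" using that by (auto simp: R_def)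
    from sat[OF this] show ?thesis by simp
  qed
  have plus: "fi M 2 [std M m, std M n] = std M (m + n)" for m n
  proof -
    have "Eq (plus_tm (num_tm m) (num_tm n)) (num_tm (m + n)) \<in> R" by (auto simp: R_def)
    from sat[OF this] show ?thesis by (simp add: plus_tm_def)
  qed
  have times: "fi M 3 [std M m, std M n] = std M (m * n)" for m n
  proof -
    have "Eq (times_tm (num_tm m) (num_tm n)) (num_tm (m * n)) \<in> R" by (auto simp: R_def)
    from sat[OF this] show ?thesis by (simp add: times_tm_def)
  qed
  have le1: "\<exists>k \<le> n. x = std M k" if "x \<in> dm M" "ri M 0 [x, std M n]" for x n
  proof -
    have "All (Imp (le_fm (Var 0) (num_tm n))
        (Disj (map (\<lambda>k. Eq (Var 0) (num_tm k)) [0..<Suc n]))) \<in> R"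
      unfolding R_def by blast
    from sat[OF this] that have "\<exists>k \<in> {0..<Suc n}. x = std M k"
      by (auto simp: le_fm_def simp del: upt_Suc)
    then show ?thesis by (auto simp: less_Suc_eq_le)
  qed
  have total: "ri M 0 [x, std M n] \<or> ri M 0 [std M n, x]" if "x \<in> dm M" for x n
  proof -
    have "All (Or (le_fm (Var 0) (num_tm n)) (le_fm (num_tm n) (Var 0))) \<in> R"
      unfolding R_def by blast
    from sat[OF this] that show ?thesis by (simp add: le_fm_def)
  qed
  \<comment> \<open>R has no axiom for true instances of the order. If comparability yields the
    reverse instance, the disjunction axiom forces \<open>n \<le> k\<close>, so both numerals
    coincide.\<close>
  have le2: "ri M 0 [std M k, std M n]" if "k \<le> n" for k n
    using total[OF dm, of k n] le1[OF dm, of n k] neq[of n] that by (metis le_antisym)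
  show ?thesis
    unfolding rmodel_def
    using dm neq plus times le1 le2 total by (auto simp: inj_def)
qed

text \<open>All derivations in R below are obtained through this lemma, by arguing about the
  elements of a model.\<close>

lemma R_proves:
  assumes "wff sigA 0 p" "\<And>(M :: tm set str) e. rmodel M \<Longrightarrow> sat M e p"
  shows "R \<turnstile> p"
proof (rule completeness)
  fix M :: "tm set str" and e
  assume M: "\<And>q. R \<turnstile> q \<Longrightarrow> sat M e q" "\<And>f xs. set xs \<subseteq> dm M \<Longrightarrow> fi M f xs \<in> dm M"
  have "rmodel M"
    by (rule rmodel_R[of M e]) (use M proves.assm in auto)
  then show "sat M e p" by (rule assms(2))
qed (auto intro: wff_R assms(1))

section \<open>Bounded formulas and their absoluteness\<close>

text \<open>A bound is a variable of the surrounding formula, hence \<open>Suc j\<close> beneath the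
  binder. If it has a standard value, the quantifier stays inside the standard part.\<close>

inductive d0 :: "nat \<Rightarrow> fm \<Rightarrow> bool" where
  d0_Bot: "d0 k Bot"
| d0_Eq: "wft sigA k s \<Longrightarrow> wft sigA k t \<Longrightarrow> d0 k (Eq s t)"
| d0_Imp: "d0 k p \<Longrightarrow> d0 k q \<Longrightarrow> d0 k (Imp p q)"
| d0_All: "j < k \<Longrightarrow> d0 (Suc k) p \<Longrightarrow> d0 k (All (Imp (le_fm (Var 0) (Var (Suc j))) p))"

lemma d0_wff: "d0 k p \<Longrightarrow> wff sigA k p"
  by (induction rule: d0.induct) auto

lemma std_NN [simp]: "std NN n = n"
  by (induction n) (simp_all add: std_Suc[symmetric] std_0[symmetric])

lemma rmodelD:
  assumes "rmodel M"
  shows "std M n \<in> dm M" "inj (std M)" "fi M 2 [std M m, std M n] = std M (m + n)"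
    "fi M 3 [std M m, std M n] = std M (m * n)"
    "x \<in> dm M \<Longrightarrow> ri M 0 [x, std M n] \<longleftrightarrow> (\<exists>k \<le> n. x = std M k)"
    "x \<in> dm M \<Longrightarrow> ri M 0 [x, std M n] \<or> ri M 0 [std M n, x]"
  using assms unfolding rmodel_def by blast+

lemma tval_std:
  assumes "rmodel M"
  shows "wft sigA k t \<Longrightarrow> (\<And>i. i < k \<Longrightarrow> e i = std M (v i)) \<Longrightarrow> tval M e t = std M (tval NN v t)"
proof (induction t)
  case (Fun f ts)
  have args: "map (tval M e) ts = map (std M) (map (tval NN v) ts)"
    using Fun by simp
  consider "f = 0" "length ts = 0" | "f = 1" "length ts = 1" | "f = 2" "length ts = 2"
    | "f = 3" "length ts = 2"
    using Fun.prems(1) by (auto simp: sigA_def)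
  then show ?case
  proof cases
    case 1
    then show ?thesis by (simp add: std_0)
  next
    case 2
    then obtain a where "ts = [a]" by (auto simp: length_Suc_conv)
    then show ?thesis using 2 args by (simp add: std_Suc)
  next
    case 3
    then obtain a b where "ts = [a, b]" by (auto simp: length_Suc_conv numeral_2_eq_2)
    then show ?thesis using 3 args assms by (simp add: rmodel_def)
  next
    case 4
    then obtain a b where "ts = [a, b]" by (auto simp: length_Suc_conv numeral_2_eq_2)
    then show ?thesis using 4 args assms by (simp add: rmodel_def)
  qed
qed simp

text \<open>Below a standard number there are only standard elements, so bounded quantifiers range
  over the same numbers in \<open>M\<close> and in \<open>NN\<close>.\<close>

lemma d0_absolute:
  assumes M: "rmodel M"
  shows "d0 k p \<Longrightarrow> (\<And>i. i < k \<Longrightarrow> e i = std M (v i)) \<Longrightarrow> sat M e p \<longleftrightarrow> sat NN v p"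
proof (induction arbitrary: e v rule: d0.induct)
  case (d0_Eq k s t)
  then have "tval M e s = std M (tval NN v s)" "tval M e t = std M (tval NN v t)"
    using tval_std[OF M] by blast+
  moreover have "inj (std M)" using M by (simp add: rmodel_def)
  ultimately show ?case by (simp add: inj_eq)
next
  case (d0_Imp k p q)
  then have "sat M e p = sat NN v p" "sat M e q = sat NN v q" by blast+
  then show ?case by simp
next
  case (d0_All j k p)
  have IH: "sat M (case_nat (std M x) e) p \<longleftrightarrow> sat NN (case_nat x v) p" for x
    using d0_All.prems by (intro d0_All.IH) (auto split: nat.split)
  have "sat M e (All (Imp (le_fm (Var 0) (Var (Suc j))) p)) \<longleftrightarrow>
      (\<forall>x \<in> dm M. ri M 0 [x, std M (v j)] \<longrightarrow> sat M (case_nat x e) p)"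
    using d0_All by (simp add: le_fm_def)
  also have "\<dots> \<longleftrightarrow> (\<forall>k \<le> v j. sat M (case_nat (std M k) e) p)"
    using rmodelD(1)[OF M] by (auto simp: rmodelD(5)[OF M])
  also have "\<dots> \<longleftrightarrow> (\<forall>k. k \<le> v j \<longrightarrow> sat NN (case_nat k v) p)"
    by (simp add: IH)
  finally show ?case by (simp add: le_fm_def)
qed simp

lemma tval_tsubst: "tval M e (tsubst s t) = tval M (\<lambda>i. tval M e (s i)) t"
  by (induction t) (auto cong: map_cong intro!: arg_cong[where f = "fi M _"])

lemma sat_fsubst: "sat M e (fsubst s p) \<longleftrightarrow> sat M (\<lambda>i. tval M e (s i)) p"
proof (induction p arbitrary: e s)
  case (All p)
  have "(\<lambda>i. tval M (case_nat x e) (up s i)) = case_nat x (\<lambda>i. tval M e (s i))" for x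
    by (rule ext) (simp add: tval_tsubst split: nat.split)
  then show ?case by (simp add: All)
qed (auto simp: tval_tsubst comp_def)

text \<open>Only renamings are allowed, since a substituted bound has to remain a variable.\<close>

lemma d0_rename: "d0 k p \<Longrightarrow> (\<And>i. i < k \<Longrightarrow> r i < m) \<Longrightarrow> d0 m (fsubst (\<lambda>i. Var (r i)) p)"
proof (induction arbitrary: m r rule: d0.induct)
  case (d0_Eq k s t)
  then show ?case by (auto intro!: d0.d0_Eq wft_tsubst)
next
  case (d0_Imp k p q)
  then show ?case by (auto intro: d0.d0_Imp)
next
  case (d0_All j k p)
  have up: "up (\<lambda>i. Var (r i)) = (\<lambda>i. Var (case_nat 0 (\<lambda>i. Suc (r i)) i))"
    by (rule ext) (simp split: nat.split)
  have "d0 (Suc m) (fsubst (\<lambda>i. Var (case_nat 0 (\<lambda>i. Suc (r i)) i)) p)"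
    using d0_All.prems by (intro d0_All.IH) (auto split: nat.split)
  then show ?case
    using d0.d0_All[of "r j" m] d0_All by (simp add: le_fm_def up)
qed (auto intro: d0.d0_Bot)

section \<open>Closure properties of bounded definability\<close>

text \<open>Definability is stated for relations on environments, so that later proofs can follow
  the shape of a HOL formula and never mention de Bruijn terms.\<close>

definition def0 :: "nat \<Rightarrow> ((nat \<Rightarrow> nat) \<Rightarrow> bool) \<Rightarrow> bool" where
  "def0 k P \<longleftrightarrow> (\<exists>p. d0 k p \<and> (\<forall>v. sat NN v p \<longleftrightarrow> P v))"

definition arith :: "nat \<Rightarrow> ((nat \<Rightarrow> nat) \<Rightarrow> nat) \<Rightarrow> bool" where
  "arith k f \<longleftrightarrow> (\<exists>t. wft sigA k t \<and> (\<forall>v. tval NN v t = f v))"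

lemma arith_var: "i < k \<Longrightarrow> arith k (\<lambda>v. v i)"
  unfolding arith_def by (intro exI[of _ "Var i"]) auto

lemma arith_const: "arith k (\<lambda>v. n)"
  unfolding arith_def by (intro exI[of _ "num_tm n"]) auto

lemma arith_plus: "arith k f \<Longrightarrow> arith k g \<Longrightarrow> arith k (\<lambda>v. f v + g v)"
  unfolding arith_def
proof (elim exE conjE)
  fix s t assume "wft sigA k s" "\<forall>v. tval NN v s = f v" "wft sigA k t" "\<forall>v. tval NN v t = g v"
  then show "\<exists>t. wft sigA k t \<and> (\<forall>v. tval NN v t = f v + g v)"
    by (intro exI[of _ "plus_tm s t"]) (auto simp: plus_tm_def sigA_def)
qed

lemma arith_times: "arith k f \<Longrightarrow> arith k g \<Longrightarrow> arith k (\<lambda>v. f v * g v)"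
  unfolding arith_def
proof (elim exE conjE)
  fix s t assume "wft sigA k s" "\<forall>v. tval NN v s = f v" "wft sigA k t" "\<forall>v. tval NN v t = g v"
  then show "\<exists>t. wft sigA k t \<and> (\<forall>v. tval NN v t = f v * g v)"
    by (intro exI[of _ "times_tm s t"]) (auto simp: times_tm_def sigA_def)
qed

lemma arith_Suc: "arith k f \<Longrightarrow> arith k (\<lambda>v. Suc (f v))"
  using arith_plus[OF _ arith_const, of k f 1] by simp

lemma def0_eq: "arith k f \<Longrightarrow> arith k g \<Longrightarrow> def0 k (\<lambda>v. f v = g v)"
  unfolding arith_def def0_def
proof (elim exE conjE)
  fix s t assume "wft sigA k s" "\<forall>v. tval NN v s = f v" "wft sigA k t" "\<forall>v. tval NN v t = g v"
  then show "\<exists>p. d0 k p \<and> (\<forall>v. sat NN v p = (f v = g v))"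
    by (intro exI[of _ "Eq s t"]) (auto intro: d0.intros)
qed

lemma def0_False: "def0 k (\<lambda>v. False)"
  unfolding def0_def by (intro exI[of _ Bot]) (auto intro: d0.intros)

lemma def0_imp: "def0 k P \<Longrightarrow> def0 k Q \<Longrightarrow> def0 k (\<lambda>v. P v \<longrightarrow> Q v)"
  unfolding def0_def
proof (elim exE conjE)
  fix p q assume "d0 k p" "\<forall>v. sat NN v p = P v" "d0 k q" "\<forall>v. sat NN v q = Q v"
  then show "\<exists>p. d0 k p \<and> (\<forall>v. sat NN v p = (P v \<longrightarrow> Q v))"
    by (intro exI[of _ "Imp p q"]) (auto intro: d0.intros)
qed

lemma def0_not: "def0 k P \<Longrightarrow> def0 k (\<lambda>v. \<not> P v)"
  using def0_imp[OF _ def0_False, of k P] by simp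

lemma def0_disj: "def0 k P \<Longrightarrow> def0 k Q \<Longrightarrow> def0 k (\<lambda>v. P v \<or> Q v)"
  using def0_imp[OF def0_not, of k P Q] by (simp add: disj_imp)

lemma def0_conj: "def0 k P \<Longrightarrow> def0 k Q \<Longrightarrow> def0 k (\<lambda>v. P v \<and> Q v)"
  using def0_not[OF def0_imp[OF _ def0_not], of k P Q] by simp

lemma def0_ball:
  assumes "j < k" "def0 (Suc k) (\<lambda>v. P (v 0) (\<lambda>i. v (Suc i)))"
  shows "def0 k (\<lambda>v. \<forall>x \<le> v j. P x v)"
proof -
  obtain p where p: "d0 (Suc k) p" "\<And>v. sat NN v p \<longleftrightarrow> P (v 0) (\<lambda>i. v (Suc i))"
    using assms(2) by (auto simp: def0_def)
  have "sat NN v (All (Imp (le_fm (Var 0) (Var (Suc j))) p)) \<longleftrightarrow> (\<forall>x \<le> v j. P x v)" for v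
    by (simp add: p(2) le_fm_def)
  then show ?thesis
    unfolding def0_def using d0_All[OF assms(1) p(1)] by blast
qed

lemma def0_bex:
  assumes "j < k" "def0 (Suc k) (\<lambda>v. P (v 0) (\<lambda>i. v (Suc i)))"
  shows "def0 k (\<lambda>v. \<exists>x \<le> v j. P x v)"
proof -
  have "def0 k (\<lambda>v. \<not> (\<forall>x \<le> v j. \<not> P x v))"
    by (intro def0_not def0_ball assms)
  then show ?thesis by simp
qed

lemma def0_bex_list: "(\<And>x. x \<in> set xs \<Longrightarrow> def0 k (P x)) \<Longrightarrow> def0 k (\<lambda>v. \<exists>x \<in> set xs. P x v)"
proof (induction xs)
  case Nil
  then show ?case by (simp add: def0_False)
next
  case (Cons x xs)
  then show ?case using def0_disj[of k "P x"] by simp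
qed

lemma def0_ball_list: "(\<And>x. x \<in> set xs \<Longrightarrow> def0 k (P x)) \<Longrightarrow> def0 k (\<lambda>v. \<forall>x \<in> set xs. P x v)"
  using def0_not[OF def0_bex_list[of xs k "\<lambda>x v. \<not> P x v"]] def0_not by simp

text \<open>The bounds guarantee that a nonstandard witness cannot falsify a decided instance.\<close>

lemma represent_rosser:
  assumes A: "def0 2 (\<lambda>v. A (v 0) (v 1))" and B: "def0 2 (\<lambda>v. B (v 0) (v 1))"
  obtains p where "wff sigA 1 p"
    "\<And>n d. A d n \<Longrightarrow> \<forall>d' \<le> d. \<not> B d' n \<Longrightarrow> R \<turnstile> All (Imp (Eq (Var 0) (num_tm n)) p)"
    "\<And>n d. B d n \<Longrightarrow> \<forall>d' < d. A d' n \<longrightarrow> (\<exists>d'' \<le> d'. B d'' n) \<Longrightarrow>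
      R \<turnstile> All (Imp (Eq (Var 0) (num_tm n)) (Neg p))"
proof -
  obtain a where a: "d0 2 a" "\<And>v. sat NN v a \<longleftrightarrow> A (v 0) (v 1)"
    using A by (auto simp: def0_def)
  obtain b where b: "d0 2 b" "\<And>v. sat NN v b \<longleftrightarrow> B (v 0) (v 1)"
    using B by (auto simp: def0_def)
  \<comment> \<open>Beneath the quantifier of \<open>c\<close> the variables are d', d, n in this
    order; doubling the index keeps the first and skips d.\<close>
  define b' where "b' = fsubst (\<lambda>i. Var (2 * i)) b"
  define c where "c = All (Imp (le_fm (Var 0) (Var 1)) (Neg b'))"
  have "d0 3 b'"
    unfolding b'_def by (rule d0_rename[OF b(1)]) simp
  then have c: "d0 2 c"
    unfolding c_def Neg_def using d0_All[of 0 2 "Imp b' Bot"]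
    by (auto intro: d0.intros simp: eval_nat_numeral)
  have satc: "sat NN v c \<longleftrightarrow> (\<forall>d' \<le> v 0. \<not> B d' (v 1))" for v
    by (simp add: c_def b'_def sat_fsubst b(2) le_fm_def numeral_2_eq_2)
  have wff: "wff sigA 1 (Ex (And a c))"
    using d0_wff[OF a(1)] d0_wff[OF c] by (simp add: numeral_2_eq_2)
  have env: "case_nat (std M d) (case_nat (std M n) e) i = std M (case_nat d (\<lambda>_. n) i)"
    if "i < 2" for M :: "tm set str" and d n e i
    using that by (auto simp: less_Suc_eq numeral_2_eq_2)
  have sat_a: "sat M (case_nat (std M d) (case_nat (std M n) e)) a \<longleftrightarrow> A d n"
    and sat_b: "sat M (case_nat (std M d) (case_nat (std M n) e)) b \<longleftrightarrow> B d n"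
    and sat_c: "sat M (case_nat (std M d) (case_nat (std M n) e)) c \<longleftrightarrow> (\<forall>d' \<le> d. \<not> B d' n)"
    if "rmodel M" for M :: "tm set str" and d n e
    using d0_absolute[OF that a(1) env] d0_absolute[OF that b(1) env]
      d0_absolute[OF that c env] by (simp_all add: a(2) b(2) satc)
  show thesis
  proof (rule that[OF wff])
    fix n d
    assume h: "A d n" "\<forall>d' \<le> d. \<not> B d' n"
    show "R \<turnstile> All (Imp (Eq (Var 0) (num_tm n)) (Ex (And a c)))"
    proof (rule R_proves)
      fix M :: "tm set str" and e
      assume M: "rmodel M"
      show "sat M e (All (Imp (Eq (Var 0) (num_tm n)) (Ex (And a c))))"
        using h sat_a[OF M, of d n e] sat_c[OF M, of d n e] rmodelD(1)[OF M, of d] by auto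
    qed (use wff in simp)
  next
    fix n d
    assume h: "B d n" "\<forall>d' < d. A d' n \<longrightarrow> (\<exists>d'' \<le> d'. B d'' n)"
    show "R \<turnstile> All (Imp (Eq (Var 0) (num_tm n)) (Neg (Ex (And a c))))"
    proof (rule R_proves)
      fix M :: "tm set str" and e
      assume M: "rmodel M"
      \<comment> \<open>Rosser's case distinction: a witness \<open>y\<close> below \<open>d\<close>
        is standard and excluded by the assumption; any other \<open>y\<close> lies above
        \<open>d\<close>, and then \<open>B d n\<close> contradicts \<open>c\<close>.\<close>
      have False if y: "y \<in> dm M" "sat M (case_nat y (case_nat (std M n) e)) a"
        "sat M (case_nat y (case_nat (std M n) e)) c" for y
      proof (cases "ri M 0 [y, std M d]")
        case True
        then obtain k where k: "k \<le> d" "y = std M k"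
          using rmodelD(5)[OF M y(1)] by auto
        have "A k n" "\<forall>d' \<le> k. \<not> B d' n"
          using y sat_a[OF M] sat_c[OF M] k by auto
        then show False using h k by (metis le_neq_implies_less)
      next
        case False
        then have "\<not> sat M (case_nat (std M d) (case_nat y (case_nat (std M n) e))) b'"
          using y(3) rmodelD(6)[OF M y(1)] rmodelD(1)[OF M] by (auto simp: c_def le_fm_def)
        then have "\<not> sat M (\<lambda>i. case_nat (std M d) (case_nat y (case_nat (std M n) e)) (2 * i)) b"
          by (simp add: b'_def sat_fsubst)
        also have "sat M (\<lambda>i. case_nat (std M d) (case_nat y (case_nat (std M n) e)) (2 * i)) b \<longleftrightarrow>
          sat M (case_nat (std M d) (case_nat (std M n) e)) b"
          by (rule sat_cong[OF d0_wff[OF b(1)]]) (auto simp: less_Suc_eq numeral_2_eq_2)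
        finally show False using sat_b[OF M] h by simp
      qed
      then show "sat M e (All (Imp (Eq (Var 0) (num_tm n)) (Neg (Ex (And a c)))))"
        by auto
    qed (use wff in simp)
  qed
qed

text \<open>Rosser's idea for functions: a witness must agree with all values found below it. A
  nonstandard witness lies above the standard one \<open>d\<close>, hence agrees with
  \<open>m\<close>. A standard witness bounds its value, which is then standard too, and
  absoluteness of \<open>G\<close> applies.\<close>

lemma represent_function:
  assumes G: "def0 3 (\<lambda>v. G (v 0) (v 1) (v 2))"
  obtains p where "wff sigA 2 p"
    "\<And>d m n. G d m n \<Longrightarrow> m \<le> d \<Longrightarrow> \<forall>d' m'. G d' m' n \<longrightarrow> m' = m \<Longrightarrow>
      R \<turnstile> All (Imp (Eq (Var 0) (num_tm n))
        (All (And (Imp p (Eq (Var 0) (num_tm m))) (Imp (Eq (Var 0) (num_tm m)) p))))"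
proof -
  obtain g where g: "d0 3 g" "\<And>v. sat NN v g \<longleftrightarrow> G (v 0) (v 1) (v 2)"
    using G by (auto simp: def0_def)
  \<comment> \<open>Inside both quantifiers of \<open>h\<close> the variables are z', y', y, z, n,
    and \<open>G\<close> is to be read at y', z', n.\<close>
  define r :: "nat \<Rightarrow> nat" where "r i = (if i = 0 then 1 else if i = 1 then 0 else 4)" for i
  define g' where "g' = fsubst (\<lambda>i. Var (r i)) g"
  have g': "d0 5 g'"
    unfolding g'_def by (rule d0_rename[OF g(1)]) (simp add: r_def)
  define h where "h = All (Imp (le_fm (Var 0) (Var 1))
    (All (Imp (le_fm (Var 0) (Var 1)) (Imp g' (Eq (Var 0) (Var 3))))))"
  define p where "p = Ex (And (le_fm (Var 1) (Var 0)) (And g h))"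
  have wff: "wff sigA 2 p"
    using d0_wff[OF g(1)] d0_wff[OF g'] by (simp add: p_def h_def eval_nat_numeral)
  show thesis
  proof (rule that[OF wff])
    fix d m n
    assume a: "G d m n" "m \<le> d" "\<forall>d' m'. G d' m' n \<longrightarrow> m' = m"
    show "R \<turnstile> All (Imp (Eq (Var 0) (num_tm n))
        (All (And (Imp p (Eq (Var 0) (num_tm m))) (Imp (Eq (Var 0) (num_tm m)) p))))"
    proof (rule R_proves)
      fix M :: "tm set str" and e
      assume M: "rmodel M"
      define E where "E y z = case_nat y (case_nat z (case_nat (std M n) e))" for y z
      have sat_g: "sat M (E (std M y) (std M z)) g \<longleftrightarrow> G y z n" for y z
      proof -
        have "E (std M y) (std M z) i = std M (case_nat y (case_nat z (\<lambda>_. n)) i)" if "i < 3" for i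
          using that by (auto simp: E_def less_Suc_eq eval_nat_numeral)
        then show ?thesis using d0_absolute[OF M g(1)] g(2) by (simp add: eval_nat_numeral)
      qed
      have sat_g': "sat M (case_nat z' (case_nat y' (E y z))) g' \<longleftrightarrow> sat M (E y' z') g" for y z y' z'
        unfolding g'_def sat_fsubst tval.simps
        by (rule sat_cong[OF d0_wff[OF g(1)]])
          (auto simp: less_Suc_eq eval_nat_numeral r_def E_def)
      have sat_p: "sat M (case_nat z (case_nat (std M n) e)) p \<longleftrightarrow> (\<exists>y \<in> dm M. ri M 0 [z, y] \<and>
          sat M (E y z) g \<and> (\<forall>y' \<in> dm M. ri M 0 [y', y] \<longrightarrow> (\<forall>z' \<in> dm M. ri M 0 [z', y'] \<longrightarrow>
            sat M (E y' z') g \<longrightarrow> z' = z)))" for z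
        using sat_g' by (simp add: p_def h_def le_fm_def E_def eval_nat_numeral)
      have sound: "z = std M m" if z: "z \<in> dm M" "sat M (case_nat z (case_nat (std M n) e)) p" for z
      proof -
        obtain y where y: "y \<in> dm M" "ri M 0 [z, y]" "sat M (E y z) g"
          "\<And>y' z'. \<lbrakk>y' \<in> dm M; ri M 0 [y', y]; z' \<in> dm M; ri M 0 [z', y']; sat M (E y' z') g\<rbrakk> \<Longrightarrow> z' = z"
          using z(2) unfolding sat_p by blast
        show ?thesis
        proof (cases "ri M 0 [y, std M d]")
          case True
          then obtain k where k: "y = std M k" using rmodelD(5)[OF M y(1)] by auto
          then obtain l where l: "z = std M l" using rmodelD(5)[OF M z(1)] y(2) by auto
          show ?thesis using y(3) a(3) sat_g k l by blast
        next
          case False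
          \<comment> \<open>The standard witness is now below \<open>y\<close>, so the uniqueness
            clause of \<open>p\<close> compares its value \<open>m\<close> with
            \<open>z\<close>.\<close>
          then have "ri M 0 [std M d, y]" using rmodelD(6)[OF M y(1)] by blast
          moreover have "ri M 0 [std M m, std M d]"
            using rmodelD(5)[OF M rmodelD(1)[OF M]] a(2) by blast
          ultimately show ?thesis
            using y(4)[of "std M d" "std M m"] rmodelD(1)[OF M] sat_g a(1) by auto
        qed
      qed
      have unique: "z' = std M m" if yz: "y' \<in> dm M" "ri M 0 [y', std M d]" "z' \<in> dm M"
        "ri M 0 [z', y']" "sat M (E y' z') g" for y' z'
      proof -
        obtain k where k: "y' = std M k" using rmodelD(5)[OF M yz(1)] yz(2) by blast
        obtain l where l: "z' = std M l" using rmodelD(5)[OF M yz(3)] yz(4) k by blast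
        show ?thesis using yz(5) a(3) sat_g k l by blast
      qed
      have "ri M 0 [std M m, std M d]" "sat M (E (std M d) (std M m)) g"
        using a(1,2) sat_g rmodelD(5)[OF M rmodelD(1)[OF M]] by blast+
      then have complete: "sat M (case_nat (std M m) (case_nat (std M n) e)) p"
        unfolding sat_p using unique by (intro bexI[OF _ rmodelD(1)[OF M, of d]] conjI ballI HOL.impI)
      have iff: "\<forall>z \<in> dm M. sat M (case_nat z (case_nat (std M n) e)) p \<longleftrightarrow> z = std M m"
        using sound complete by blast
      show "sat M e (All (Imp (Eq (Var 0) (num_tm n))
        (All (And (Imp p (Eq (Var 0) (num_tm m))) (Imp (Eq (Var 0) (num_tm m)) p)))))"
        using iff by auto
    qed (use wff in \<open>simp add: numeral_2_eq_2\<close>)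
  qed
qed

text \<open>Its translation guarantees that each numeral has a value in the domain of an
  interpretation.\<close>

lemma R_ex_num: "R \<turnstile> Ex (Eq (Var 0) (num_tm n))"
  by (rule R_proves) (auto simp: rmodel_def)

section \<open>Derivability in logic programs\<close>

text \<open>Patterns of Horn clauses over numbers. Besides pairing there is successor because the
  code of a nonempty list is the successor of a pair.\<close>

datatype pat = PVar nat | PNum nat | PPair pat pat | PSuc pat

primrec pev :: "(nat \<Rightarrow> nat) \<Rightarrow> pat \<Rightarrow> nat" where
  "pev e (PVar i) = e i"
| "pev e (PNum n) = n"
| "pev e (PPair p q) = prod_encode (pev e p, pev e q)"
| "pev e (PSuc p) = Suc (pev e p)"

primrec pbound :: "nat \<Rightarrow> pat \<Rightarrow> bool" where
  "pbound r (PVar i) = (i < r)"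
| "pbound r (PNum n) = True"
| "pbound r (PPair p q) = (pbound r p \<and> pbound r q)"
| "pbound r (PSuc p) = pbound r p"

type_synonym clause = "pat list \<times> pat"

inductive der :: "clause list \<Rightarrow> nat \<Rightarrow> bool" for Q where
  der: "(b, h) \<in> set Q \<Longrightarrow> \<forall>q \<in> set b. der Q (pev e q) \<Longrightarrow> der Q (pev e h)"

definition prog_bound :: "nat \<Rightarrow> clause list \<Rightarrow> bool" where
  "prog_bound r Q \<longleftrightarrow> (\<forall>(b, h) \<in> set Q. pbound r h \<and> (\<forall>q \<in> set b. pbound r q))"

lemma pev_cong: "pbound r q \<Longrightarrow> (\<And>i. i < r \<Longrightarrow> d i = e i) \<Longrightarrow> pev d q = pev e q"
  by (induction q) auto

text \<open>The triangular number inside the pairing function hides a division by 2; doubling leaves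
  a polynomial equation, expressible by terms of \<open>sigA\<close>.\<close>

lemma eq_prod_encode_iff:
  "x = prod_encode (u, w) \<longleftrightarrow> x + x = (u + w) * Suc (u + w) + (u + u)"
proof -
  have "even ((u + w) * Suc (u + w))" by simp
  then have "2 * triangle (u + w) = (u + w) * Suc (u + w)"
    unfolding triangle_def by (rule dvd_mult_div_cancel)
  then show ?thesis by (simp only: prod_encode_def prod.case) linarith
qed

lemma def0_pair:
  assumes "arith k f" "arith k g" "arith k h"
  shows "def0 k (\<lambda>v. f v = prod_encode (g v, h v))"
  unfolding eq_prod_encode_iff
  by (intro def0_eq arith_plus arith_times arith_Suc assms)

lemma def0_eq_Suc: "arith k f \<Longrightarrow> arith k g \<Longrightarrow> def0 k (\<lambda>v. f v = Suc (g v))"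
  by (intro def0_eq arith_Suc)

text \<open>Subpatterns have values at most the value of the whole pattern, so these can be
  quantified boundedly. The offset \<open>s\<close> counts the quantifiers introduced in this way,
  which shift the pattern variables.\<close>

lemma def0_pev:
  "pbound r q \<Longrightarrow> r + s \<le> k \<Longrightarrow> x < k \<Longrightarrow> def0 k (\<lambda>v. pev (\<lambda>i. v (i + s)) q = v x)"
proof (induction q arbitrary: s k x)
  case (PVar i)
  then show ?case by (auto intro!: def0_eq arith_var)
next
  case (PNum n)
  then show ?case by (auto intro!: def0_eq arith_var arith_const)
next
  case (PPair p q)
  have "def0 k (\<lambda>v. \<exists>u \<le> v x. \<exists>w \<le> v x. v x = prod_encode (u, w) \<and>
      pev (\<lambda>i. v (i + s)) p = u \<and> pev (\<lambda>i. v (i + s)) q = w)"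
    using PPair.IH(1)[of "Suc (Suc s)" "Suc (Suc k)" 1] PPair.IH(2)[of "Suc (Suc s)" "Suc (Suc k)" 0]
      PPair.prems
    by (intro def0_bex def0_conj def0_pair arith_var) auto
  moreover have "(\<exists>u \<le> v x. \<exists>w \<le> v x. v x = prod_encode (u, w) \<and>
      pev (\<lambda>i. v (i + s)) p = u \<and> pev (\<lambda>i. v (i + s)) q = w) \<longleftrightarrow>
      pev (\<lambda>i. v (i + s)) (PPair p q) = v x" for v
    using le_prod_encode_1[of "pev (\<lambda>i. v (i + s)) p" "pev (\<lambda>i. v (i + s)) q"]
      le_prod_encode_2[of "pev (\<lambda>i. v (i + s)) q" "pev (\<lambda>i. v (i + s)) p"] by auto
  ultimately show ?case by simp
next
  case (PSuc q)
  have "def0 k (\<lambda>v. \<exists>u \<le> v x. v x = Suc u \<and> pev (\<lambda>i. v (i + s)) q = u)"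
    using PSuc.IH[of "Suc s" "Suc k" 0] PSuc.prems
    by (intro def0_bex def0_conj def0_eq_Suc arith_var) auto
  moreover have "(\<exists>u \<le> v x. v x = Suc u \<and> pev (\<lambda>i. v (i + s)) q = u) \<longleftrightarrow>
      pev (\<lambda>i. v (i + s)) (PSuc q) = v x" for v
    by auto
  ultimately show ?case by simp
qed

lemma def0_neq: "i < k \<Longrightarrow> j < k \<Longrightarrow> def0 k (\<lambda>v. v i \<noteq> v j)"
  by (intro def0_not def0_eq arith_var)

lemma def0_bex_upto:
  assumes "def0 (k + r) P" "j < k"
  shows "def0 k (\<lambda>v. \<exists>ps. (\<forall>i < r. ps i \<le> v j) \<and> P (\<lambda>i. if i < r then ps i else v (i - r)))"
  using assms
proof (induction r arbitrary: k j)
  case (Suc r)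
  \<comment> \<open>The outermost quantifier takes the variable with index \<open>r\<close>; the
    induction hypothesis binds those below it.\<close>
  have *: "def0 (Suc k) (\<lambda>v. \<exists>ps. (\<forall>i < r. ps i \<le> v (Suc j)) \<and>
      P (\<lambda>i. if i < r then ps i else v (i - r)))"
    using Suc.prems by (intro Suc.IH) auto
  have "(case n of 0 \<Rightarrow> v 0 | Suc i \<Rightarrow> v (Suc i)) = v n" for v :: "nat \<Rightarrow> nat" and n
    by (simp split: nat.split)
  then have "(\<lambda>v. \<exists>ps. (\<forall>i < r. ps i \<le> v (Suc j)) \<and>
      P (\<lambda>i. if i < r then ps i else case_nat (v 0) (\<lambda>i. v (Suc i)) (i - r))) =
      (\<lambda>v. \<exists>ps. (\<forall>i < r. ps i \<le> v (Suc j)) \<and> P (\<lambda>i. if i < r then ps i else v (i - r)))"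
    by (intro ext) (rule arg_cong[where f = HOL.Ex], rule ext, rule arg_cong2[where f = "(\<and>)"],
      rule HOL.refl, rule arg_cong[where f = P], rule ext, simp)
  with * have "def0 k (\<lambda>v. \<exists>x \<le> v j. \<exists>ps. (\<forall>i < r. ps i \<le> v j) \<and>
      P (\<lambda>i. if i < r then ps i else case_nat x v (i - r)))"
    by (intro def0_bex Suc.prems(2)) simp
  moreover have "(\<exists>x \<le> v j. \<exists>ps. (\<forall>i < r. ps i \<le> v j) \<and>
      P (\<lambda>i. if i < r then ps i else case_nat x v (i - r))) \<longleftrightarrow>
      (\<exists>ps. (\<forall>i < Suc r. ps i \<le> v j) \<and> P (\<lambda>i. if i < Suc r then ps i else v (i - Suc r)))"
    (is "?l \<longleftrightarrow> ?r") for v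
  proof
    assume ?l
    then obtain x ps where x: "x \<le> v j" "\<forall>i < r. ps i \<le> v j"
      "P (\<lambda>i. if i < r then ps i else case_nat x v (i - r))" by blast
    have "(\<lambda>i. if i < r then ps i else case_nat x v (i - r)) =
        (\<lambda>i. if i < Suc r then (ps(r := x)) i else v (i - Suc r))"
      by (rule ext) (auto split: nat.split simp: less_Suc_eq diff_Suc)
    then show ?r using x by (intro exI[of _ "ps(r := x)"]) (auto simp: less_Suc_eq)
  next
    assume ?r
    then obtain ps where x: "\<forall>i < Suc r. ps i \<le> v j"
      "P (\<lambda>i. if i < Suc r then ps i else v (i - Suc r))" by blast
    have "(\<lambda>i. if i < r then ps i else case_nat (ps r) v (i - r)) =
        (\<lambda>i. if i < Suc r then ps i else v (i - Suc r))"
      by (rule ext) (auto split: nat.split simp: less_Suc_eq diff_Suc)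
    with x have "P (\<lambda>i. if i < r then ps i else case_nat (ps r) v (i - r))" by simp
    moreover have "ps r \<le> v j" "\<forall>i < r. ps i \<le> v j" using x(1) by simp_all
    ultimately show ?l by blast
  qed
  ultimately show ?case by simp
qed simp

text \<open>Finite sets are coded by divisibility: for \<open>b\<close> divisible by all positive numbers up to \<open>c\<close>,
  the numbers \<open>1 + (k + 1) b\<close> with \<open>k \<le> c\<close> are pairwise coprime.\<close>

definition mem :: "nat \<Rightarrow> nat \<Rightarrow> nat \<Rightarrow> bool" where
  "mem a b k \<longleftrightarrow> Suc (Suc k * b) dvd a"

lemma mem_iff: "mem a b k \<longleftrightarrow> (\<exists>q \<le> a. a = q * Suc (Suc k * b))"
proof (cases "a = 0")
  case False
  have "q \<le> a" if "a = q * Suc (Suc k * b)" for q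
    unfolding that by simp
  then show ?thesis unfolding mem_def dvd_def by (metis mult.commute)
qed (simp add: mem_def)

lemma def0_mem: "ia < k \<Longrightarrow> ib < k \<Longrightarrow> i < k \<Longrightarrow> def0 k (\<lambda>v. mem (v ia) (v ib) (v i))"
  unfolding mem_iff by (intro def0_bex def0_eq arith_times arith_Suc arith_var) auto

text \<open>A common divisor divides \<open>(j - i) * b\<close> and is coprime to \<open>b\<close>;
  so it divides \<open>j - i\<close>, hence \<open>b\<close> itself, and is a unit.\<close>

lemma coprime_mem:
  fixes b :: nat
  assumes "i < j" "j - i dvd b"
  shows "coprime (Suc (Suc i * b)) (Suc (Suc j * b))"
proof (rule coprimeI)
  fix g
  assume g: "g dvd Suc (Suc i * b)" "g dvd Suc (Suc j * b)"
  have "Suc j * b = Suc i * b + (j - i) * b"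
    using assms(1) by (simp add: algebra_simps flip: add_mult_distrib)
  then have "Suc (Suc j * b) - Suc (Suc i * b) = (j - i) * b" by simp
  then have "g dvd (j - i) * b" using dvd_diff_nat[OF g(2,1)] by simp
  moreover have "coprime g b"
  proof (rule coprimeI)
    fix h assume "h dvd g" "h dvd b"
    then have "h dvd Suc i * b + 1" "h dvd Suc i * b"
      using g(1) dvd_trans by auto
    then show "is_unit h" by (simp only: dvd_add_right_iff)
  qed
  ultimately have "g dvd j - i" by (simp add: coprime_dvd_mult_left_iff)
  then have "g dvd b" using assms(2) by (rule dvd_trans)
  with \<open>coprime g b\<close> show "is_unit g" by (metis coprime_absorb_left)
qed

text \<open>Goedel's choice \<open>b = c!\<close> makes the moduli pairwise coprime. The product
  over \<open>S\<close> is then divisible by no other modulus, since each of them exceeds 1.\<close>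

lemma ex_mem:
  assumes "S \<subseteq> {..c}"
  obtains a b where "\<And>k. k \<le> c \<Longrightarrow> mem a b k \<longleftrightarrow> k \<in> S"
proof -
  define b where "b = \<Prod>{1..c}"
  define a where "a = (\<Prod>k \<in> S. Suc (Suc k * b))"
  have fin: "finite S" using assms finite_subset by blast
  have b: "b \<noteq> 0" by (simp add: b_def)
  have co: "coprime (Suc (Suc i * b)) (Suc (Suc j * b))" if "i \<le> c" "j \<le> c" "i \<noteq> j" for i j
  proof -
    have "n dvd b" if "0 < n" "n \<le> c" for n
      unfolding b_def by (rule dvd_prodI[where f = "\<lambda>x. x"]) (use that in auto)
    then show ?thesis
      using that coprime_mem[of i j b] coprime_mem[of j i b]
      by (cases "i < j") (auto simp: coprime_commute)
  qed
  show thesis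
  proof (rule that)
    fix k
    assume k: "k \<le> c"
    show "mem a b k \<longleftrightarrow> k \<in> S"
    proof
      assume "k \<in> S"
      then show "mem a b k" unfolding mem_def a_def by (rule dvd_prodI[OF fin])
    next
      assume m: "mem a b k"
      show "k \<in> S"
      proof (rule ccontr)
        assume "k \<notin> S"
        then have "coprime (Suc (Suc k * b)) a"
          unfolding a_def using k assms by (intro prod_coprime_right co) auto
        then have "is_unit (Suc (Suc k * b))"
          using m unfolding mem_def by (metis coprime_absorb_left)
        then show False using b by simp
      qed
    qed
  qed
qed

text \<open>Everything is bounded by a variable so that the relation becomes a bounded formula.
  Bounded quantifiers only offer \<open>\<le>\<close>, so an earlier time is written
  \<open>t' \<le> t\<close> with \<open>t' \<noteq> t\<close>; \<open>g\<close> names the value of a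
  pattern.\<close>

definition justified :: "clause list \<Rightarrow> nat \<Rightarrow> nat \<Rightarrow> nat \<Rightarrow> nat \<Rightarrow> nat \<Rightarrow> nat \<Rightarrow> bool" where
  "justified Q r a b c t f \<longleftrightarrow> (\<exists>(bd, h) \<in> set Q. \<exists>ps. (\<forall>i < r. ps i \<le> c) \<and> pev ps h = f \<and>
     (\<forall>q \<in> set bd. \<exists>t' \<le> t. t' \<noteq> t \<and>
        (\<exists>g \<le> c. \<exists>k \<le> c. k = prod_encode (t', g) \<and> mem a b k \<and> pev ps q = g)))"

lemma def0_justified:
  assumes Q: "prog_bound r Q" and i: "ia < k" "ib < k" "ic < k" "it < k" "jf < k"
  shows "def0 k (\<lambda>v. justified Q r (v ia) (v ib) (v ic) (v it) (v jf))"
  unfolding justified_def case_prod_beta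
proof (rule def0_bex_list)
  fix cl assume cl: "cl \<in> set Q"
  obtain bd h where bh: "cl = (bd, h)" by force
  have bound: "pbound r h" "\<And>q. q \<in> set bd \<Longrightarrow> pbound r q"
    using Q cl bh by (auto simp: prog_bound_def)
  define P where "P w \<longleftrightarrow> pev w h = w (jf + r) \<and> (\<forall>q \<in> set bd. \<exists>t' \<le> w (it + r). t' \<noteq> w (it + r) \<and>
      (\<exists>g \<le> w (ic + r). \<exists>k \<le> w (ic + r). k = prod_encode (t', g) \<and>
        mem (w (ia + r)) (w (ib + r)) k \<and> pev w q = g))" for w
  have "def0 (k + r) P"
    unfolding P_def
  proof (intro def0_conj def0_ball_list)
    show "def0 (k + r) (\<lambda>w. pev w h = w (jf + r))"
      using def0_pev[OF bound(1), of 0 "k + r" "jf + r"] i by simp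
    fix q assume q: "q \<in> set bd"
    have "def0 (Suc (Suc (Suc (k + r)))) (\<lambda>w. pev (\<lambda>i. w (Suc (Suc (Suc i)))) q = w 1)"
      using def0_pev[OF bound(2)[OF q], of 3 "Suc (Suc (Suc (k + r)))" 1] by (simp add: eval_nat_numeral)
    then show "def0 (k + r) (\<lambda>w. \<exists>t' \<le> w (it + r). t' \<noteq> w (it + r) \<and>
      (\<exists>g \<le> w (ic + r). \<exists>k \<le> w (ic + r). k = prod_encode (t', g) \<and>
        mem (w (ia + r)) (w (ib + r)) k \<and> pev w q = g))"
      using i by (intro def0_bex def0_conj def0_neq def0_pair def0_mem arith_var) auto
  qed
  note def0_bex_upto[OF this i(3)]
  moreover have "(\<exists>ps. (\<forall>i < r. ps i \<le> v ic) \<and> P (\<lambda>i. if i < r then ps i else v (i - r))) \<longleftrightarrow>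
      (\<exists>ps. (\<forall>i < r. ps i \<le> v ic) \<and> pev ps (snd cl) = v jf \<and>
       (\<forall>q \<in> set (fst cl). \<exists>t' \<le> v it. t' \<noteq> v it \<and>
        (\<exists>g \<le> v ic. \<exists>k \<le> v ic. k = prod_encode (t', g) \<and> mem (v ia) (v ib) k \<and> pev ps q = g)))" for v
  proof -
    have "pev (\<lambda>i. if i < r then ps i else v (i - r)) q = pev ps q" if "pbound r q" for ps q
      by (rule pev_cong[OF that]) simp
    then show ?thesis using bound by (simp add: P_def bh)
  qed
  ultimately show "def0 k (\<lambda>v. \<exists>ps. (\<forall>i < r. ps i \<le> v ic) \<and> pev ps (snd cl) = v jf \<and>
       (\<forall>q \<in> set (fst cl). \<exists>t' \<le> v it. t' \<noteq> v it \<and>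
        (\<exists>g \<le> v ic. \<exists>k \<le> v ic. k = prod_encode (t', g) \<and> mem (v ia) (v ib) k \<and> pev ps q = g)))"
    by simp
qed

text \<open>A derivation is coded as a finite set of pairs of a time and a fact, each fact being obtained
  from facts with smaller times.\<close>

definition accepts :: "clause list \<Rightarrow> nat \<Rightarrow> nat \<Rightarrow> nat \<Rightarrow> bool" where
  "accepts Q r d f \<longleftrightarrow> (\<exists>a \<le> d. \<exists>b \<le> d. \<exists>c \<le> d.
     (\<forall>k \<le> c. mem a b k \<longrightarrow> (\<forall>t \<le> k. \<forall>g \<le> k. k = prod_encode (t, g) \<longrightarrow> justified Q r a b c t g)) \<and>
     (\<exists>k \<le> c. \<exists>t \<le> c. k = prod_encode (t, f) \<and> mem a b k))"

lemma def0_accepts: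
  assumes "prog_bound r Q" "x < k" "y < k"
  shows "def0 k (\<lambda>v. accepts Q r (v x) (v y))"
  unfolding accepts_def
  by (intro def0_bex def0_ball def0_conj def0_imp def0_pair def0_mem arith_var def0_justified assms)
    (use assms in auto)

text \<open>Derivability follows by induction on the time. The bound \<open>f \<le> d\<close> later
  allows the queried fact, and a function value inside it, to be bounded by the witness.\<close>

lemma accepts_sound:
  assumes "accepts Q r d f"
  shows "der Q f" "f \<le> d"
proof -
  obtain a b c t where c: "c \<le> d"
    "\<And>t g. mem a b (prod_encode (t, g)) \<Longrightarrow> prod_encode (t, g) \<le> c \<Longrightarrow> justified Q r a b c t g"
    "prod_encode (t, f) \<le> c" "mem a b (prod_encode (t, f))"
    using assms unfolding accepts_def by (metis le_prod_encode_1 le_prod_encode_2)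
  show "f \<le> d" using c(1,3) le_prod_encode_2[of f t] by linarith
  have "der Q g" if "mem a b (prod_encode (t, g))" "prod_encode (t, g) \<le> c" for t g
    using that
  proof (induction t arbitrary: g rule: less_induct)
    case (less t)
    from c(2)[OF less.prems] obtain bd h ps where h: "(bd, h) \<in> set Q" "pev ps h = g"
      "\<forall>q \<in> set bd. \<exists>t' \<le> t. t' \<noteq> t \<and> prod_encode (t', pev ps q) \<le> c \<and> mem a b (prod_encode (t', pev ps q))"
      unfolding justified_def by blast
    then have "\<forall>q \<in> set bd. der Q (pev ps q)"
      using less.IH by (metis le_neq_implies_less)
    then show ?case using der.der h by blast
  qed
  then show "der Q f" using c by blast
qed

text \<open>The assignment is explicit because its values have to enter the bound of the
  code.\<close>

definition steps :: "clause list \<Rightarrow> (nat \<times> nat) set \<Rightarrow> (nat \<Rightarrow> nat) \<Rightarrow> nat \<times> nat \<Rightarrow> bool" where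
  "steps Q K e x \<longleftrightarrow> (\<exists>(b, h) \<in> set Q. pev e h = snd x \<and>
     (\<forall>q \<in> set b. \<exists>t' < fst x. (t', pev e q) \<in> K))"

lemma steps_mono: "steps Q K e x \<Longrightarrow> K \<subseteq> L \<Longrightarrow> steps Q L e x"
  unfolding steps_def by blast

text \<open>The sets for the premises are united and the conclusion gets a time beyond all of
  theirs. Enlarging a set preserves justifications, so overlaps do no harm.\<close>

lemma der_finite:
  "der Q f \<Longrightarrow> \<exists>K t. finite K \<and> (t, f) \<in> K \<and> (\<forall>x \<in> K. \<exists>e. steps Q K e x)"
proof (induction rule: der.induct)
  case (der b h e)
  then have "\<forall>q \<in> set b. \<exists>K t. finite K \<and> (t, pev e q) \<in> K \<and> (\<forall>x \<in> K. \<exists>e. steps Q K e x)"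
    by blast
  then obtain K t where Kt: "\<And>q. q \<in> set b \<Longrightarrow> finite (K q) \<and> (t q, pev e q) \<in> K q \<and>
      (\<forall>x \<in> K q. \<exists>e. steps Q (K q) e x)"
    by metis
  define T where "T = Suc (\<Sum>q \<in> set b. t q)"
  define L where "L = insert (T, pev e h) (\<Union>q \<in> set b. K q)"
  have "t q < T" if "q \<in> set b" for q
    using member_le_sum[of q "set b" t] that by (simp add: T_def)
  then have "steps Q L e (T, pev e h)"
    unfolding steps_def using der.hyps Kt by (intro bexI[of _ "(b, h)"]) (auto simp: L_def)
  moreover have "\<exists>e. steps Q L e x" if "q \<in> set b" "x \<in> K q" for q x
  proof -
    have "K q \<subseteq> L" using that by (auto simp: L_def)
    then show ?thesis using Kt that steps_mono by blast
  qed
  ultimately have "\<forall>x \<in> L. \<exists>e. steps Q L e x" unfolding L_def by blast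
  moreover have "finite L" using Kt by (simp add: L_def)
  ultimately show ?case by (intro exI[of _ L] exI[of _ T]) (auto simp: L_def)
qed

lemma accepts_complete:
  assumes "der Q f"
  shows "\<exists>d. accepts Q r d f"
proof -
  obtain K t where K: "finite K" "(t, f) \<in> K" "\<forall>x \<in> K. \<exists>e. steps Q K e x"
    using der_finite[OF assms] by blast
  then obtain e where e: "\<And>x. x \<in> K \<Longrightarrow> steps Q K (e x) x" by metis
  \<comment> \<open>One bound for all pair codes and for the values of all pattern variables used in
    the derivation.\<close>
  define c where "c = (\<Sum>x \<in> K. prod_encode x + (\<Sum>i < r. e x i))"
  have c: "prod_encode x + (\<Sum>i < r. e x i) \<le> c" if "x \<in> K" for x
    unfolding c_def using that K(1) by (intro member_le_sum) auto
  have ce: "e x i \<le> c" if "x \<in> K" "i < r" for x i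
  proof -
    have "e x i \<le> (\<Sum>i < r. e x i)" by (rule member_le_sum) (use that in auto)
    then show ?thesis using c[OF that(1)] by linarith
  qed
  have le: "prod_encode x \<le> c" if "x \<in> K" for x
    using c[OF that] by linarith
  then have "prod_encode ` K \<subseteq> {..c}" by blast
  then obtain a b where ab: "\<And>k. k \<le> c \<Longrightarrow> mem a b k \<longleftrightarrow> k \<in> prod_encode ` K"
    by (rule ex_mem) blast
  have mem: "prod_encode x \<le> c" "mem a b (prod_encode x)" if "x \<in> K" for x
    using ab[OF le[OF that]] le[OF that] that by blast+
  have just: "justified Q r a b c t g" if "(t, g) \<in> K" for t g
  proof -
    from e[OF that] obtain bd h where h: "(bd, h) \<in> set Q" "pev (e (t, g)) h = g"
      "\<forall>q \<in> set bd. \<exists>t' < t. (t', pev (e (t, g)) q) \<in> K"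
      unfolding steps_def by auto
    have "\<exists>t' \<le> t. t' \<noteq> t \<and> (\<exists>g' \<le> c. \<exists>k \<le> c. k = prod_encode (t', g') \<and> mem a b k \<and> pev (e (t, g)) q = g')"
      if q: "q \<in> set bd" for q
    proof -
      obtain t' where t': "t' < t" "(t', pev (e (t, g)) q) \<in> K" using h(3) q by blast
      then show ?thesis
        using mem[OF t'(2)] le_prod_encode_2[of "pev (e (t, g)) q" t']
        by (intro exI[of _ t']) auto
    qed
    then show ?thesis
      unfolding justified_def using h ce[OF that]
      by (intro bexI[of _ "(bd, h)"]) auto
  qed
  have "(\<forall>k \<le> c. mem a b k \<longrightarrow> (\<forall>t \<le> k. \<forall>g \<le> k. k = prod_encode (t, g) \<longrightarrow> justified Q r a b c t g))"
    using just ab by auto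
  moreover have "\<exists>k \<le> c. \<exists>t \<le> c. k = prod_encode (t, f) \<and> mem a b k"
  proof -
    have "t \<le> c" using mem[OF K(2)] le_prod_encode_1[of t f] by linarith
    then show ?thesis using mem[OF K(2)] by blast
  qed
  moreover have "a \<le> a + b + c" "b \<le> a + b + c" "c \<le> a + b + c" by simp_all
  ultimately have "accepts Q r (a + b + c) f"
    unfolding accepts_def by blast
  then show ?thesis ..
qed

lemma der_iff_accepts: "der Q f \<longleftrightarrow> (\<exists>d. accepts Q r d f)"
  using accepts_sound accepts_complete by blast

section \<open>A logic program for provability\<close>

lemma less_prod_encode: "a < prod_encode (Suc t, a)"
  by (simp add: prod_encode_def)

lemma set_list_decode_less: "x \<in> set (list_decode l) \<Longrightarrow> x < l"
proof (induction l rule: list_decode.induct)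
  case (2 n)
  obtain y m where ym: "prod_decode n = (y, m)" by force
  then have n: "n = prod_encode (y, m)" by (metis prod_decode_inverse)
  have "y \<le> n" "m \<le> n" unfolding n by (rule le_prod_encode_1, rule le_prod_encode_2)
  then show ?case using 2 ym by (auto simp: less_Suc_eq_le)
qed simp

text \<open>Clauses may match arbitrary numbers. With a total decoder their soundness can be proved
  for whatever these numbers decode to, and the program needs no syntax checks.\<close>

function decT :: "nat \<Rightarrow> tm" where
  "decT n = (case prod_decode n of (0, i) \<Rightarrow> Var i | (Suc f, l) \<Rightarrow> Fun f (map decT (list_decode l)))"
  by auto
termination
proof (relation "measure id")
  fix n x y t l
  assume "(x, y) = prod_decode n" "x = Suc t" "l \<in> set (list_decode y)"
  then have "n = prod_encode (Suc t, y)" by (metis prod_decode_inverse)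
  then show "(l, n) \<in> measure id"
    using set_list_decode_less[OF \<open>l \<in> _\<close>] less_prod_encode[of y t] by simp
qed simp

declare decT.simps [simp del]

lemma decT_simps [simp]:
  "decT (prod_encode (0, i)) = Var i"
  "decT (prod_encode (Suc f, l)) = Fun f (map decT (list_decode l))"
  by (simp_all add: decT.simps)

lemma decT_gnt [simp]: "decT (gnt t) = t"
  by (induction t) (auto simp: map_idI)

text \<open>For totality, tags above 4 are read as \<open>All\<close> and any number with tag 0 as
  \<open>Bot\<close>.\<close>

function decF :: "nat \<Rightarrow> fm" where
  "decF n = (case prod_decode n of (t, a) \<Rightarrow> case prod_decode a of (x, y) \<Rightarrow>
     if t = 0 then Bot
     else if t = 1 then Eq (decT x) (decT y)
     else if t = 2 then Rel x (map decT (list_decode y))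
     else if t = 3 then Imp (decF x) (decF y)
     else All (decF a))"
  by auto
termination
proof (relation "measure id")
  fix n t a x y
  assume *: "(t, a) = prod_decode n" "(x, y) = prod_decode a" "t \<noteq> 0"
  then have "n = prod_encode (Suc (t - 1), a)" "a = prod_encode (x, y)"
    by (metis Suc_pred' not_gr_zero prod_decode_inverse, metis prod_decode_inverse)
  then have "a < n" "x \<le> a" "y \<le> a"
    using less_prod_encode le_prod_encode_1 le_prod_encode_2 by metis+
  then show "(x, n) \<in> measure id" "(y, n) \<in> measure id" "(a, n) \<in> measure id" by auto
qed simp

declare decF.simps [simp del]

lemma decF_simps [simp]:
  "decF (prod_encode (0, a)) = Bot"
  "decF (prod_encode (Suc 0, prod_encode (s, t))) = Eq (decT s) (decT t)"
  "decF (prod_encode (2, prod_encode (r, l))) = Rel r (map decT (list_decode l))"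
  "decF (prod_encode (3, prod_encode (p, q))) = Imp (decF p) (decF q)"
  "decF (prod_encode (4, p)) = All (decF p)"
  by (simp_all add: decF.simps split: prod.split)

lemma decF_gn [simp]: "decF (gn p) = p"
  by (induction p) (auto simp: map_idI)

function decS :: "nat \<Rightarrow> nat \<Rightarrow> tm" where
  "decS n = (case prod_decode n of (0, m) \<Rightarrow> (\<lambda>i. Var (i + m)) | (Suc t, s) \<Rightarrow> case_nat (decT t) (decS s))"
  by auto
termination
proof (relation "measure id")
  fix n x y t
  assume "(x, y) = prod_decode n" "x = Suc t"
  then have "n = prod_encode (Suc t, y)" by (metis prod_decode_inverse)
  then show "(y, n) \<in> measure id" by (simp add: less_prod_encode)
qed simp

declare decS.simps [simp del]

lemma decS_simps [simp]:
  "decS (prod_encode (0, m)) = (\<lambda>i. Var (i + m))"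
  "decS (prod_encode (Suc t, s)) = case_nat (decT t) (decS s)"
  by (simp_all add: decS.simps)

section \<open>Evaluation on codes of recursive functions\<close>

lemma code_inj: "code f = code g \<Longrightarrow> f = g"
proof (induction f arbitrary: g)
  case (Comp f fs)
  then obtain h hs where g: "g = Comp h hs" and e: "map code fs = map code hs" "code f = code h"
    by (cases g) (auto dest: injD[OF inj_list_encode])
  have "fs = hs"
    using e Comp.IH by (simp add: list_eq_iff_nth_eq)
  then show ?case using g e Comp.IH by simp
qed (case_tac g, auto)+

text \<open>The base case of primitive recursion never runs the step function, so the program must
  check separately that this number is a code; otherwise numbers outside the range of
  \<open>code\<close> would be evaluated.\<close>

definition is_code :: "nat \<Rightarrow> bool" where
  "is_code c \<longleftrightarrow> c \<in> range code"

definition evc :: "nat \<Rightarrow> nat list \<Rightarrow> nat \<Rightarrow> bool" where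
  "evc c xs y \<longleftrightarrow> (\<exists>f. code f = c \<and> ev f xs y)"

lemma W_iff: "x \<in> W i \<longleftrightarrow> (\<exists>y. evc i [x] y)"
  by (auto simp: W_def evc_def)

lemma is_code_intros:
  "is_code (prod_encode (0, 0))" "is_code (prod_encode (Suc 0, 0))" "is_code (prod_encode (2, i))"
  "is_code f \<Longrightarrow> \<forall>c \<in> set (list_decode gs). is_code c \<Longrightarrow> is_code (prod_encode (3, prod_encode (f, gs)))"
  "is_code f \<Longrightarrow> is_code g \<Longrightarrow> is_code (prod_encode (4, prod_encode (f, g)))"
  "is_code f \<Longrightarrow> is_code (prod_encode (5, f))"
proof -
  show "is_code (prod_encode (0, 0))" unfolding is_code_def by (rule range_eqI[of _ _ Zero]) simp
  show "is_code (prod_encode (Suc 0, 0))" unfolding is_code_def by (rule range_eqI[of _ _ Succ]) simp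
  show "is_code (prod_encode (2, i))" unfolding is_code_def by (rule range_eqI[of _ _ "Proj i"]) simp
  show "is_code (prod_encode (4, prod_encode (f, g)))" if fg: "is_code f" "is_code g"
  proof -
    obtain f' g' where "f = code f'" "g = code g'" using fg by (auto simp: is_code_def)
    then show ?thesis unfolding is_code_def by (intro range_eqI[of _ _ "Prec f' g'"]) simp
  qed
  show "is_code (prod_encode (5, f))" if f: "is_code f"
  proof -
    obtain f' where "f = code f'" using f by (auto simp: is_code_def)
    then show ?thesis unfolding is_code_def by (intro range_eqI[of _ _ "Mu f'"]) simp
  qed
  show "is_code (prod_encode (3, prod_encode (f, gs)))"
    if fgs: "is_code f" "\<forall>c \<in> set (list_decode gs). is_code c"
  proof -
    obtain f' where f: "f = code f'" using fgs by (auto simp: is_code_def)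
    have "list_decode gs \<in> lists (range code)" using fgs by (auto simp: is_code_def lists_eq_set)
    then obtain gs' where "list_decode gs = map code gs'" by (metis ex_map_conv in_listsD rangeE)
    then have "gs = list_encode (map code gs')" by (metis list_decode_inverse)
    then show ?thesis unfolding is_code_def using f by (intro range_eqI[of _ _ "Comp f' gs'"]) simp
  qed
qed

lemma list_all2_evc:
  "list_all2 (\<lambda>g y. evc g xs y) gs ys \<Longrightarrow> \<exists>fs. map code fs = gs \<and> list_all2 (\<lambda>g y. ev g xs y) fs ys"
proof (induction rule: list_all2_induct)
  case (Cons g gs y ys)
  then obtain f fs where "code f = g" "ev f xs y" "map code fs = gs" "list_all2 (\<lambda>g y. ev g xs y) fs ys"
    by (auto simp: evc_def)
  then show ?case by (intro exI[of _ "f # fs"]) simp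
qed simp

text \<open>The rules of \<open>ev\<close> read on codes. Injectivity of \<open>code\<close>
  identifies the functions that different premises provide for the same number.\<close>

lemma evc_intros:
  "evc (prod_encode (0, 0)) xs 0"
  "evc (prod_encode (Suc 0, 0)) [x] (Suc x)"
  "i < length xs \<Longrightarrow> xs ! i = y \<Longrightarrow> evc (prod_encode (2, i)) xs y"
  "list_all2 (\<lambda>g y. evc g xs y) (list_decode gs) ys \<Longrightarrow> evc f ys z \<Longrightarrow>
    evc (prod_encode (3, prod_encode (f, gs))) xs z"
  "evc f xs y \<Longrightarrow> is_code g \<Longrightarrow> evc (prod_encode (4, prod_encode (f, g))) (0 # xs) y"
  "evc (prod_encode (4, prod_encode (f, g))) (n # xs) r \<Longrightarrow> evc g (n # r # xs) y \<Longrightarrow>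
    evc (prod_encode (4, prod_encode (f, g))) (Suc n # xs) y"
  "evc f (n # xs) 0 \<Longrightarrow> \<forall>m < n. \<exists>r. evc f (m # xs) (Suc r) \<Longrightarrow> evc (prod_encode (5, f)) xs n"
proof -
  show "evc (prod_encode (0, 0)) xs 0"
    unfolding evc_def by (intro exI[of _ Zero]) (auto intro: ev.intros)
  show "evc (prod_encode (Suc 0, 0)) [x] (Suc x)"
    unfolding evc_def by (intro exI[of _ Succ]) (auto intro: ev.intros)
  show "evc (prod_encode (2, i)) xs y" if "i < length xs" "xs ! i = y"
    unfolding evc_def using that by (intro exI[of _ "Proj i"]) (auto intro: ev.intros)
  show "evc (prod_encode (3, prod_encode (f, gs))) xs z"
    if gs: "list_all2 (\<lambda>g y. evc g xs y) (list_decode gs) ys" and f: "evc f ys z"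
  proof -
    obtain fs where fs: "map code fs = list_decode gs" "list_all2 (\<lambda>g y. ev g xs y) fs ys"
      using list_all2_evc[OF gs] by blast
    obtain f' where f': "code f' = f" "ev f' ys z" using f by (auto simp: evc_def)
    then have "ev (Comp f' fs) xs z" using fs(2) by (auto intro: ev.intros)
    then show ?thesis unfolding evc_def using f'(1) fs(1) by (intro exI[of _ "Comp f' fs"]) simp
  qed
  show "evc (prod_encode (4, prod_encode (f, g))) (0 # xs) y" if fg: "evc f xs y" "is_code g"
  proof -
    obtain f' g' where "code f' = f" "ev f' xs y" "code g' = g"
      using fg by (auto simp: evc_def is_code_def)
    then show ?thesis unfolding evc_def by (intro exI[of _ "Prec f' g'"]) (auto intro: ev.intros)
  qed
  show "evc (prod_encode (4, prod_encode (f, g))) (Suc n # xs) y"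
    if fg: "evc (prod_encode (4, prod_encode (f, g))) (n # xs) r" and g: "evc g (n # r # xs) y"
  proof -
    obtain h where h: "code h = prod_encode (4, prod_encode (f, g))" "ev h (n # xs) r"
      using fg by (auto simp: evc_def)
    then obtain f' g' where fg': "h = Prec f' g'" "code f' = f" "code g' = g"
      by (cases h) auto
    obtain g'' where "code g'' = g" "ev g'' (n # r # xs) y" using g by (auto simp: evc_def)
    then have "ev g' (n # r # xs) y" using fg'(3) code_inj[of g' g''] by simp
    then have "ev h (Suc n # xs) y" using h(2) fg'(1) by (auto intro: ev.intros)
    then show ?thesis unfolding evc_def using h(1) by blast
  qed
  show "evc (prod_encode (5, f)) xs n"
    if f: "evc f (n # xs) 0" and m: "\<forall>m < n. \<exists>r. evc f (m # xs) (Suc r)"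
  proof -
    obtain f' where f': "code f' = f" "ev f' (n # xs) 0" using f by (auto simp: evc_def)
    have "\<forall>m < n. \<exists>r. ev f' (m # xs) (Suc r)"
      using m f'(1) code_inj unfolding evc_def by metis
    then have "ev (Mu f') xs n" using f'(2) by (auto intro: ev.intros)
    then show ?thesis unfolding evc_def using f'(1) by (intro exI[of _ "Mu f'"]) simp
  qed
qed

text \<open>Facts are tagged tuples. A substitution is coded as a list of terms followed by a shift, which
  applies to the remaining variables.\<close>

abbreviation "pcons p q \<equiv> PSuc (PPair p q)"
abbreviation "pnil \<equiv> PNum 0"
abbreviation "psub p q \<equiv> PPair (PSuc p) q"
abbreviation "fact1 t a \<equiv> PPair (PNum t) a"
abbreviation "fact2 t a b \<equiv> PPair (PNum t) (PPair a b)"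
abbreviation "fact3 t a b c \<equiv> PPair (PNum t) (PPair a (PPair b c))"

abbreviation "pBot \<equiv> PPair (PNum 0) (PNum 0)"
abbreviation "pEq s t \<equiv> fact2 1 s t"
abbreviation "pRel r l \<equiv> fact2 2 r l"
abbreviation "pImp p q \<equiv> fact2 3 p q"
abbreviation "pAll p \<equiv> fact1 4 p"

abbreviation "pCode \<equiv> fact1 0"
abbreviation "pCodes \<equiv> fact1 1"
abbreviation "pEv \<equiv> fact3 2"
abbreviation "pEvs \<equiv> fact3 3"
abbreviation "pPos \<equiv> fact3 4"
abbreviation "pNth \<equiv> fact3 5"
abbreviation "pLookup \<equiv> fact3 6"
abbreviation "pLiftS \<equiv> fact2 7"
abbreviation "pSubT \<equiv> fact3 8"
abbreviation "pSubL \<equiv> fact3 9"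
abbreviation "pSubF \<equiv> fact3 10"
abbreviation "pLiftL \<equiv> fact2 11"
abbreviation "pMem \<equiv> fact2 12"
abbreviation "pSubset \<equiv> fact2 13"
abbreviation "pProves \<equiv> fact2 14"
abbreviation "pAllIn \<equiv> fact2 15"
abbreviation "pQuery \<equiv> fact2 16"
abbreviation "pValue \<equiv> fact3 17"

abbreviation "x0 \<equiv> PVar 0"
abbreviation "x1 \<equiv> PVar 1"
abbreviation "x2 \<equiv> PVar 2"
abbreviation "x3 \<equiv> PVar 3"
abbreviation "x4 \<equiv> PVar 4"
abbreviation "x5 \<equiv> PVar 5"

section \<open>The clauses of the program\<close>

definition code_clauses :: "clause list" where
  "code_clauses =
    [([], pCode (fact1 0 (PNum 0))),
     ([], pCode (fact1 1 (PNum 0))),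
     ([], pCode (fact1 2 x0)),
     ([pCode x0, pCodes x1], pCode (fact2 3 x0 x1)),
     ([pCode x0, pCode x1], pCode (fact2 4 x0 x1)),
     ([pCode x0], pCode (fact1 5 x0)),
     ([], pCodes pnil),
     ([pCode x0, pCodes x1], pCodes (pcons x0 x1))]"

text \<open>Clauses have no universal premises. The one of minimization is therefore built up
  recursively by \<open>pPos\<close>: the function has positive values at all smaller
  arguments.\<close>

definition ev_clauses :: "clause list" where
  "ev_clauses =
    [([], pEv (fact1 0 (PNum 0)) x0 (PNum 0)),
     ([], pEv (fact1 1 (PNum 0)) (pcons x0 pnil) (PSuc x0)),
     ([pNth x0 x1 x2], pEv (fact1 2 x1) x0 x2),
     ([pEvs x0 x1 x2, pEv x3 x2 x4], pEv (fact2 3 x3 x0) x1 x4),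
     ([pEv x0 x1 x2, pCode x3], pEv (fact2 4 x0 x3) (pcons (PNum 0) x1) x2),
     ([pEv (fact2 4 x0 x1) (pcons x2 x3) x4, pEv x1 (pcons x2 (pcons x4 x3)) x5],
       pEv (fact2 4 x0 x1) (pcons (PSuc x2) x3) x5),
     ([pEv x0 (pcons x1 x2) (PNum 0), pPos x0 x1 x2], pEv (fact1 5 x0) x2 x1),
     ([], pEvs pnil x0 pnil),
     ([pEv x0 x1 x2, pEvs x3 x1 x4], pEvs (pcons x0 x3) x1 (pcons x2 x4)),
     ([], pPos x0 (PNum 0) x1),
     ([pPos x0 x1 x2, pEv x0 (pcons x1 x2) (PSuc x3)], pPos x0 (PSuc x1) x2),
     ([], pNth (pcons x0 x1) (PNum 0) x0),
     ([pNth x0 x1 x2], pNth (pcons x3 x0) (PSuc x1) x2)]"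

text \<open>Looking up a variable in a pure shift needs no addition: the index is moved into the
  shift one unit at a time.\<close>

definition subst_clauses :: "clause list" where
  "subst_clauses =
    [([], pLookup (fact1 0 x0) (PNum 0) (fact1 0 x0)),
     ([pLookup (fact1 0 (PSuc x0)) x1 x2], pLookup (fact1 0 x0) (PSuc x1) x2),
     ([], pLookup (psub x0 x1) (PNum 0) x0),
     ([pLookup x0 x1 x2], pLookup (psub x3 x0) (PSuc x1) x2),
     ([], pLiftS (fact1 0 x0) (fact1 0 (PSuc x0))),
     ([pLiftS x0 x1, pSubT (fact1 0 (PNum 1)) x2 x3], pLiftS (psub x2 x0) (psub x3 x1)),
     ([pLookup x0 x1 x2], pSubT x0 (fact1 0 x1) x2),
     ([pSubL x0 x1 x2], pSubT x0 (psub x3 x1) (psub x3 x2)),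
     ([], pSubL x0 pnil pnil),
     ([pSubT x0 x1 x2, pSubL x0 x3 x4], pSubL x0 (pcons x1 x3) (pcons x2 x4)),
     ([], pSubF x0 pBot pBot),
     ([pSubT x0 x1 x2, pSubT x0 x3 x4], pSubF x0 (pEq x1 x3) (pEq x2 x4)),
     ([pSubL x0 x1 x2], pSubF x0 (pRel x3 x1) (pRel x3 x2)),
     ([pSubF x0 x1 x2, pSubF x0 x3 x4], pSubF x0 (pImp x1 x3) (pImp x2 x4)),
     ([pLiftS x0 x1, pSubF (psub (fact1 0 (PNum 0)) x1) x2 x3], pSubF x0 (pAll x2) (pAll x3))]"

text \<open>The rules of \<open>proves\<close> with lists as finite contexts. Weakening is added as
  a clause, because the premises of a rule may come with different lists and the discharged
  hypothesis has to be at the front.\<close>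

definition proof_clauses :: "clause list" where
  "proof_clauses =
    [([], pLiftL pnil pnil),
     ([pSubF (fact1 0 (PNum 1)) x0 x1, pLiftL x2 x3], pLiftL (pcons x0 x2) (pcons x1 x3)),
     ([], pMem x0 (pcons x0 x1)),
     ([pMem x0 x1], pMem x0 (pcons x2 x1)),
     ([], pSubset pnil x0),
     ([pMem x0 x1, pSubset x2 x1], pSubset (pcons x0 x2) x1),
     ([pMem x0 x1], pProves x1 x0),
     ([pProves (pcons x0 x1) x2], pProves x1 (pImp x0 x2)),
     ([pProves x0 (pImp x1 x2), pProves x0 x1], pProves x0 x2),
     ([pProves (pcons (pImp x0 pBot) x1) pBot], pProves x1 x0),
     ([pLiftL x0 x1, pProves x1 x2], pProves x0 (pAll x2)),
     ([pProves x0 (pAll x1), pSubF (psub x2 (fact1 0 (PNum 0))) x1 x3], pProves x0 x3),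
     ([], pProves x0 (pEq x1 x1)),
     ([pProves x0 (pEq x1 x2), pSubF (psub x1 (fact1 0 (PNum 0))) x3 x4, pProves x0 x4,
       pSubF (psub x2 (fact1 0 (PNum 0))) x3 x5], pProves x0 x5),
     ([pProves x0 x1, pSubset x0 x2], pProves x2 x1)]"

text \<open>In the last two clauses the argument of the queried function is a pair \<open>(c, i)\<close>, passed to it
  as the list of \<open>c\<close> and the pair, so that no unpairing function is needed.\<close>

definition query_clauses :: "clause list" where
  "query_clauses =
    [([], pAllIn x0 pnil),
     ([pEv x0 (pcons x1 pnil) x2, pAllIn x0 x3], pAllIn x0 (pcons x1 x3)),
     ([pEv x0 (pcons x1 (pcons (PPair x1 x2) pnil)) x3, pAllIn x2 x4, pProves x4 x3],
       pQuery x0 (PPair x1 x2)),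
     ([pEv x0 (pcons x1 (pcons (PPair x1 x2) pnil)) x3], pValue x0 (PPair x1 x2) x3)]"

definition prog :: "clause list" where
  "prog = code_clauses @ ev_clauses @ subst_clauses @ proof_clauses @ query_clauses"

lemma prog_bound: "prog_bound 6 prog"
  by (simp add: prog_bound_def prog_def code_clauses_def ev_clauses_def subst_clauses_def
      proof_clauses_def query_clauses_def)

section \<open>Soundness of the program\<close>

text \<open>The intended meaning of a fact, as a table indexed by its tag. It is defined through the
  decoders for all numbers, so that it can be an invariant of derivations.\<close>

definition holds :: "nat \<Rightarrow> bool" where
  "holds n \<longleftrightarrow> (case prod_decode n of (t, a) \<Rightarrow> case prod_decode a of (x, u) \<Rightarrow>
     case prod_decode u of (y, z) \<Rightarrow>
     [is_code a,
      \<forall>c \<in> set (list_decode a). is_code c,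
      evc x (list_decode y) z,
      list_all2 (\<lambda>g y'. evc g (list_decode y) y') (list_decode x) (list_decode z),
      \<forall>m < y. \<exists>r. evc x (m # list_decode z) (Suc r),
      y < length (list_decode x) \<and> list_decode x ! y = z,
      decS x y = decT z,
      decS u = (\<lambda>i. shift (decS x i)),
      tsubst (decS x) (decT y) = decT z,
      map (tsubst (decS x)) (map decT (list_decode y)) = map decT (list_decode z),
      fsubst (decS x) (decF y) = decF z,
      map decF (list_decode u) = map lift (map decF (list_decode x)),
      x \<in> set (list_decode u),
      set (list_decode x) \<subseteq> set (list_decode u),
      decF ` set (list_decode x) \<turnstile> decF u,
      set (list_decode u) \<subseteq> W x,
      case prod_decode u of (c, i) \<Rightarrow> \<exists>p l. evc x [c, u] p \<and> set (list_decode l) \<subseteq> W i \<and>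
        decF ` set (list_decode l) \<turnstile> decF p,
      case prod_decode y of (c, i) \<Rightarrow> evc x [c, y] z] ! t)"

lemma holds_simps [simp]:
  "holds (prod_encode (0, a)) = is_code a"
  "holds (prod_encode (Suc 0, a)) = (\<forall>c \<in> set (list_decode a). is_code c)"
  "holds (prod_encode (2, prod_encode (x, prod_encode (y, z)))) = evc x (list_decode y) z"
  "holds (prod_encode (3, prod_encode (x, prod_encode (y, z)))) =
    list_all2 (\<lambda>g y'. evc g (list_decode y) y') (list_decode x) (list_decode z)"
  "holds (prod_encode (4, prod_encode (x, prod_encode (y, z)))) =
    (\<forall>m < y. \<exists>r. evc x (m # list_decode z) (Suc r))"
  "holds (prod_encode (5, prod_encode (x, prod_encode (y, z)))) =
    (y < length (list_decode x) \<and> list_decode x ! y = z)"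
  "holds (prod_encode (6, prod_encode (x, prod_encode (y, z)))) = (decS x y = decT z)"
  "holds (prod_encode (7, prod_encode (x, u))) = (decS u = (\<lambda>i. shift (decS x i)))"
  "holds (prod_encode (8, prod_encode (x, prod_encode (y, z)))) = (tsubst (decS x) (decT y) = decT z)"
  "holds (prod_encode (9, prod_encode (x, prod_encode (y, z)))) =
    (map (tsubst (decS x)) (map decT (list_decode y)) = map decT (list_decode z))"
  "holds (prod_encode (10, prod_encode (x, prod_encode (y, z)))) = (fsubst (decS x) (decF y) = decF z)"
  "holds (prod_encode (11, prod_encode (x, u))) =
    (map decF (list_decode u) = map lift (map decF (list_decode x)))"
  "holds (prod_encode (12, prod_encode (x, u))) = (x \<in> set (list_decode u))"
  "holds (prod_encode (13, prod_encode (x, u))) = (set (list_decode x) \<subseteq> set (list_decode u))"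
  "holds (prod_encode (14, prod_encode (x, u))) = (decF ` set (list_decode x) \<turnstile> decF u)"
  "holds (prod_encode (15, prod_encode (x, u))) = (set (list_decode u) \<subseteq> W x)"
  "holds (prod_encode (16, prod_encode (x, prod_encode (c, i)))) =
    (\<exists>p l. evc x [c, prod_encode (c, i)] p \<and> set (list_decode l) \<subseteq> W i \<and>
        decF ` set (list_decode l) \<turnstile> decF p)"
  "holds (prod_encode (17, prod_encode (x, prod_encode (prod_encode (c, i), z)))) =
    evc x [c, prod_encode (c, i)] z"
  by (simp_all add: holds_def split: prod.split del: map_map)

definition sound :: "clause list \<Rightarrow> bool" where
  "sound Q \<longleftrightarrow> (\<forall>(b, h) \<in> set Q. \<forall>e. (\<forall>q \<in> set b. holds (pev e q)) \<longrightarrow> holds (pev e h))"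

lemma code_clauses_sound: "sound code_clauses"
  by (simp add: sound_def code_clauses_def is_code_intros)

lemma ev_clauses_sound: "sound ev_clauses"
  by (auto simp: sound_def ev_clauses_def less_Suc_eq intro: evc_intros)

lemma subst_clauses_sound: "sound subst_clauses"
  by (auto simp: sound_def subst_clauses_def up_def split: nat.split intro!: ext)

lemma proof_clauses_sound: "sound proof_clauses"
proof -
  \<comment> \<open>The rules are restated with equations, since a clause only provides that a
    number decodes to the result of a substitution.\<close>
  have inst: "\<Gamma> \<turnstile> b" if "\<Gamma> \<turnstile> All p" "fsubst (case_nat t Var) p = b" for \<Gamma> p t b
    using proves.allE[OF that(1), of t] that(2) by (simp add: inst_def)
  have leib: "\<Gamma> \<turnstile> b" if "\<Gamma> \<turnstile> Eq s t" "fsubst (case_nat s Var) p = a" "\<Gamma> \<turnstile> a"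
    "fsubst (case_nat t Var) p = b" for \<Gamma> p s t a b
    using proves.leibniz[of \<Gamma> s t p] that by (simp add: inst_def)
  have gen: "decF ` set \<Gamma> \<turnstile> All p"
    if "map decF \<Delta> = map (lift \<circ> decF) \<Gamma>" "decF ` set \<Delta> \<turnstile> p" for \<Gamma> \<Delta> p
  proof (rule proves.allI)
    have "decF ` set \<Delta> = lift ` decF ` set \<Gamma>"
      using arg_cong[OF that(1), of set] by (simp add: image_comp)
    then show "lift ` decF ` set \<Gamma> \<turnstile> p" using that(2) by simp
  qed
  have weak: "decF ` S \<turnstile> p \<Longrightarrow> S \<subseteq> T \<Longrightarrow> decF ` T \<turnstile> p" for S T p
    by (rule proves_weaken) blast+
  show ?thesis
    unfolding sound_def proof_clauses_def
    apply (simp add: lift_def)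
    apply (intro conjI HOL.allI HOL.impI; (elim conjE)?)
    subgoal by (rule proves.assm) simp
    subgoal by (rule proves.impI)
    subgoal by (rule proves.impE)
    subgoal by (rule proves.raa) (simp add: Neg_def)
    subgoal by (rule gen)
    subgoal by (rule inst)
    subgoal by (rule proves.refl)
    subgoal by (rule leib)
    subgoal by (rule weak)
    done
qed

lemma query_clauses_sound: "sound query_clauses"
  by (auto simp: sound_def query_clauses_def W_iff)

lemma sound_append: "sound (P @ Q) \<longleftrightarrow> sound P \<and> sound Q"
  by (auto simp: sound_def)

lemma prog_sound: "der prog n \<Longrightarrow> holds n"
proof (induction rule: der.induct)
  case (der b h e)
  moreover have "sound prog"
    by (simp add: prog_def sound_append code_clauses_sound ev_clauses_sound subst_clauses_sound
        proof_clauses_sound query_clauses_sound)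
  ultimately show ?case unfolding sound_def by blast
qed

section \<open>Completeness of the program\<close>

definition prv :: "nat \<Rightarrow> bool" where
  "prv n \<longleftrightarrow> der prog n"

text \<open>Clauses are addressed by their position within a group; the assignment is supplied below
  as \<open>(!)\<close> of the list of values.\<close>

lemma prv_step:
  assumes "set Q \<subseteq> set prog" "k < length Q" "\<forall>q \<in> set (fst (Q ! k)). prv (pev e q)"
  shows "prv (pev e (snd (Q ! k)))"
proof -
  have "Q ! k \<in> set prog" using assms(1) nth_mem[OF assms(2)] by blast
  then show ?thesis using assms(3) unfolding prv_def by (intro der.der[of "fst (Q ! k)"]) auto
qed

lemma prog_groups: "set code_clauses \<subseteq> set prog" "set ev_clauses \<subseteq> set prog"
  "set subst_clauses \<subseteq> set prog" "set proof_clauses \<subseteq> set prog" "set query_clauses \<subseteq> set prog"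
  by (auto simp: prog_def)

lemmas code_step = prv_step[OF prog_groups(1)]
lemmas ev_step = prv_step[OF prog_groups(2)]
lemmas subst_step = prv_step[OF prog_groups(3)]
lemmas proof_step = prv_step[OF prog_groups(4)]
lemmas query_step = prv_step[OF prog_groups(5)]

abbreviation "gfact2 t a b \<equiv> prod_encode (t, prod_encode (a, b))"
abbreviation "gfact3 t a b c \<equiv> prod_encode (t, prod_encode (a, prod_encode (b, c)))"

lemma prv_codes:
  "(\<And>f. f \<in> set fs \<Longrightarrow> prv (prod_encode (0, code f))) \<Longrightarrow>
    prv (prod_encode (1, list_encode (map code fs)))"
proof (induction fs)
  case Nil
  then show ?case using code_step[of 6] by (simp add: code_clauses_def)
next
  case (Cons f fs)
  then show ?case
    using code_step[of 7 "(!) [code f, list_encode (map code fs)]"] by (simp add: code_clauses_def)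
qed

lemma prv_code: "prv (prod_encode (0, code f))"
proof (induction f)
  case Zero
  then show ?case using code_step[of 0] by (simp add: code_clauses_def)
next
  case Succ
  then show ?case using code_step[of 1] by (simp add: code_clauses_def)
next
  case (Proj i)
  then show ?case using code_step[of 2 "(!) [i]"] by (simp add: code_clauses_def)
next
  case (Comp f fs)
  then show ?case
    using code_step[of 3 "(!) [code f, list_encode (map code fs)]"] prv_codes[of fs]
    by (simp add: code_clauses_def)
next
  case (Prec f g)
  then show ?case using code_step[of 4 "(!) [code f, code g]"] by (simp add: code_clauses_def)
next
  case (Mu f)
  then show ?case using code_step[of 5 "(!) [code f]"] by (simp add: code_clauses_def)
qed

lemma prv_nth: "i < length xs \<Longrightarrow> prv (gfact3 5 (list_encode xs) i (xs ! i))"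
proof (induction xs arbitrary: i)
  case (Cons x xs)
  show ?case
  proof (cases i)
    case 0
    then show ?thesis
      using ev_step[of 11 "(!) [x, list_encode xs]"] by (simp add: ev_clauses_def)
  next
    case (Suc j)
    then show ?thesis
      using ev_step[of 12 "(!) [list_encode xs, j, xs ! j, x]"] Cons by (simp add: ev_clauses_def)
  qed
qed simp

lemma prv_evs:
  "list_all2 (\<lambda>g y. prv (gfact3 2 (code g) (list_encode xs) y)) gs ys \<Longrightarrow>
    prv (gfact3 3 (list_encode (map code gs)) (list_encode xs) (list_encode ys))"
proof (induction rule: list_all2_induct)
  case Nil
  then show ?case using ev_step[of 7 "(!) [list_encode xs]"] by (simp add: ev_clauses_def)
next
  case (Cons g gs y ys)
  then show ?case
    using ev_step[of 8 "(!) [code g, list_encode xs, y, list_encode (map code gs), list_encode ys]"]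
    by (simp add: ev_clauses_def)
qed

lemma prv_ev: "ev f xs y \<Longrightarrow> prv (gfact3 2 (code f) (list_encode xs) y)"
proof (induction rule: ev.induct)
  case (1 xs)
  then show ?case using ev_step[of 0 "(!) [list_encode xs]"] by (simp add: ev_clauses_def)
next
  case (2 x)
  then show ?case using ev_step[of 1 "(!) [x]"] by (simp add: ev_clauses_def)
next
  case (3 i xs)
  then show ?case
    using ev_step[of 2 "(!) [list_encode xs, i, xs ! i]"] prv_nth by (simp add: ev_clauses_def)
next
  case (4 xs gs ys f z)
  then have "prv (gfact3 3 (list_encode (map code gs)) (list_encode xs) (list_encode ys))"
    by (intro prv_evs) (auto elim: list_all2_mono)
  then show ?case
    using ev_step[of 3 "(!) [list_encode (map code gs), list_encode xs, list_encode ys, code f, z]"] 4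
    by (simp add: ev_clauses_def)
next
  case (5 f xs y g)
  then show ?case
    using ev_step[of 4 "(!) [code f, list_encode xs, y, code g]"] prv_code[of g]
    by (simp add: ev_clauses_def)
next
  case (6 f g n xs r y)
  then show ?case
    using ev_step[of 5 "(!) [code f, code g, n, list_encode xs, r, y]"] by (simp add: ev_clauses_def)
next
  case (7 f n xs)
  have "prv (gfact3 4 (code f) m (list_encode xs))" if "m \<le> n" for m
    using that
  proof (induction m)
    case 0
    show ?case using ev_step[of 9 "(!) [code f, list_encode xs]"] by (simp add: ev_clauses_def)
  next
    case (Suc m)
    have "m < n" using Suc.prems by simp
    with 7 obtain r where "prv (gfact3 2 (code f) (list_encode (m # xs)) (Suc r))" by blast
    then show ?case
      using ev_step[of 10 "(!) [code f, m, list_encode xs, r]"] Suc by (simp add: ev_clauses_def)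
  qed
  then show ?case
    using ev_step[of 6 "(!) [code f, n, list_encode xs]"] 7 by (simp add: ev_clauses_def)
qed

primrec subs :: "tm list \<Rightarrow> nat \<Rightarrow> nat \<Rightarrow> tm" where
  "subs [] m = (\<lambda>i. Var (i + m))"
| "subs (t # ts) m = case_nat t (subs ts m)"

primrec encS :: "tm list \<Rightarrow> nat \<Rightarrow> nat" where
  "encS [] m = prod_encode (0, m)"
| "encS (t # ts) m = prod_encode (Suc (gnt t), encS ts m)"

lemma prv_lookup: "prv (gfact3 6 (encS ts m) i (gnt (subs ts m i)))"
proof (induction ts arbitrary: i)
  case Nil
  show ?case
  proof (induction i arbitrary: m)
    case 0
    show ?case using subst_step[of 0 "(!) [m]"] by (simp add: subst_clauses_def)
  next
    case (Suc i)
    from Suc[of "Suc m"] show ?case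
      using subst_step[of 1 "(!) [m, i, gnt (Var (i + Suc m))]"] by (simp add: subst_clauses_def)
  qed
next
  case (Cons t ts)
  show ?case
  proof (cases i)
    case 0
    then show ?thesis
      using subst_step[of 2 "(!) [gnt t, encS ts m]"] by (simp add: subst_clauses_def)
  next
    case (Suc j)
    then show ?thesis
      using subst_step[of 3 "(!) [encS ts m, j, gnt (subs ts m j), gnt t]"] Cons
      by (simp add: subst_clauses_def)
  qed
qed

lemma prv_substL:
  "(\<And>t. t \<in> set us \<Longrightarrow> prv (gfact3 8 (encS ts m) (gnt t) (gnt (tsubst (subs ts m) t)))) \<Longrightarrow>
    prv (gfact3 9 (encS ts m) (list_encode (map gnt us)) (list_encode (map (gnt \<circ> tsubst (subs ts m)) us)))"
proof (induction us)
  case Nil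
  show ?case using subst_step[of 8 "(!) [encS ts m]"] by (simp add: subst_clauses_def)
next
  case (Cons u us)
  then show ?case
    using subst_step[of 9 "(!) [encS ts m, gnt u, gnt (tsubst (subs ts m) u), list_encode (map gnt us),
      list_encode (map (gnt \<circ> tsubst (subs ts m)) us)]"]
    by (simp add: subst_clauses_def comp_def)
qed

lemma prv_substT: "prv (gfact3 8 (encS ts m) (gnt t) (gnt (tsubst (subs ts m) t)))"
proof (induction t)
  case (Var i)
  show ?case
    using subst_step[of 6 "(!) [encS ts m, i, gnt (subs ts m i)]"] prv_lookup
    by (simp add: subst_clauses_def)
next
  case (Fun f us)
  then show ?case
    using subst_step[of 7 "(!) [encS ts m, list_encode (map gnt us),
      list_encode (map (gnt \<circ> tsubst (subs ts m)) us), f]"] prv_substL[of us ts m]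
    by (simp add: subst_clauses_def)
qed

lemma prv_liftS: "prv (gfact2 7 (encS ts m) (encS (map shift ts) (Suc m)))"
proof (induction ts)
  case Nil
  show ?case using subst_step[of 4 "(!) [m]"] by (simp add: subst_clauses_def)
next
  case (Cons t ts)
  then show ?case
    using subst_step[of 5 "(!) [encS ts m, encS (map shift ts) (Suc m), gnt t, gnt (shift t)]"]
      prv_substT[of "[]" 1 t]
    by (simp add: subst_clauses_def)
qed

text \<open>Finite lists followed by a shift are closed under passing beneath a binder and include
  instantiation and lifting, so this finite representation covers all substitutions that derivations
  need.\<close>

lemma up_subs: "up (subs ts m) = subs (Var 0 # map shift ts) (Suc m)"
proof -
  have "shift (subs ts m i) = subs (map shift ts) (Suc m) i" for i
    by (induction ts arbitrary: i) (auto split: nat.split)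
  then show ?thesis by (simp add: up_def)
qed

lemma prv_substF: "prv (gfact3 10 (encS ts m) (gn p) (gn (fsubst (subs ts m) p)))"
proof (induction p arbitrary: ts m)
  case Bot
  show ?case using subst_step[of 10 "(!) [encS ts m]"] by (simp add: subst_clauses_def)
next
  case (Eq s t)
  show ?case
    using subst_step[of 11 "(!) [encS ts m, gnt s, gnt (tsubst (subs ts m) s),
      gnt t, gnt (tsubst (subs ts m) t)]"] prv_substT
    by (simp add: subst_clauses_def)
next
  case (Rel r us)
  show ?case
    using subst_step[of 12 "(!) [encS ts m, list_encode (map gnt us),
      list_encode (map (gnt \<circ> tsubst (subs ts m)) us), r]"] prv_substL[of us ts m] prv_substT
    by (simp add: subst_clauses_def)
next
  case (Imp p q)
  then show ?case
    using subst_step[of 13 "(!) [encS ts m, gn p, gn (fsubst (subs ts m) p),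
      gn q, gn (fsubst (subs ts m) q)]"]
    by (simp add: subst_clauses_def)
next
  case (All p)
  then show ?case
    using subst_step[of 14 "(!) [encS ts m, encS (map shift ts) (Suc m), gn p,
      gn (fsubst (subs (Var 0 # map shift ts) (Suc m)) p)]"] prv_liftS[of ts m]
      All[of "Var 0 # map shift ts" "Suc m"]
    by (simp add: subst_clauses_def up_subs del: subs.simps)
qed

abbreviation "gns ps \<equiv> list_encode (map gn ps)"

lemma prv_inst: "prv (gfact3 10 (prod_encode (Suc (gnt t), prod_encode (0, 0))) (gn p) (gn (inst p t)))"
  using prv_substF[of "[t]" 0 p] by (simp add: inst_def)

lemma prv_lift: "prv (gfact3 10 (prod_encode (0, 1)) (gn p) (gn (lift p)))"
  using prv_substF[of "[]" 1 p] by (simp add: lift_def)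

lemma prv_liftL: "prv (gfact2 11 (gns ps) (gns (map lift ps)))"
proof (induction ps)
  case Nil
  show ?case using proof_step[of 0] by (simp add: proof_clauses_def)
next
  case (Cons p ps)
  then show ?case
    using proof_step[of 1 "(!) [gn p, gn (lift p), gns ps, gns (map lift ps)]"] prv_lift[of p]
    by (simp add: proof_clauses_def)
qed

lemma prv_mem: "p \<in> set ps \<Longrightarrow> prv (gfact2 12 (gn p) (gns ps))"
proof (induction ps)
  case (Cons q ps)
  show ?case
  proof (cases "p = q")
    case True
    then show ?thesis using proof_step[of 2 "(!) [gn p, gns ps]"] by (simp add: proof_clauses_def)
  next
    case False
    then show ?thesis
      using proof_step[of 3 "(!) [gn p, gns ps, gn q]"] Cons by (simp add: proof_clauses_def)
  qed
qed simp

lemma prv_subset: "set ps \<subseteq> set qs \<Longrightarrow> prv (gfact2 13 (gns ps) (gns qs))"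
proof (induction ps)
  case Nil
  show ?case using proof_step[of 4 "(!) [gns qs]"] by (simp add: proof_clauses_def)
next
  case (Cons p ps)
  then show ?case
    using proof_step[of 5 "(!) [gn p, gns qs, gns ps]"] prv_mem[of p qs]
    by (simp add: proof_clauses_def)
qed

lemma prv_weaken:
  "prv (gfact2 14 (gns ps) p) \<Longrightarrow> set ps \<subseteq> set qs \<Longrightarrow> prv (gfact2 14 (gns qs) p)"
  using proof_step[of 14 "(!) [gns ps, p, gns qs]"] prv_subset[of ps qs]
  by (simp add: proof_clauses_def)

text \<open>Brings the hypothesis to be discharged to the front of the list, adding it if it did not
  occur.\<close>

lemma prv_discharge:
  assumes "set ps \<subseteq> insert p \<Gamma>" "prv (gfact2 14 (gns ps) q)"
  shows "\<exists>qs. set qs \<subseteq> \<Gamma> \<and> prv (gfact2 14 (gns (p # qs)) q)"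
  using assms prv_weaken[of ps q "p # removeAll p ps"] by (intro exI[of _ "removeAll p ps"]) auto

lemma prv_common:
  assumes "set ps \<subseteq> \<Gamma>" "prv (gfact2 14 (gns ps) p)" "set qs \<subseteq> \<Gamma>" "prv (gfact2 14 (gns qs) q)"
  shows "\<exists>rs. set rs \<subseteq> \<Gamma> \<and> prv (gfact2 14 (gns rs) p) \<and> prv (gfact2 14 (gns rs) q)"
  using assms prv_weaken[of ps p "ps @ qs"] prv_weaken[of qs q "ps @ qs"]
  by (intro exI[of _ "ps @ qs"]) auto

text \<open>A finite part of the possibly infinite context is selected along the derivation; two
  premises are brought to a common list by weakening.\<close>

lemma prv_proves: "\<Gamma> \<turnstile> p \<Longrightarrow> \<exists>ps. set ps \<subseteq> \<Gamma> \<and> prv (gfact2 14 (gns ps) (gn p))"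
proof (induction rule: proves.induct)
  case (assm p \<Gamma>)
  then show ?case
    using proof_step[of 6 "(!) [gn p, gns [p]]"] prv_mem[of p "[p]"]
    by (intro exI[of _ "[p]"]) (simp add: proof_clauses_def)
next
  case (impI p \<Gamma> q)
  from impI.IH obtain ps where "set ps \<subseteq> insert p \<Gamma>" "prv (gfact2 14 (gns ps) (gn q))"
    by (elim exE conjE)
  from prv_discharge[OF this] obtain qs where qs: "set qs \<subseteq> \<Gamma>"
    "prv (gfact2 14 (gns (p # qs)) (gn q))"
    by (elim exE conjE)
  then show ?case
    using proof_step[of 7 "(!) [gn p, gns qs, gn q]"]
    by (intro exI[of _ qs]) (simp add: proof_clauses_def)
next
  case (impE \<Gamma> p q)
  obtain ps qs where "set ps \<subseteq> \<Gamma>" "prv (gfact2 14 (gns ps) (gn (Imp p q)))"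
    "set qs \<subseteq> \<Gamma>" "prv (gfact2 14 (gns qs) (gn p))"
    using impE.IH by (elim exE conjE)
  from prv_common[OF this] obtain rs where "set rs \<subseteq> \<Gamma>" "prv (gfact2 14 (gns rs) (gn (Imp p q)))"
    "prv (gfact2 14 (gns rs) (gn p))"
    by (elim exE conjE)
  then show ?case
    using proof_step[of 8 "(!) [gns rs, gn p, gn q]"]
    by (intro exI[of _ rs]) (simp add: proof_clauses_def)
next
  case (raa p \<Gamma>)
  from raa.IH obtain ps where "set ps \<subseteq> insert (Neg p) \<Gamma>" "prv (gfact2 14 (gns ps) (gn Bot))"
    by (elim exE conjE)
  from prv_discharge[OF this] obtain qs where qs: "set qs \<subseteq> \<Gamma>"
    "prv (gfact2 14 (gns (Neg p # qs)) (gn Bot))"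
    by (elim exE conjE)
  then show ?case
    using proof_step[of 9 "(!) [gn p, gns qs]"]
    by (intro exI[of _ qs]) (simp add: proof_clauses_def Neg_def)
next
  case (allI \<Gamma> p)
  then obtain ps where ps: "set ps \<subseteq> lift ` \<Gamma>" "prv (gfact2 14 (gns ps) (gn p))" by blast
  \<comment> \<open>The list found consists of lifted formulas, so it is the image of a list over
    \<open>\<Gamma>\<close>, as the clause for \<open>All\<close> demands.\<close>
  have "ps \<in> lists (lift ` \<Gamma>)" using ps(1) by (simp add: lists_eq_set)
  then have "ps \<in> map lift ` lists \<Gamma>" by (simp only: lists_image)
  then obtain qs where "set qs \<subseteq> \<Gamma>" "ps = map lift qs" by (auto simp: lists_eq_set)
  then show ?case
    using proof_step[of 10 "(!) [gns qs, gns (map lift qs), gn p]"] prv_liftL[of qs] ps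
    by (intro exI[of _ qs]) (simp add: proof_clauses_def)
next
  case (allE \<Gamma> p t)
  then obtain qs where "set qs \<subseteq> \<Gamma>" "prv (gfact2 14 (gns qs) (gn (All p)))" by blast
  then show ?case
    using proof_step[of 11 "(!) [gns qs, gn p, gnt t, gn (inst p t)]"] prv_inst[of t p]
    by (intro exI[of _ qs]) (simp add: proof_clauses_def)
next
  case (refl \<Gamma> t)
  show ?case
    using proof_step[of 12 "(!) [0, gnt t]"]
    by (intro exI[of _ "[]"]) (simp add: proof_clauses_def)
next
  case (leibniz \<Gamma> s t p)
  obtain ps qs where "set ps \<subseteq> \<Gamma>" "prv (gfact2 14 (gns ps) (gn (Eq s t)))"
    "set qs \<subseteq> \<Gamma>" "prv (gfact2 14 (gns qs) (gn (inst p s)))"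
    using leibniz.IH by (elim exE conjE)
  from prv_common[OF this] obtain rs where "set rs \<subseteq> \<Gamma>" "prv (gfact2 14 (gns rs) (gn (Eq s t)))"
    "prv (gfact2 14 (gns rs) (gn (inst p s)))"
    by (elim exE conjE)
  then show ?case
    using proof_step[of 13 "(!) [gns rs, gnt s, gnt t, gn p, gn (inst p s), gn (inst p t)]"]
      prv_inst[of s p] prv_inst[of t p]
    by (intro exI[of _ rs]) (simp add: proof_clauses_def)
qed

lemma prv_all_in: "set xs \<subseteq> W i \<Longrightarrow> prv (gfact2 15 i (list_encode xs))"
proof (induction xs)
  case Nil
  show ?case using query_step[of 0 "(!) [i]"] by (simp add: query_clauses_def)
next
  case (Cons x xs)
  then obtain f y where "code f = i" "ev f [x] y" by (auto simp: W_def)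
  then have "prv (gfact3 2 i (list_encode [x]) y)" using prv_ev by blast
  then show ?case
    using query_step[of 1 "(!) [i, x, y, list_encode xs]"] Cons by (simp add: query_clauses_def)
qed

lemma der_value_iff:
  "der prog (gfact3 17 (code h) (prod_encode (c, i)) z) \<longleftrightarrow> ev h [c, prod_encode (c, i)] z"
proof
  assume "der prog (gfact3 17 (code h) (prod_encode (c, i)) z)"
  from prog_sound[OF this] show "ev h [c, prod_encode (c, i)] z"
    by (auto simp: evc_def dest: code_inj)
next
  assume "ev h [c, prod_encode (c, i)] z"
  from prv_ev[OF this] show "der prog (gfact3 17 (code h) (prod_encode (c, i)) z)"
    using query_step[of 3 "(!) [code h, c, i, z]"] by (simp add: query_clauses_def prv_def)
qed

text \<open>The index is a mere number in the query, so one fact schema covers all theories. That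
  \<open>h\<close> has only this value identifies the derived formula as \<open>p\<close>, and
  \<open>T\<close> is recovered from \<open>W i\<close> by decoding.\<close>

lemma der_query_iff:
  assumes h: "\<And>y. ev h [c, prod_encode (c, i)] y \<longleftrightarrow> y = gn p" and T: "W i = gn ` T"
  shows "der prog (gfact2 16 (code h) (prod_encode (c, i))) \<longleftrightarrow> T \<turnstile> p"
proof
  assume "der prog (gfact2 16 (code h) (prod_encode (c, i)))"
  then have "holds (gfact2 16 (code h) (prod_encode (c, i)))" by (rule prog_sound)
  then obtain q l where q: "evc (code h) [c, prod_encode (c, i)] q"
    and l: "set (list_decode l) \<subseteq> W i" "decF ` set (list_decode l) \<turnstile> decF q"
    unfolding holds_simps by blast
  obtain h' where "code h' = code h" "ev h' [c, prod_encode (c, i)] q"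
    using q unfolding evc_def by blast
  then have "q = gn p" using h code_inj by metis
  moreover have "decF ` set (list_decode l) \<subseteq> T" using l(1) unfolding T by fastforce
  ultimately show "T \<turnstile> p" using proves_weaken[OF l(2)] by simp
next
  assume "T \<turnstile> p"
  then obtain ps where ps: "set ps \<subseteq> T" "prv (gfact2 14 (gns ps) (gn p))"
    using prv_proves by blast
  have "prv (gfact2 15 i (gns ps))"
    using ps(1) T by (intro prv_all_in) auto
  moreover have "prv (gfact3 2 (code h) (list_encode [c, prod_encode (c, i)]) (gn p))"
    using h by (intro prv_ev) simp
  ultimately show "der prog (gfact2 16 (code h) (prod_encode (c, i)))"
    using query_step[of 2 "(!) [code h, c, i, gn p, gns ps]"] ps(2)
    by (simp add: query_clauses_def prv_def)
qed

section \<open>Computability of the diagonal sentences\<close>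

inductive_cases ev_elims: "ev Zero xs y" "ev Succ xs y" "ev (Proj i) xs y" "ev (Comp f gs) xs y"
  "ev (Prec f g) (0 # xs) y" "ev (Prec f g) (Suc n # xs) y" "ev (Mu f) xs y"

lemma ev_det: "ev f xs y \<Longrightarrow> ev f xs z \<Longrightarrow> y = z"
proof (induction arbitrary: z rule: ev.induct)
  case (4 xs gs ys f y)
  from "4.prems" obtain ys' where ys': "list_all2 (\<lambda>g y. ev g xs y) gs ys'" "ev f ys' z"
    by (rule ev_elims)
  have "ys = ys'"
    using "4.IH"(1) ys'(1) by (auto simp: list_all2_conv_all_nth intro: nth_equalityI)
  then show ?case using "4.IH"(2) ys'(2) by simp
next
  case (5 f xs y g)
  from "5.prems" have "ev f xs z" by (rule ev_elims)
  then show ?case by (rule "5.IH")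
next
  case (6 f g n xs r y)
  from "6.prems" obtain r' where "ev (Prec f g) (n # xs) r'" "ev g (n # r' # xs) z"
    by (rule ev_elims)
  then show ?case using "6.IH" by blast
next
  case (7 f n xs)
  from "7.prems" have z: "ev f (z # xs) 0" "\<forall>m < z. \<exists>r. ev f (m # xs) (Suc r)"
    by (blast elim: ev_elims)+
  have "\<not> z < n" using 7 z(1) by force
  moreover have "\<not> n < z" using 7 z(2) by force
  ultimately show ?case by simp
qed (auto elim: ev_elims)

section \<open>Closure properties of computable functions\<close>

definition computable :: "nat \<Rightarrow> (nat list \<Rightarrow> nat) \<Rightarrow> bool" where
  "computable k F \<longleftrightarrow> (\<exists>f. \<forall>xs. length xs = k \<longrightarrow> ev f xs (F xs))"

lemma computable_nth: "i < k \<Longrightarrow> computable k (\<lambda>xs. xs ! i)"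
  unfolding computable_def by (intro exI[of _ "Proj i"]) (auto intro: ev.intros)

lemma computable_comp1:
  assumes "computable 1 G" "computable k F"
  shows "computable k (\<lambda>xs. G [F xs])"
proof -
  obtain g f where "\<And>xs. length xs = 1 \<Longrightarrow> ev g xs (G xs)" "\<And>xs. length xs = k \<Longrightarrow> ev f xs (F xs)"
    using assms by (auto simp: computable_def)
  then have "ev (Comp g [f]) xs (G [F xs])" if "length xs = k" for xs
    using that by (intro ev.intros(4)[of xs "[f]" "[F xs]"]) auto
  then show ?thesis by (auto simp: computable_def)
qed

lemma computable_comp2:
  assumes "computable 2 G" "computable k E" "computable k F"
  shows "computable k (\<lambda>xs. G [E xs, F xs])"
proof -
  obtain g e f where "\<And>xs. length xs = 2 \<Longrightarrow> ev g xs (G xs)" "\<And>xs. length xs = k \<Longrightarrow> ev e xs (E xs)"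
    "\<And>xs. length xs = k \<Longrightarrow> ev f xs (F xs)"
    using assms by (auto simp: computable_def)
  then have "ev (Comp g [e, f]) xs (G [E xs, F xs])" if "length xs = k" for xs
    using that by (intro ev.intros(4)[of xs "[e, f]" "[E xs, F xs]"]) auto
  then show ?thesis by (auto simp: computable_def)
qed

lemma computable_Suc:
  assumes "computable k F"
  shows "computable k (\<lambda>xs. Suc (F xs))"
proof -
  have "computable 1 (\<lambda>xs. Suc (xs ! 0))"
    unfolding computable_def
    by (intro exI[of _ Succ]) (auto simp: length_Suc_conv intro: ev.intros)
  from computable_comp1[OF this assms] show ?thesis by simp
qed

lemma computable_const: "computable k (\<lambda>xs. n)"
proof (induction n)
  case 0
  show ?case unfolding computable_def by (intro exI[of _ Zero]) (auto intro: ev.intros)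
qed (rule computable_Suc)

lemma computable_prec:
  assumes "computable k F" "computable (Suc (Suc k)) G"
    and "\<And>xs. length xs = k \<Longrightarrow> H (0 # xs) = F xs"
    and "\<And>n xs. length xs = k \<Longrightarrow> H (Suc n # xs) = G (n # H (n # xs) # xs)"
  shows "computable (Suc k) H"
proof -
  obtain f g where fg: "\<And>xs. length xs = k \<Longrightarrow> ev f xs (F xs)"
    "\<And>xs. length xs = Suc (Suc k) \<Longrightarrow> ev g xs (G xs)"
    using assms(1,2) by (auto simp: computable_def)
  have "ev (Prec f g) (n # xs) (H (n # xs))" if "length xs = k" for n xs
  proof (induction n)
    case 0
    show ?case using that fg(1) assms(3) by (auto intro: ev.intros)
  next
    case (Suc n)
    have "ev g (n # H (n # xs) # xs) (H (Suc n # xs))"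
      using that fg(2)[of "n # H (n # xs) # xs"] assms(4) by simp
    with Suc show ?case by (rule ev.intros)
  qed
  then show ?thesis
    unfolding computable_def by (intro exI[of _ "Prec f g"]) (auto simp: length_Suc_conv)
qed

lemma computable_rec:
  assumes "computable 2 G" "\<And>n. h (Suc n) = G [n, h n]"
  shows "computable 1 (\<lambda>xs. h (xs ! 0))"
  using computable_prec[of 0 "\<lambda>_. h 0" G "\<lambda>xs. h (xs ! 0)"] computable_const assms
  by (simp add: numeral_2_eq_2)

lemma computable_add:
  assumes "computable k F" "computable k G"
  shows "computable k (\<lambda>xs. F xs + G xs)"
proof -
  have "computable (Suc 1) (\<lambda>xs. xs ! 0 + xs ! 1)"
    by (rule computable_prec[of 1 "\<lambda>xs. xs ! 0" "\<lambda>xs. Suc (xs ! 1)"])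
      (auto intro: computable_nth computable_Suc)
  then have "computable 2 (\<lambda>xs. xs ! 0 + xs ! 1)" by (simp add: numeral_2_eq_2)
  from computable_comp2[OF this assms] show ?thesis by simp
qed

text \<open>Triangular numbers are computed by recursion, which avoids the division.\<close>

lemma computable_prod_encode:
  assumes "computable k F" "computable k G"
  shows "computable k (\<lambda>xs. prod_encode (F xs, G xs))"
proof -
  have "computable 1 (\<lambda>xs. triangle (xs ! 0))"
    by (rule computable_rec[of "\<lambda>xs. xs ! 1 + Suc (xs ! 0)"])
      (auto intro!: computable_add computable_Suc computable_nth)
  from computable_comp1[OF this computable_add[OF assms]]
  have "computable k (\<lambda>xs. triangle (F xs + G xs))" by simp
  from computable_add[OF this assms(1)] show ?thesis by (simp add: prod_encode_def)
qed

section \<open>Goedel numbers of sentences about numerals\<close>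

lemma unravel_1: "unravel N d [v] p =
    Ex (And (And (And (fsubst (\<lambda>_. Var 0) (dom N)) (v (Suc d) 0)) (Neg Bot)) p)"
  by (simp add: unravel_def Exs_def Conj_def)

lemma unravel_2: "unravel N d [v, w] p =
    Ex (Ex (And (And (And (fsubst (\<lambda>_. Var 0) (dom N)) (v (Suc (Suc d)) 0))
      (And (And (fsubst (\<lambda>_. Var 1) (dom N)) (w (Suc (Suc d)) 1)) (Neg Bot))) p))"
  by (simp add: unravel_def Exs_def Conj_def upt_rec numeral_2_eq_2)

lemma val_num_Suc: "val N (num_tm (Suc n)) d y =
    unravel N d [val N (num_tm n)] (fsubst (\<lambda>j. if j < 1 then Var j else Var (y + 1)) (funf N 1 1))"
  by (simp add: num_tm_def suc_tm_def cong: if_cong)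

text \<open>Numerals are closed, so the offset for their variables has no effect. Otherwise each
  recursion step for the translated numeral would work with a new offset.\<close>

lemma val_num_shift: "val N (num_tm n) d y = val N (num_tm n) 0 y"
proof (induction n arbitrary: d y)
  case 0
  show ?case by (simp add: num_tm_def zero_tm_def unravel_def)
next
  case (Suc n)
  show ?case by (simp only: val_num_Suc unravel_1 Suc[of "Suc d"] Suc[of "Suc 0"])
qed

definition gNeg :: "nat \<Rightarrow> nat" where
  "gNeg a = prod_encode (3, prod_encode (a, prod_encode (0, 0)))"
definition gAnd :: "nat \<Rightarrow> nat \<Rightarrow> nat" where
  "gAnd a b = gNeg (prod_encode (3, prod_encode (a, gNeg b)))"
definition gEx :: "nat \<Rightarrow> nat" where
  "gEx a = gNeg (prod_encode (4, gNeg a))"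

lemma gn_simps:
  "gn (Neg p) = gNeg (gn p)" "gn (And p q) = gAnd (gn p) (gn q)" "gn (Ex p) = gEx (gn p)"
  by (simp_all add: Neg_def And_def Ex_def gNeg_def gAnd_def gEx_def)

lemma computable_gNeg: "computable k F \<Longrightarrow> computable k (\<lambda>xs. gNeg (F xs))"
  unfolding gNeg_def by (intro computable_prod_encode computable_const)

lemma computable_gAnd:
  "computable k F \<Longrightarrow> computable k G \<Longrightarrow> computable k (\<lambda>xs. gAnd (F xs) (G xs))"
  unfolding gAnd_def by (intro computable_gNeg computable_prod_encode computable_const)

lemma computable_gEx: "computable k F \<Longrightarrow> computable k (\<lambda>xs. gEx (F xs))"
  unfolding gEx_def by (intro computable_gNeg computable_prod_encode computable_const)

lemmas computable_intros = computable_const computable_gNeg computable_gAnd computable_gEx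

text \<open>The argument of a translated successor has its value in variable 0. So the recursion
  runs for \<open>y = 0\<close>, and any other \<open>y\<close> takes one more step from
  there.\<close>

lemma computable_val_num:
  assumes "computable k F"
  shows "computable k (\<lambda>xs. gn (val N (num_tm (F xs)) d y))"
proof -
  define v where "v y n = gn (val N (num_tm n) 0 y)" for y n
  define step where "step y a = gEx (gAnd (gAnd (gAnd (gn (fsubst (\<lambda>_. Var 0) (dom N))) a) (gn (Neg Bot)))
    (gn (fsubst (\<lambda>j. if j < 1 then Var j else Var (y + 1)) (funf N 1 1))))" for y a
  have v_Suc: "v y (Suc n) = step y (v 0 n)" for y n
    by (simp only: v_def val_num_Suc unravel_1 gn_simps(2,3) step_def val_num_shift[of _ _ "Suc 0"])
  have step: "computable k (\<lambda>xs. step y (F xs))" if "computable k F" for k y F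
    unfolding step_def by (intro computable_intros that)
  have "computable 1 (\<lambda>xs. v 0 (xs ! 0))"
    by (rule computable_rec[OF step[of _ "\<lambda>xs. xs ! 1" 0]]) (auto intro: computable_nth simp: v_Suc)
  from computable_comp1[OF this] have v0: "computable k (\<lambda>xs. v 0 (F xs))" if "computable k F" for k F
    using that by simp
  have "computable 1 (\<lambda>xs. v y (xs ! 0))"
    by (rule computable_rec[OF step[OF v0[of _ "\<lambda>xs. xs ! 0"], of _ y]])
      (auto intro: computable_nth simp: v_Suc)
  from computable_comp1[OF this assms] show ?thesis by (simp add: v_def val_num_shift[of N _ d])
qed

text \<open>Generalizes \<open>at_gn\<close> to numbers such as the pair of
  \<open>gn \<beta>\<close> and an index, so that \<open>\<sigma>\<close> and
  \<open>\<xi>(\<sigma>)\<close> have the same form and one computable function yields both.\<close>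

definition at_num :: "interp \<Rightarrow> nat \<Rightarrow> fm \<Rightarrow> fm" where
  "at_num N n p = Ex (And (dom N) (And (transl N (Eq (Var 0) (num_tm n))) p))"

definition at_code :: "interp \<Rightarrow> nat \<Rightarrow> nat \<Rightarrow> nat" where
  "at_code N c n = gEx (gAnd (gn (dom N)) (gAnd (gn (transl N (Eq (Var 0) (num_tm n)))) c))"

lemma gn_at_num: "gn (at_num N n p) = at_code N (gn p) n"
  by (simp only: at_num_def at_code_def gn_simps)

lemma computable_at_code:
  assumes "computable k C" "computable k F"
  shows "computable k (\<lambda>xs. at_code N (C xs) (F xs))"
  unfolding at_code_def transl.simps unravel_2 gn_simps
  by (intro computable_intros computable_val_num assms)

lemma computable_code:
  assumes "computable k F"
  obtains f where "\<And>xs y. length xs = k \<Longrightarrow> ev f xs y \<longleftrightarrow> y = F xs"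
  using assms ev_det unfolding computable_def by metis

section \<open>The diagonal argument\<close>

lemma wff_Exs [simp]: "wff L k (Exs n p) \<longleftrightarrow> wff L (n + k) p"
  by (induction n arbitrary: k) (auto simp: Exs_def)

lemma wff_Conj: "wff L k (Conj ps) \<longleftrightarrow> (\<forall>p \<in> set ps. wff L k p)"
  by (induction ps) (auto simp: Conj_def)

lemma wff_unravel:
  assumes N: "wff L 1 (dom N)" and p: "wff L (length vs + k) p"
    and vs: "\<And>v i. v \<in> set vs \<Longrightarrow> i < length vs \<Longrightarrow> wff L (length vs + k) (v (d + length vs) i)"
  shows "wff L k (unravel N d vs p)"
proof -
  have "wff L (length vs + k) (fsubst (\<lambda>_. Var i) (dom N))" if "i < length vs" for i
    by (rule wff_fsubst[OF N]) (use that in auto)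
  then show ?thesis
    using p vs by (auto simp: unravel_def Let_def wff_Conj in_set_zip)
qed

lemma wff_val:
  assumes N: "wf_interp LV L N"
  shows "wft LV k t \<Longrightarrow> k + d \<le> m \<Longrightarrow> y < m \<Longrightarrow> wff L m (val N t d y)"
proof (induction t arbitrary: d y m)
  case (Var i)
  have "wff L 2 (eqf N)" using N by (simp add: wf_interp_def)
  then show ?case
    using Var by (auto intro!: wff_fsubst[of L 2] simp: numeral_2_eq_2 less_Suc_eq split: nat.split)
next
  case (Fun f ts)
  have f: "wff L (Suc (length ts)) (funf N f (length ts))"
    using N Fun.prems by (auto simp: wf_interp_def)
  show ?case
    unfolding val.simps
  proof (rule wff_unravel)
    show "wff L 1 (dom N)" using N by (simp add: wf_interp_def)
    show "wff L (length (map (val N) ts) + m)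
      (fsubst (\<lambda>j. if j < length ts then Var j else Var (y + length ts)) (funf N f (length ts)))"
      by (rule wff_fsubst[OF f]) (use Fun.prems in auto)
    fix v i assume "v \<in> set (map (val N) ts)" "i < length (map (val N) ts)"
    then show "wff L (length (map (val N) ts) + m) (v (d + length (map (val N) ts)) i)"
      using Fun.prems by (auto intro!: Fun.IH)
  qed
qed

lemma wff_transl:
  assumes N: "wf_interp LV L N"
  shows "wff LV k p \<Longrightarrow> wff L k (transl N p)"
proof (induction p arbitrary: k)
  case (Eq s t)
  have "wff L (2 + k) (eqf N)" using N by (auto simp: wf_interp_def intro: wff_mono)
  then show ?case
    using Eq N by (auto simp: wf_interp_def intro!: wff_unravel wff_val[OF N, of k])
next
  case (Rel r ts)
  have "wff L (length ts) (relf N r (length ts))" using N Rel by (auto simp: wf_interp_def)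
  then show ?case
    using Rel N by (auto simp: wf_interp_def intro!: wff_unravel wff_val[OF N, of k] intro: wff_mono)
next
  case (All p)
  have "wff L (Suc k) (dom N)" using N by (auto simp: wf_interp_def intro: wff_mono)
  then show ?case using All by simp
qed auto

lemma wff_at_num:
  assumes "wf_interp sigA L N" "wff L 1 p"
  shows "wff L 0 (at_num N n p)"
proof -
  have "wff L 1 (transl N (Eq (Var 0) (num_tm n)))"
    using assms(1) by (rule wff_transl) simp
  then show ?thesis using assms by (simp add: at_num_def wf_interp_def)
qed

lemma at_gn_eq: "at_gn N \<xi> p = at_num N (gn p) \<xi>"
  by (simp add: at_gn_def at_num_def)

lemma transl_Neg: "transl N (Neg p) = Neg (transl N p)"
  by (simp add: Neg_def)

section \<open>The diagonal sentence in models of \<open>U\<close>\<close>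

text \<open>The numeral is fixed by an equation and not substituted, because its translation is a
  formula about an element of the domain and not a term.\<close>

definition decides :: "nat \<Rightarrow> bool \<Rightarrow> fm \<Rightarrow> bool" where
  "decides n b p \<longleftrightarrow> R \<turnstile> All (Imp (Eq (Var 0) (num_tm n)) (if b then p else Neg p))"

definition represents :: "nat \<Rightarrow> nat \<Rightarrow> fm \<Rightarrow> bool" where
  "represents n m p \<longleftrightarrow> R \<turnstile> All (Imp (Eq (Var 0) (num_tm n))
     (All (And (Imp p (Eq (Var 0) (num_tm m))) (Imp (Eq (Var 0) (num_tm m)) p))))"

text \<open>Says \<open>p\<close> of the value that the graph \<open>D\<close> assigns to the outer
  variable. The function has no term in the language of \<open>U\<close>, so its value is
  quantified.\<close>

definition at_value :: "interp \<Rightarrow> fm \<Rightarrow> fm \<Rightarrow> fm" where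
  "at_value N D p = Ex (And (dom N) (And (transl N D) p))"

text \<open>Variable 0 stands for the pair of \<open>gn \<beta>\<close> and the index;
  \<open>D\<close> computes the number of \<open>\<sigma>\<close> from it, and \<open>A\<close>,
  \<open>B\<close> are the two Rosser comparisons.\<close>

definition diag_body :: "interp \<Rightarrow> fm \<Rightarrow> fm \<Rightarrow> fm \<Rightarrow> fm \<Rightarrow> fm" where
  "diag_body N \<xi> D A B =
    And (Imp (transl N A) (at_value N D \<xi>)) (Imp (transl N B) (Neg (at_value N D \<xi>)))"

lemma wff_diag_body:
  assumes N: "wf_interp sigA L N" and "wff L 1 \<xi>" "wff sigA 2 D" "wff sigA 1 A" "wff sigA 1 B"
  shows "wff L 1 (diag_body N \<xi> D A B)"
proof -
  have "wff L 2 (dom N)" "wff L 2 \<xi>"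
    using N assms(2) by (auto simp: wf_interp_def intro: wff_mono)
  moreover have "wff L 2 (transl N D)" "wff L 1 (transl N A)" "wff L 1 (transl N B)"
    using wff_transl[OF N] assms by blast+
  ultimately show ?thesis
    by (simp add: diag_body_def at_value_def numeral_2_eq_2)
qed

text \<open>The inner structure defined by \<open>N\<close> is never formed; the translated theorems
  of R are evaluated in \<open>M\<close> itself.\<close>

locale interp_model =
  fixes L :: sig and U :: "fm set" and N :: interp and M :: "'a str" and e :: "nat \<Rightarrow> 'a"
  assumes interp: "interpretation_of sigA R L U N" and model: "\<And>q. U \<turnstile> q \<Longrightarrow> sat M e q"
begin

text \<open>A relation, because equality is interpreted by a formula and a numeral may have several
  values.\<close>

definition numeral_at :: "nat \<Rightarrow> 'a \<Rightarrow> bool" where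
  "numeral_at n a \<longleftrightarrow> a \<in> dm M \<and> sat M (case_nat a e) (dom N) \<and>
     sat M (case_nat a e) (transl N (Eq (Var 0) (num_tm n)))"

lemma wf: "wf_interp sigA L N"
  using interp by (simp add: interpretation_of_def)

lemma sat_transl: "R \<turnstile> p \<Longrightarrow> wff sigA 0 p \<Longrightarrow> sat M e (transl N p)"
  using interp model by (simp add: interpretation_of_def Sent_def)

lemma sat_at_num: "sat M e (at_num N n p) \<longleftrightarrow> (\<exists>a. numeral_at n a \<and> sat M (case_nat a e) p)"
  by (auto simp: at_num_def numeral_at_def simp del: transl.simps(2))

lemma ex_numeral_at: "\<exists>a. numeral_at n a"
proof -
  have "sat M e (transl N (Ex (Eq (Var 0) (num_tm n))))"
    by (rule sat_transl[OF R_ex_num]) simp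
  then show ?thesis by (auto simp: Ex_def transl_Neg numeral_at_def simp del: transl.simps(2))
qed

lemma sat_decides:
  assumes "decides n b p" "wff sigA 1 p" "numeral_at n a"
  shows "sat M (case_nat a e) (transl N p) \<longleftrightarrow> b"
proof -
  have "sat M e (transl N (All (Imp (Eq (Var 0) (num_tm n)) (if b then p else Neg p))))"
    by (rule sat_transl) (use assms in \<open>auto simp: decides_def\<close>)
  then show ?thesis
    using assms(3) by (cases b) (auto simp: transl_Neg numeral_at_def simp del: transl.simps(2))
qed

text \<open>On the domain of \<open>N\<close>, the translation of \<open>D\<close> at any value of
  the numeral \<open>n\<close> is equivalent to being a value of the numeral
  \<open>m\<close>.\<close>

lemma sat_at_value:
  assumes D: "represents n m D" "wff sigA 2 D" and p: "wff L 1 p" and a: "numeral_at n a"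
  shows "sat M (case_nat a e) (at_value N D p) \<longleftrightarrow> sat M e (at_num N m p)"
proof -
  have drop: "sat M (case_nat z (case_nat a e)) q \<longleftrightarrow> sat M (case_nat z e) q" if "wff L 1 q" for z q
    by (rule sat_cong[OF that]) simp
  have dom: "wff L 1 (dom N)" using wf by (simp add: wf_interp_def)
  have num: "wff L 1 (transl N (Eq (Var 0) (num_tm m)))" by (rule wff_transl[OF wf]) simp
  have "sat M e (transl N (All (Imp (Eq (Var 0) (num_tm n))
      (All (And (Imp D (Eq (Var 0) (num_tm m))) (Imp (Eq (Var 0) (num_tm m)) D))))))"
    by (rule sat_transl) (use D in \<open>auto simp: represents_def numeral_2_eq_2\<close>)
  then have "\<forall>z \<in> dm M. sat M (case_nat z (case_nat a e)) (dom N) \<longrightarrow>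
      (sat M (case_nat z (case_nat a e)) (transl N D) \<longleftrightarrow>
       sat M (case_nat z (case_nat a e)) (transl N (Eq (Var 0) (num_tm m))))"
    using a by (auto simp: And_def transl_Neg numeral_at_def simp del: transl.simps(2))
  then show ?thesis
    by (auto simp: sat_at_num numeral_at_def at_value_def drop[OF dom] drop[OF num] drop[OF p]
        simp del: transl.simps(2))
qed

lemma sat_diag:
  assumes "represents n m D" "wff sigA 2 D" "wff L 1 \<xi>"
  shows "sat M e (at_num N n (diag_body N \<xi> D A B)) \<longleftrightarrow> (\<exists>a. numeral_at n a \<and>
    (sat M (case_nat a e) (transl N A) \<longrightarrow> sat M e (at_num N m \<xi>)) \<and>
    (sat M (case_nat a e) (transl N B) \<longrightarrow> \<not> sat M e (at_num N m \<xi>)))"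
  unfolding sat_at_num[of n] using sat_at_value[OF assms] by (auto simp: diag_body_def)

end

section \<open>Consequences of the diagonal sentence in \<open>U\<close>\<close>

context
  fixes L U N \<xi> D A B n m \<sigma> \<tau>
  assumes U: "U \<subseteq> Sent L" and N: "interpretation_of sigA R L U N" and \<xi>: "wff L 1 \<xi>"
    and D: "represents n m D" "wff sigA 2 D" and AB: "wff sigA 1 A" "wff sigA 1 B"
  defines "\<sigma> \<equiv> at_num N n (diag_body N \<xi> D A B)" and "\<tau> \<equiv> at_num N m \<xi>"
begin

lemma wf_diag: "wff L 0 \<sigma>" "wff L 0 \<tau>"
proof -
  have "wf_interp sigA L N" using N by (simp add: interpretation_of_def)
  then show "wff L 0 \<sigma>" "wff L 0 \<tau>"
    unfolding \<sigma>_def \<tau>_def using \<xi> D(2) AB by (simp_all only: wff_at_num wff_diag_body)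
qed

lemma proves_diag:
  assumes "wff L 0 p" "\<And>(M :: tm set str) e. interp_model L U N M e \<Longrightarrow> sat M e p"
  shows "U \<turnstile> p"
  by (rule completeness[of U L]) (use U N assms in \<open>auto simp: Sent_def interp_model_def\<close>)

lemma diag_first:
  assumes "decides n True A"
  shows "U \<turnstile> Imp \<sigma> \<tau>"
proof (rule proves_diag)
  fix M :: "tm set str" and e assume M: "interp_model L U N M e"
  show "sat M e (Imp \<sigma> \<tau>)"
    using interp_model.sat_decides[OF M assms AB(1)]
    by (auto simp: \<sigma>_def \<tau>_def interp_model.sat_diag[OF M D \<xi>])
qed (use wf_diag in simp)

lemma diag_second:
  assumes "decides n True B"
  shows "U \<turnstile> Imp \<sigma> (Neg \<tau>)"
proof (rule proves_diag)
  fix M :: "tm set str" and e assume M: "interp_model L U N M e"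
  show "sat M e (Imp \<sigma> (Neg \<tau>))"
    using interp_model.sat_decides[OF M assms AB(2)]
    by (auto simp: \<sigma>_def \<tau>_def interp_model.sat_diag[OF M D \<xi>])
qed (use wf_diag in simp)

text \<open>A comparison decided negatively makes its conjunct of \<open>\<sigma>\<close> vacuous,
  which is expressed by the trivial premise \<open>Neg Bot\<close>; this treats four cases at
  once.\<close>

lemma diag_decided:
  assumes "decides n a A" "decides n b B"
  shows "U \<turnstile> Imp (if a then \<tau> else Neg Bot) (Imp (if b then Neg \<tau> else Neg Bot) \<sigma>)"
proof (rule proves_diag)
  fix M :: "tm set str" and e assume M: "interp_model L U N M e"
  \<comment> \<open>\<open>\<sigma>\<close> is existential, so its truth needs an actual value of
    the numeral \<open>n\<close>.\<close>
  obtain y where y: "interp_model.numeral_at N M e n y" using interp_model.ex_numeral_at[OF M] by blast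
  show "sat M e (Imp (if a then \<tau> else Neg Bot) (Imp (if b then Neg \<tau> else Neg Bot) \<sigma>))"
    using y interp_model.sat_decides[OF M assms(1) AB(1) y] interp_model.sat_decides[OF M assms(2) AB(2) y]
    by (auto simp: \<sigma>_def \<tau>_def interp_model.sat_diag[OF M D \<xi>])
qed (use wf_diag in simp)

end

lemma proves_extension:
  assumes "extends L T U" "U \<turnstile> p"
  shows "T \<turnstile> p"
  using assms(1) by (intro proves_cut[OF assms(2)]) (auto simp: extends_def)

section \<open>Provability and evaluation as bounded relations\<close>

text \<open>For \<open>x = prod_encode (c, i)\<close> the number \<open>d\<close> bounds a coded
  derivation, from \<open>W i\<close>, of the formula whose number \<open>h\<close> computes from
  \<open>c\<close> and \<open>x\<close>. The constant 6 is the number of pattern variables in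
  \<open>prog\<close>.\<close>

definition query :: "recf \<Rightarrow> nat \<Rightarrow> nat \<Rightarrow> bool" where
  "query h d x \<longleftrightarrow> accepts prog 6 d (prod_encode (16, prod_encode (code h, x)))"

lemma def0_query: "def0 2 (\<lambda>v. query h (v 0) (v 1))"
proof -
  have "def0 2 (\<lambda>v. \<exists>f \<le> v 0. pev v (fact2 16 (PNum (code h)) (PVar 1)) = f \<and> accepts prog 6 (v 0) f)"
    using def0_pev[of 2 "fact2 16 (PNum (code h)) (PVar 1)" 1 3 0]
    by (intro def0_bex def0_conj def0_accepts prog_bound) (auto simp: eval_nat_numeral)
  moreover have "query h (v 0) (v 1) \<longleftrightarrow>
      (\<exists>f \<le> v 0. pev v (fact2 16 (PNum (code h)) (PVar 1)) = f \<and> accepts prog 6 (v 0) f)" for v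
    using accepts_sound(2) by (auto simp: query_def)
  ultimately show ?thesis by simp
qed

definition computes :: "recf \<Rightarrow> nat \<Rightarrow> nat \<Rightarrow> nat \<Rightarrow> bool" where
  "computes h d z x \<longleftrightarrow> accepts prog 6 d (prod_encode (17, prod_encode (code h, prod_encode (x, z))))"

lemma def0_computes: "def0 3 (\<lambda>v. computes h (v 0) (v 1) (v 2))"
proof -
  have "def0 3 (\<lambda>v. \<exists>f \<le> v 0. pev v (fact3 17 (PNum (code h)) (PVar 2) (PVar 1)) = f \<and> accepts prog 6 (v 0) f)"
    using def0_pev[of 3 "fact3 17 (PNum (code h)) (PVar 2) (PVar 1)" 1 4 0]
    by (intro def0_bex def0_conj def0_accepts prog_bound) (auto simp: eval_nat_numeral)
  moreover have "computes h (v 0) (v 1) (v 2) \<longleftrightarrow>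
      (\<exists>f \<le> v 0. pev v (fact3 17 (PNum (code h)) (PVar 2) (PVar 1)) = f \<and> accepts prog 6 (v 0) f)" for v
    using accepts_sound(2) by (auto simp: computes_def)
  ultimately show ?thesis by simp
qed

lemma ex_query_iff:
  assumes "\<And>y. ev h [c, prod_encode (c, i)] y \<longleftrightarrow> y = gn p" "W i = gn ` T"
  shows "(\<exists>d. query h d (prod_encode (c, i))) \<longleftrightarrow> T \<turnstile> p"
  unfolding query_def der_iff_accepts[symmetric] by (rule der_query_iff[OF assms])

lemma ex_computes_iff: "(\<exists>d. computes h d z (prod_encode (c, i))) \<longleftrightarrow> ev h [c, prod_encode (c, i)] z"
  unfolding computes_def der_iff_accepts[symmetric] by (rule der_value_iff)

text \<open>Supplies the condition \<open>m \<le> d\<close> of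
  \<open>represent_function\<close>.\<close>

lemma computes_le: "computes h d z x \<Longrightarrow> z \<le> d"
  unfolding computes_def using accepts_sound(2) le_prod_encode_2 by (meson le_trans)

theorem theorem4p7:
  fixes L :: sig and U X :: "fm set" and N :: interp and \<xi> :: fm
  assumes "ce_theory L U" and "consistent U" and "X \<subseteq> Sent L"
    and "eff_ef_ess_incomplete L U X N \<xi>"
  shows "\<exists>\<Phi>. eff_ess_incomplete_via L U X \<Phi> \<and>
    (\<forall>i v. \<Phi> i = Some v \<longrightarrow> (\<exists>\<sigma> \<in> Sent L. v = gn (at_gn N \<xi> \<sigma>)))"
proof -
  have U: "U \<subseteq> Sent L" using assms(1) by (simp add: ce_theory_def)
  have N: "interpretation_of sigA R L U N" and \<xi>: "wff L 1 \<xi>"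
    and indep: "\<And>p. p \<in> Sent L \<Longrightarrow> consistent (insert p U) \<Longrightarrow>
      independent (insert p U) (at_gn N \<xi> p) \<and> at_gn N \<xi> p \<in> X"
    using assms(4) by (auto simp: eff_ef_ess_incomplete_def)
  \<comment> \<open>With \<open>xs = [c, n]\<close> and \<open>c = gn p\<close> these are the
    numbers of \<open>p\<close> at \<open>n\<close> and of \<open>\<xi>\<close> at that sentence.
    The formula enters only through the argument \<open>c\<close>, so \<open>h0\<close> to
    \<open>h3\<close> exist before \<open>\<beta>\<close> is built from them and there is no
    circularity.\<close>
  let ?s = "\<lambda>xs. at_code N (xs ! 0) (xs ! 1)"
  let ?t = "\<lambda>xs. at_code N (gn \<xi>) (?s xs)"
  have s: "computable 2 ?s" by (intro computable_at_code computable_nth) simp_all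
  have t: "computable 2 ?t" by (intro computable_at_code computable_const s)
  obtain h0 where h0: "\<And>xs y. length xs = 2 \<Longrightarrow> ev h0 xs y \<longleftrightarrow> y = ?s xs"
    using computable_code[OF s] by blast
  obtain h1 where h1: "\<And>xs y. length xs = 2 \<Longrightarrow> ev h1 xs y \<longleftrightarrow> y = ?t xs"
    using computable_code[OF t] by blast
  obtain h2 where h2: "\<And>xs y. length xs = 2 \<Longrightarrow> ev h2 xs y \<longleftrightarrow> y = gNeg (?t xs)"
    using computable_code[OF computable_gNeg[OF t]] by blast
  obtain h3 where h3: "\<And>xs y. length xs = 2 \<Longrightarrow> ev h3 xs y \<longleftrightarrow> y = gNeg (?s xs)"
    using computable_code[OF computable_gNeg[OF s]] by blast
  obtain A where A: "wff sigA 1 A"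
    "\<And>n d. query h1 d n \<Longrightarrow> \<forall>d' \<le> d. \<not> query h3 d' n \<Longrightarrow> decides n True A"
    "\<And>n d. query h3 d n \<Longrightarrow> \<forall>d' < d. query h1 d' n \<longrightarrow> (\<exists>d'' \<le> d'. query h3 d'' n) \<Longrightarrow> decides n False A"
    using represent_rosser[OF def0_query[of h1] def0_query[of h3]] unfolding decides_def by auto
  obtain B where B: "wff sigA 1 B"
    "\<And>n d. query h2 d n \<Longrightarrow> \<forall>d' \<le> d. \<not> query h3 d' n \<Longrightarrow> decides n True B"
    "\<And>n d. query h3 d n \<Longrightarrow> \<forall>d' < d. query h2 d' n \<longrightarrow> (\<exists>d'' \<le> d'. query h3 d'' n) \<Longrightarrow> decides n False B"
    using represent_rosser[OF def0_query[of h2] def0_query[of h3]] unfolding decides_def by auto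
  obtain D where D: "wff sigA 2 D"
    "\<And>d m n. computes h0 d m n \<Longrightarrow> m \<le> d \<Longrightarrow> \<forall>d' m'. computes h0 d' m' n \<longrightarrow> m' = m \<Longrightarrow> represents n m D"
    using represent_function[OF def0_computes[of h0]] unfolding represents_def by blast
  define \<beta> where "\<beta> = diag_body N \<xi> D A B"
  \<comment> \<open>Self-reference: \<open>\<beta>\<close> is applied to a number carrying its own
    Goedel number, along with the index.\<close>
  define n where "n i = prod_encode (gn \<beta>, i)" for i
  define \<sigma> where "\<sigma> i = at_num N (n i) \<beta>" for i
  define \<tau> where "\<tau> i = at_gn N \<xi> (\<sigma> i)" for i
  have gn_\<sigma>: "at_code N (gn \<beta>) (n i) = gn (\<sigma> i)" for i
    by (simp only: \<sigma>_def gn_at_num)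
  have \<tau>: "\<tau> i = at_num N (gn (\<sigma> i)) \<xi>" for i by (simp only: \<tau>_def at_gn_eq)
  have gn_\<tau>: "at_code N (gn \<xi>) (gn (\<sigma> i)) = gn (\<tau> i)" for i
    by (simp only: \<tau> gn_at_num)
  have rep: "represents (n i) (gn (\<sigma> i)) D" for i
  proof -
    have "(\<exists>d. computes h0 d z (n i)) \<longleftrightarrow> z = gn (\<sigma> i)" for z
      unfolding n_def ex_computes_iff by (simp add: h0 gn_\<sigma>[unfolded n_def])
    then obtain d where "computes h0 d (gn (\<sigma> i)) (n i)" "\<forall>d' m'. computes h0 d' m' (n i) \<longrightarrow> m' = gn (\<sigma> i)"
      by blast
    then show ?thesis using D(2) computes_le by blast
  qed
  note diag = U N \<xi> rep D(1) A(1) B(1)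
  have \<sigma>_Sent: "\<sigma> i \<in> Sent L" for i
    using wf_diag(1)[OF diag] by (simp add: Sent_def \<sigma>_def \<beta>_def)
  have main: "\<tau> i \<in> X \<and> independent T (\<tau> i)"
    if T: "W i = gn ` T" "consistent T" "extends L T U" for i T
  proof -
    have q1: "(\<exists>d. query h1 d (n i)) \<longleftrightarrow> T \<turnstile> \<tau> i"
      unfolding n_def by (rule ex_query_iff[OF _ T(1)]) (simp add: h1 gn_\<sigma>[unfolded n_def] gn_\<tau>)
    have q2: "(\<exists>d. query h2 d (n i)) \<longleftrightarrow> T \<turnstile> Neg (\<tau> i)"
      unfolding n_def by (rule ex_query_iff[OF _ T(1)]) (simp add: h2 gn_\<sigma>[unfolded n_def] gn_\<tau> gn_simps)
    have q3: "(\<exists>d. query h3 d (n i)) \<longleftrightarrow> T \<turnstile> Neg (\<sigma> i)"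
      unfolding n_def by (rule ex_query_iff[OF _ T(1)]) (simp add: h3 gn_\<sigma>[unfolded n_def] gn_simps)
    have no: "\<not> (T \<turnstile> p \<and> T \<turnstile> Neg p)" for p
      using T(2) proves_Neg_E unfolding consistent_def by blast
    have first: "U \<turnstile> Imp (\<sigma> i) (\<tau> i)" if "decides (n i) True A"
      using diag_first[OF diag that] by (simp only: \<sigma>_def \<beta>_def \<tau>)
    have second: "U \<turnstile> Imp (\<sigma> i) (Neg (\<tau> i))" if "decides (n i) True B"
      using diag_second[OF diag that] by (simp only: \<sigma>_def \<beta>_def \<tau>)
    have "\<not> T \<turnstile> Neg (\<sigma> i)"
    proof
      assume "T \<turnstile> Neg (\<sigma> i)"
      then obtain d where d: "query h3 d (n i)" using q3 by blast
      \<comment> \<open>Either a proof of \<open>\<tau> i\<close> is found below \<open>d\<close>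
        before any refutation of \<open>\<sigma> i\<close>, so the comparison is true, or the
        refutation at \<open>d\<close> makes it false.\<close>
      have "(T \<turnstile> \<tau> i \<and> decides (n i) True A) \<or> decides (n i) False A"
        using A(2,3)[of _ "n i"] d q1 by (metis linorder_not_le)
      moreover have "(T \<turnstile> Neg (\<tau> i) \<and> decides (n i) True B) \<or> decides (n i) False B"
        using B(2,3)[of _ "n i"] d q2 by (metis linorder_not_le)
      ultimately obtain a b where ab: "decides (n i) a A" "decides (n i) b B"
        "a \<longrightarrow> T \<turnstile> \<tau> i" "b \<longrightarrow> T \<turnstile> Neg (\<tau> i)"
        by metis
      have "U \<turnstile> Imp (if a then \<tau> i else Neg Bot) (Imp (if b then Neg (\<tau> i) else Neg Bot) (\<sigma> i))"
        using diag_decided[OF diag ab(1,2)] by (simp only: \<sigma>_def \<beta>_def \<tau>)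
      then have "T \<turnstile> Imp (if a then \<tau> i else Neg Bot) (Imp (if b then Neg (\<tau> i) else Neg Bot) (\<sigma> i))"
        by (rule proves_extension[OF T(3)])
      moreover have "T \<turnstile> Neg Bot"
        unfolding Neg_def by (rule proves.impI, rule proves.assm) simp
      ultimately have "T \<turnstile> \<sigma> i"
        using ab(3,4) proves.impE by (metis (full_types))
      then show False using no \<open>T \<turnstile> Neg (\<sigma> i)\<close> by blast
    qed
    \<comment> \<open>Contrapositively, since \<open>T\<close> does not refute
      \<open>\<sigma> i\<close>, neither does \<open>U\<close>; this is the consistency that the
      hypothesis asks for.\<close>
    moreover have "T \<turnstile> Neg (\<sigma> i)" if "\<not> consistent (insert (\<sigma> i) U)"
      using that unfolding Neg_def consistent_def
      by (intro proves_extension[OF T(3)] proves.impI) simp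
    ultimately have "independent (insert (\<sigma> i) U) (\<tau> i)" and X: "\<tau> i \<in> X"
      using indep[OF \<sigma>_Sent] unfolding \<tau>_def by blast+
    moreover have "insert (\<sigma> i) U \<turnstile> p" if "U \<turnstile> Imp (\<sigma> i) p" for p
      by (rule proves.impE[OF proves_weaken[OF that] proves.assm]) auto
    ultimately have "\<not> decides (n i) True A" "\<not> decides (n i) True B"
      using first second unfolding independent_def by blast+
    \<comment> \<open>Without refutations of \<open>\<sigma> i\<close>, any decision of
      \<open>\<tau> i\<close> by \<open>T\<close> would win its Rosser comparison, so
      \<open>A\<close> or \<open>B\<close> would be decided positively.\<close>
    moreover have "\<not> query h3 d (n i)" for d
      using q3 \<open>\<not> T \<turnstile> Neg (\<sigma> i)\<close> by blast
    ultimately have "independent T (\<tau> i)"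
      unfolding independent_def using A(2) B(2) q1 q2 by blast
    with X show ?thesis by blast
  qed
  have "computable 1 (\<lambda>xs. at_code N (gn \<xi>) (at_code N (gn \<beta>) (prod_encode (gn \<beta>, xs ! 0))))"
    by (intro computable_at_code computable_const computable_prod_encode computable_nth) simp
  from computable_code[OF this] obtain f where
    "\<And>xs y. length xs = 1 \<Longrightarrow>
      ev f xs y \<longleftrightarrow> y = at_code N (gn \<xi>) (at_code N (gn \<beta>) (prod_encode (gn \<beta>, xs ! 0)))"
    by blast
  then have "ev f [i] y \<longleftrightarrow> y = gn (\<tau> i)" for i y
    using gn_\<sigma> gn_\<tau> by (simp add: n_def)
  \<comment> \<open>The witness is total: \<open>\<sigma> i\<close> is a sentence for every
    \<open>i\<close>, whatever \<open>W i\<close> enumerates.\<close>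
  then have "partial_computable (\<lambda>i. Some (gn (\<tau> i)))"
    unfolding partial_computable_def by (intro exI[of _ f]) auto
  then have "eff_ess_incomplete_via L U X (\<lambda>i. Some (gn (\<tau> i)))"
    unfolding eff_ess_incomplete_via_def using main by blast
  then show ?thesis
    using \<sigma>_Sent by (intro exI[of _ "\<lambda>i. Some (gn (\<tau> i))"]) (auto simp: \<tau>_def)
qed

end
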